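(* Let $G$ and $H$ be graphs, let $K=H^G$ be the exponential graph, and let $\Delta=\mathrm{Hom}(G,H)$ be the polyhedral hom complex. Then there is an equivalence of categories $\Pi^\ell(K)\simeq\Pi(\Delta)$, where $\Pi^\ell(K)$ is the looped fundamental groupoid of the graph $K$ and $\Pi(\Delta)$ is the topological fundamental groupoid of the space $\Delta$.
   Context: A graph $G$ is undirected without multiple edges, loops allowed: a vertex set $V(G)$ with a symmetric adjacency relation $\sim$; edges $E(G)$ are regarded as (symmetric) pairs. A graph morphism $f: G\to H$ is a map $V(G)\to V(H)$ with $v_1\sim v_2 \Rightarrow f(v_1)\sim f(v_2)$. The product $G\times H$ has vertices $V(G)\times V(H)$, with $(v_1,w_1)\sim(v_2,w_2)$ iff $v_1\sim v_2$ and $w_1\sim w_2$. $I_n^\ell$ is the graph on $\{0,\dots,n\}$ whose edges are $i\sim i$ and $i\sim i+1$. Exponential graph: $H^G$ has as vertices all set maps $f:V(G)\to V(H)$, with $f\sim g$ iff $f(v_1)\sim g(v_2)$ in $H$ whenever $v_1\sim v_2$ in $G$; its looped vertices are exactly the graph morphisms $G\to H$. Looped fundamental groupoid: a looped walk of length $n\ge0$ in a graph $K$ is a morphism $I_n^\ell\to K$, written $(v_0v_1\dots v_n)$ (so all $v_i$ are looped and $v_i\sim v_{i+1}$). An $\ell$-prune of a looped walk is obtained either by deleting $v_i,v_{i+1}$ when $v_i=v_{i+2}$, or by deleting one of $v_i,v_{i+1}$ when $v_i=v_{i+1}$. Two looped walks $\alpha,\beta$ of length $n$ from $x$ to $y$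 are homotopic rel endpoints if there are $m\ge0$ and a morphism $\Lambda:I_n^\ell\times I_m^\ell\to K$ with $\Lambda(\cdot,0)=\alpha$, $\Lambda(\cdot,m)=\beta$, $\Lambda(0,j)=x$ and $\Lambda(n,j)=y$ for all $j$. $\Pi^\ell(K)$ has as objects the looped vertices of $K$; arrows from $v$ to $w$ are classes of looped walks from $v$ to $w$ under the equivalence relation generated by $\ell$-prunes and homotopy rel endpoints; composition is induced by concatenation. Hom complex: $\mathrm{Hom}(G,H)$ is the polyhedral complex with cells indexed by functions $\eta:V(G)\to 2^{V(H)}\setminus\{\emptyset\}$ such that $x\sim y$ in $G$ implies $\eta(x)\times\eta(y)\subseteq E(H)$; the cell indexed by $\eta$ is the product over $x\in V(G)$ of the simplices with vertex sets $\eta(x)$, and the boundary attachments are defined by the inclusions $\eta\subseteq\eta'$ (that is, $\eta(x)\subseteq\eta'(x)$ for all $x$). In particular $0$-cells are the graph morphisms $G\to H$; $1$-cells have a single vertex $v$ with $|\eta(v)|=2$ and join the two morphisms given by the two choices of image of $v$; $2$-cells are triangles (a single vertex $v$ with $|\eta(v)|=3$) or squares (two vertices $v,w$ with $|\eta(v)|=|\eta(w)|=2$), all other values of $\eta$ being singletons. *)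

theory Defs
  imports "HOL-Analysis.Analysis"
begin

section \<open>Categories and their equivalence\<close>

text \<open>
  Hom-sets are pairwise disjoint, so composition needs no object arguments. It is written in
  diagrammatic order: \<open>Comp C f g\<close> is first \<open>f\<close>, then \<open>g\<close>.
\<close>

record ('o, 'm) category =
  Obj :: "'o set"
  Hom :: "'o \<Rightarrow> 'o \<Rightarrow> 'm set"
  Id :: "'o \<Rightarrow> 'm"
  Comp :: "'m \<Rightarrow> 'm \<Rightarrow> 'm"

definition is_category :: "('o, 'm) category \<Rightarrow> bool" where
  "is_category C \<longleftrightarrow>
     (\<forall>x\<in>Obj C. \<forall>y\<in>Obj C. \<forall>x'\<in>Obj C. \<forall>y'\<in>Obj C.
        Hom C x y \<inter> Hom C x' y' \<noteq> {} \<longrightarrow> x = x' \<and> y = y') \<and>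
     (\<forall>x\<in>Obj C. Id C x \<in> Hom C x x) \<and>
     (\<forall>x\<in>Obj C. \<forall>y\<in>Obj C. \<forall>z\<in>Obj C. \<forall>f\<in>Hom C x y. \<forall>g\<in>Hom C y z. Comp C f g \<in> Hom C x z) \<and>
     (\<forall>x\<in>Obj C. \<forall>y\<in>Obj C. \<forall>f\<in>Hom C x y. Comp C (Id C x) f = f \<and> Comp C f (Id C y) = f) \<and>
     (\<forall>w\<in>Obj C. \<forall>x\<in>Obj C. \<forall>y\<in>Obj C. \<forall>z\<in>Obj C.
        \<forall>f\<in>Hom C w x. \<forall>g\<in>Hom C x y. \<forall>h\<in>Hom C y z.
          Comp C (Comp C f g) h = Comp C f (Comp C g h))"

definition is_functor ::
  "('o, 'm) category \<Rightarrow> ('p, 'n) category \<Rightarrow> ('o \<Rightarrow> 'p) \<Rightarrow> ('m \<Rightarrow> 'n) \<Rightarrow> bool" where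
  "is_functor C D Fo Fa \<longleftrightarrow>
     (\<forall>x\<in>Obj C. Fo x \<in> Obj D) \<and>
     (\<forall>x\<in>Obj C. \<forall>y\<in>Obj C. \<forall>f\<in>Hom C x y. Fa f \<in> Hom D (Fo x) (Fo y)) \<and>
     (\<forall>x\<in>Obj C. Fa (Id C x) = Id D (Fo x)) \<and>
     (\<forall>x\<in>Obj C. \<forall>y\<in>Obj C. \<forall>z\<in>Obj C. \<forall>f\<in>Hom C x y. \<forall>g\<in>Hom C y z.
        Fa (Comp C f g) = Comp D (Fa f) (Fa g))"

definition is_iso :: "('o, 'm) category \<Rightarrow> 'o \<Rightarrow> 'o \<Rightarrow> 'm \<Rightarrow> bool" where
  "is_iso C x y f \<longleftrightarrow>
     f \<in> Hom C x y \<and> (\<exists>g\<in>Hom C y x. Comp C f g = Id C x \<and> Comp C g f = Id C y)"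

definition is_natural_iso ::
  "('o, 'm) category \<Rightarrow> ('p, 'n) category \<Rightarrow> ('o \<Rightarrow> 'p) \<Rightarrow> ('m \<Rightarrow> 'n) \<Rightarrow>
     ('o \<Rightarrow> 'p) \<Rightarrow> ('m \<Rightarrow> 'n) \<Rightarrow> ('o \<Rightarrow> 'n) \<Rightarrow> bool" where
  "is_natural_iso C D Fo Fa Go Ga \<theta> \<longleftrightarrow>
     (\<forall>x\<in>Obj C. is_iso D (Fo x) (Go x) (\<theta> x)) \<and>
     (\<forall>x\<in>Obj C. \<forall>y\<in>Obj C. \<forall>f\<in>Hom C x y. Comp D (Fa f) (\<theta> y) = Comp D (\<theta> x) (Ga f))"

definition equivalent_categories :: "('o, 'm) category \<Rightarrow> ('p, 'n) category \<Rightarrow> bool" where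
  "equivalent_categories C D \<longleftrightarrow>
     is_category C \<and> is_category D \<and>
     (\<exists>Fo Fa Go Ga.
        is_functor C D Fo Fa \<and> is_functor D C Go Ga \<and>
        (\<exists>\<eta>. is_natural_iso C C id id (Go \<circ> Fo) (Ga \<circ> Fa) \<eta>) \<and>
        (\<exists>\<epsilon>. is_natural_iso D D (Fo \<circ> Go) (Fa \<circ> Ga) id id \<epsilon>))"


section \<open>Graphs\<close>

record 'a ugraph =
  verts :: "'a set"
  edges :: "('a \<times> 'a) set"

definition is_graph :: "'a ugraph \<Rightarrow> bool" where
  "is_graph G \<longleftrightarrow> edges G \<subseteq> verts G \<times> verts G \<and> sym (edges G)"

definition graph_morphism :: "'a ugraph \<Rightarrow> 'b ugraph \<Rightarrow> ('a \<Rightarrow> 'b) \<Rightarrow> bool" where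
  "graph_morphism G H f \<longleftrightarrow>
     f \<in> verts G \<rightarrow> verts H \<and> (\<forall>(v, w)\<in>edges G. (f v, f w) \<in> edges H)"

definition graph_product :: "'a ugraph \<Rightarrow> 'b ugraph \<Rightarrow> ('a \<times> 'b) ugraph" where
  "graph_product G H =
     \<lparr>verts = verts G \<times> verts H,
      edges = {((v1, w1), (v2, w2)). (v1, v2) \<in> edges G \<and> (w1, w2) \<in> edges H}\<rparr>"

definition looped_path_graph :: "nat \<Rightarrow> nat ugraph" where
  "looped_path_graph n =
     \<lparr>verts = {0..n},
      edges = {(i, j). i \<le> n \<and> j \<le> n \<and> (i = j \<or> j = Suc i \<or> i = Suc j)}\<rparr>"

text \<open>Set maps \<open>V(G) \<rightarrow> V(H)\<close> are represented by functions that are \<^const>\<open>undefined\<close> off \<open>V(G)\<close>.\<close>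

definition exp_graph :: "'b ugraph \<Rightarrow> 'a ugraph \<Rightarrow> ('a \<Rightarrow> 'b) ugraph" where
  "exp_graph H G =
     \<lparr>verts = verts G \<rightarrow>\<^sub>E verts H,
      edges = {(f, g). f \<in> verts G \<rightarrow>\<^sub>E verts H \<and> g \<in> verts G \<rightarrow>\<^sub>E verts H \<and>
                 (\<forall>(v1, v2)\<in>edges G. (f v1, g v2) \<in> edges H)}\<rparr>"

definition looped_verts :: "'a ugraph \<Rightarrow> 'a set" where
  "looped_verts K = {v \<in> verts K. (v, v) \<in> edges K}"


section \<open>The looped fundamental groupoid of a graph\<close>

text \<open>The looped walk \<open>(v\<^sub>0 v\<^sub>1 \<dots> v\<^sub>n)\<close> is represented by the list of its \<open>n + 1\<close> vertices.\<close>

definition looped_walk :: "'a ugraph \<Rightarrow> 'a list \<Rightarrow> bool" where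
  "looped_walk K \<alpha> \<longleftrightarrow>
     \<alpha> \<noteq> [] \<and> graph_morphism (looped_path_graph (length \<alpha> - 1)) K (\<lambda>i. \<alpha> ! i)"

definition looped_walks :: "'a ugraph \<Rightarrow> 'a \<Rightarrow> 'a \<Rightarrow> 'a list set" where
  "looped_walks K x y = {\<alpha>. looped_walk K \<alpha> \<and> hd \<alpha> = x \<and> last \<alpha> = y}"

inductive looped_prune :: "'a list \<Rightarrow> 'a list \<Rightarrow> bool" where
  "looped_prune (\<alpha> @ [v, w, v] @ \<beta>) (\<alpha> @ [v] @ \<beta>)"
| "looped_prune (\<alpha> @ [v, v] @ \<beta>) (\<alpha> @ [v] @ \<beta>)"

definition walk_homotopic :: "'a ugraph \<Rightarrow> 'a list \<Rightarrow> 'a list \<Rightarrow> bool" where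
  "walk_homotopic K \<alpha> \<beta> \<longleftrightarrow>
     (\<exists>n x y. \<alpha> \<in> looped_walks K x y \<and> \<beta> \<in> looped_walks K x y \<and>
        length \<alpha> = Suc n \<and> length \<beta> = Suc n \<and>
        (\<exists>m \<Lambda>. graph_morphism (graph_product (looped_path_graph n) (looped_path_graph m)) K \<Lambda> \<and>
           (\<forall>i\<le>n. \<Lambda> (i, 0) = \<alpha> ! i) \<and> (\<forall>i\<le>n. \<Lambda> (i, m) = \<beta> ! i) \<and>
           (\<forall>j\<le>m. \<Lambda> (0, j) = x) \<and> (\<forall>j\<le>m. \<Lambda> (n, j) = y)))"

definition walk_equiv :: "'a ugraph \<Rightarrow> ('a list \<times> 'a list) set" where
  "walk_equiv K =
     {(\<alpha>, \<beta>). equivclp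
        (\<lambda>\<alpha> \<beta>. looped_walk K \<alpha> \<and> looped_walk K \<beta> \<and> (looped_prune \<alpha> \<beta> \<or> walk_homotopic K \<alpha> \<beta>)) \<alpha> \<beta>}"

definition looped_fundamental_groupoid :: "'a ugraph \<Rightarrow> ('a, 'a list set) category" where
  "looped_fundamental_groupoid K =
     \<lparr>Obj = looped_verts K,
      Hom = (\<lambda>x y. looped_walks K x y // walk_equiv K),
      Id = (\<lambda>x. walk_equiv K `` {[x]}),
      Comp = (\<lambda>A B. \<Union>\<alpha>\<in>A. \<Union>\<beta>\<in>B. walk_equiv K `` {\<alpha> @ tl \<beta>})\<rparr>"


section \<open>The fundamental groupoid of a topological space\<close>

definition paths_between :: "'p topology \<Rightarrow> 'p \<Rightarrow> 'p \<Rightarrow> (real \<Rightarrow> 'p) set" where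
  "paths_between X x y = {p. pathin X p \<and> p 0 = x \<and> p 1 = y}"

definition path_concat :: "(real \<Rightarrow> 'p) \<Rightarrow> (real \<Rightarrow> 'p) \<Rightarrow> real \<Rightarrow> 'p" where
  "path_concat p q = (\<lambda>t. if t \<le> 1/2 then p (2 * t) else q (2 * t - 1))"

text \<open>
  Homotopy rel endpoints. Values of paths outside the unit interval are irrelevant: paths that
  agree on it are related.
\<close>

definition path_equiv :: "'p topology \<Rightarrow> ((real \<Rightarrow> 'p) \<times> (real \<Rightarrow> 'p)) set" where
  "path_equiv X =
     {(p, q). homotopic_with (\<lambda>h. h 0 = p 0 \<and> h 1 = p 1) (top_of_set {0..1}) X p q}"

definition fundamental_groupoid :: "'p topology \<Rightarrow> ('p, (real \<Rightarrow> 'p) set) category" where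
  "fundamental_groupoid X =
     \<lparr>Obj = topspace X,
      Hom = (\<lambda>x y. paths_between X x y // path_equiv X),
      Id = (\<lambda>x. path_equiv X `` {\<lambda>t. x}),
      Comp = (\<lambda>A B. \<Union>p\<in>A. \<Union>q\<in>B. path_equiv X `` {path_concat p q})\<rparr>"


section \<open>The polyhedral hom complex\<close>

text \<open>The union of a family of spaces, with a set open iff it meets each member in an open set.\<close>

definition coherent_topology :: "'p topology set \<Rightarrow> 'p topology" where
  "coherent_topology \<T> =
     topology (\<lambda>U. U \<subseteq> (\<Union>T\<in>\<T>. topspace T) \<and> (\<forall>T\<in>\<T>. openin T (U \<inter> topspace T)))"

lemma openin_coherent_topology:
  "openin (coherent_topology \<T>) U \<longleftrightarrow>
     U \<subseteq> (\<Union>T\<in>\<T>. topspace T) \<and> (\<forall>T\<in>\<T>. openin T (U \<inter> topspace T))"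
proof -
  have "istopology (\<lambda>U. U \<subseteq> (\<Union>T\<in>\<T>. topspace T) \<and> (\<forall>T\<in>\<T>. openin T (U \<inter> topspace T)))"
    unfolding istopology_def
  proof (intro conjI allI impI ballI)
    fix S T T' assume "S \<subseteq> (\<Union>T\<in>\<T>. topspace T) \<and> (\<forall>T\<in>\<T>. openin T (S \<inter> topspace T))"
      and "T \<subseteq> (\<Union>T\<in>\<T>. topspace T) \<and> (\<forall>T'\<in>\<T>. openin T' (T \<inter> topspace T'))" and "T' \<in> \<T>"
    then have "openin T' ((S \<inter> topspace T') \<inter> (T \<inter> topspace T'))" by blast
    moreover have "(S \<inter> topspace T') \<inter> (T \<inter> topspace T') = S \<inter> T \<inter> topspace T'" by blast
    ultimately show "openin T' (S \<inter> T \<inter> topspace T')" by simp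
  next
    fix \<K> T
    assume K: "\<forall>K\<in>\<K>. K \<subseteq> (\<Union>T\<in>\<T>. topspace T) \<and> (\<forall>T\<in>\<T>. openin T (K \<inter> topspace T))" "T \<in> \<T>"
    then have "openin T (\<Union>K\<in>\<K>. K \<inter> topspace T)" by blast
    moreover have "(\<Union>K\<in>\<K>. K \<inter> topspace T) = \<Union>\<K> \<inter> topspace T" by blast
    ultimately show "openin T (\<Union>\<K> \<inter> topspace T)" by simp
  qed blast+
  then show ?thesis
    unfolding coherent_topology_def by (simp add: topology_inverse')
qed

lemma topspace_coherent_topology: "topspace (coherent_topology \<T>) = (\<Union>T\<in>\<T>. topspace T)"
proof (rule antisym)
  show "topspace (coherent_topology \<T>) \<subseteq> (\<Union>T\<in>\<T>. topspace T)"
    using openin_topspace[of "coherent_topology \<T>"] by (simp only: openin_coherent_topology)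
  have "openin T ((\<Union>T\<in>\<T>. topspace T) \<inter> topspace T)" if "T \<in> \<T>" for T
  proof -
    have "(\<Union>T\<in>\<T>. topspace T) \<inter> topspace T = topspace T" using that by blast
    then show ?thesis by simp
  qed
  then have "openin (coherent_topology \<T>) (\<Union>T\<in>\<T>. topspace T)"
    by (simp add: openin_coherent_topology)
  then show "(\<Union>T\<in>\<T>. topspace T) \<subseteq> topspace (coherent_topology \<T>)"
    by (rule openin_subset)
qed

text \<open>
  The simplex on a vertex set \<open>S\<close>, in barycentric coordinates (extended by 0 off \<open>S\<close>). For finite
  \<open>S\<close> the topology is the Euclidean one; for infinite \<open>S\<close> it is the weak topology determined by
  the finite faces.
\<close>

definition simplex_points :: "'b set \<Rightarrow> ('b \<Rightarrow> real) set" where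
  "simplex_points S =
     {p. finite {v. p v \<noteq> 0} \<and> {v. p v \<noteq> 0} \<subseteq> S \<and> (\<forall>v. 0 \<le> p v) \<and> (\<Sum>v | p v \<noteq> 0. p v) = 1}"

definition simplex_space :: "'b set \<Rightarrow> ('b \<Rightarrow> real) topology" where
  "simplex_space S =
     coherent_topology
       ((\<lambda>F. subtopology (powertop_real UNIV) (simplex_points F)) ` {F. F \<subseteq> S \<and> finite F})"

lemma topspace_simplex_space: "topspace (simplex_space S) = simplex_points S"
proof -
  have "topspace (simplex_space S) = (\<Union>F\<in>{F. F \<subseteq> S \<and> finite F}. simplex_points F)"
    by (simp add: simplex_space_def topspace_coherent_topology)
  also have "\<dots> = simplex_points S"
  proof
    show "(\<Union>F\<in>{F. F \<subseteq> S \<and> finite F}. simplex_points F) \<subseteq> simplex_points S"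
      unfolding simplex_points_def by blast
    show "simplex_points S \<subseteq> (\<Union>F\<in>{F. F \<subseteq> S \<and> finite F}. simplex_points F)"
    proof
      fix p assume "p \<in> simplex_points S"
      then have "p \<in> simplex_points {v. p v \<noteq> 0}" "{v. p v \<noteq> 0} \<subseteq> S" "finite {v. p v \<noteq> 0}"
        unfolding simplex_points_def by simp_all
      then show "p \<in> (\<Union>F\<in>{F. F \<subseteq> S \<and> finite F}. simplex_points F)" by blast
    qed
  qed
  finally show ?thesis .
qed

definition multihoms :: "'a ugraph \<Rightarrow> 'b ugraph \<Rightarrow> ('a \<Rightarrow> 'b set) set" where
  "multihoms G H =
     {\<eta> \<in> verts G \<rightarrow>\<^sub>E (Pow (verts H) - {{}}). \<forall>(x, y)\<in>edges G. \<eta> x \<times> \<eta> y \<subseteq> edges H}"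

text \<open>
  All cells are realised inside the families of barycentric coordinates, so that \<open>\<eta> \<subseteq> \<eta>'\<close> makes
  the cell of \<open>\<eta>\<close> a face of the cell of \<open>\<eta>'\<close> and gluing along these inclusions is taking the union
  with the coherent topology. Neither graph is assumed finite: cells carry the product topology,
  also for infinite \<open>V(G)\<close>.
\<close>

definition hom_complex :: "'a ugraph \<Rightarrow> 'b ugraph \<Rightarrow> ('a \<Rightarrow> 'b \<Rightarrow> real) topology" where
  "hom_complex G H =
     coherent_topology ((\<lambda>\<eta>. product_topology (\<lambda>x. simplex_space (\<eta> x)) (verts G)) ` multihoms G H)"

end

theory Submission
  imports Defs "HOL-Library.Ramsey"
begin

text \<open>
  Call two points of \<open>Hom(G,H)\<close> compatible if they lie in a common cell. This can be read off from
  their supports, and a set of points lies in one cell as soon as its points are pairwise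
  compatible. Compatible points are joined by a straight segment, and choosing a vertex in the
  support of each point turns compatibility into adjacency in \<open>H\<^sup>G\<close>.

  A looped walk is realised by its polygonal path: moves of walks are generated by
  \<open>(v v) \<leadsto> (v)\<close> and \<open>(a b c) \<leadsto> (a c)\<close> with \<open>a \<sim> c\<close>, and the latter holds for segments because
  \<open>a, b, c\<close> span a cell. Conversely, a path is locally contained in the star of each of its points,
  so it can be transported to the groupoid of walks through finitely many centres; subdividing a
  homotopy into squares contained in stars shows that the result depends on the homotopy class
  only. Both composites are computed on edges and on segments.

  Infinite graphs need care, since a path may then meet infinitely many cells and no finite number
  of cells need cover it; locality of compatibility rests on Ramsey's theorem.
\<close>

subsection \<open>Paths up to homotopy\<close>

text \<open>Adjacent looped vertices of the exponential graph may differ at infinitely many vertices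
  of \<open>G\<close>, so an edge need not be a finite composite of 1-cells, and the edge-path
  groupoid of the 2-skeleton cannot serve as intermediary. Straight segments through product cells
  take its place.

  Pairwise compatibility suffices for a common cell because the condition on a multihom speaks of
  two values at a time. Compatibility is not transitive, however, so only coherence on pairwise
  compatible triples is available. This one law is the triangle move for walks and the contractible
  triangle for segments. Accordingly, a functor on walks is given by its values on edges, and a
  functor on paths by its values on compatible pairs of points.

  A 0-cell has singleton supports, so choosing a vertex of it gives it back: the composite on walks
  is the identity on objects and on arrows. All the work of naturality lies on the topological side,
  where a point is joined to its chosen vertex by a segment.\<close>

lemma prod_top_of_set: "prod_topology (top_of_set A) (top_of_set B) = top_of_set (A \<times> B)"
  by (simp add: subtopology_Times[symmetric] euclidean_product_topology)

text \<open>The first coordinate of \<open>h\<close> is the deformation parameter, the second the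
  time along the path. The endpoint condition in \<open>path_equiv\<close> only looks at the times 0
  and 1, so it is insensitive to values outside the unit interval, as \<open>homotopic_with\<close>
  demands.\<close>

lemma path_equiv_iff:
  "(p, q) \<in> path_equiv X \<longleftrightarrow>
     (\<exists>h. continuous_map (top_of_set ({0..1::real} \<times> {0..1})) X h \<and>
        (\<forall>t\<in>{0..1}. h (0, t) = p t) \<and> (\<forall>t\<in>{0..1}. h (1, t) = q t) \<and>
        (\<forall>s\<in>{0..1}. h (s, 0) = p 0 \<and> h (s, 1) = p 1))"
proof -
  have "homotopic_with (\<lambda>h. h 0 = p 0 \<and> h 1 = p 1) (top_of_set {0..1}) X p q \<longleftrightarrow>
     (\<exists>h. continuous_map (prod_topology (top_of_set {0..1::real}) (top_of_set {0..1})) X h \<and>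
          (\<forall>t\<in>topspace (top_of_set {0..1}). h (0, t) = p t) \<and>
          (\<forall>t\<in>topspace (top_of_set {0..1}). h (1, t) = q t) \<and>
          (\<forall>s\<in>{0..1}. h (s, 0) = p 0 \<and> h (s, 1) = p 1))"
    by (rule homotopic_with) auto
  then show ?thesis
    by (simp add: path_equiv_def prod_top_of_set)
qed

lemma path_equiv_props:
  assumes "(p, q) \<in> path_equiv X"
  shows "pathin X p" "pathin X q" "q 0 = p 0" "q 1 = p 1"
  using homotopic_with_imp_continuous_maps[of _ "top_of_set {0..1}" X p q]
    homotopic_with_imp_property[of _ "top_of_set {0..1}" X p q] assms
  unfolding path_equiv_def pathin_def by blast+

lemma path_equiv_refl: "pathin X p \<Longrightarrow> (p, p) \<in> path_equiv X"
  by (simp add: path_equiv_def pathin_def)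

lemma path_equiv_sym: "(p, q) \<in> path_equiv X \<Longrightarrow> (q, p) \<in> path_equiv X"
  using path_equiv_props[of p q X] homotopic_with_symD[of _ "top_of_set {0..1}" X p q]
  by (simp add: path_equiv_def)

lemma path_equiv_trans:
  "(p, q) \<in> path_equiv X \<Longrightarrow> (q, r) \<in> path_equiv X \<Longrightarrow> (p, r) \<in> path_equiv X"
  using path_equiv_props[of p q X] homotopic_with_trans[of _ "top_of_set {0..1}" X p q r]
  by (simp add: path_equiv_def)

lemma path_equiv_eq_on:
  assumes "pathin X p" "\<And>t. t \<in> {0..1} \<Longrightarrow> q t = p t"
  shows "(p, q) \<in> path_equiv X"
  using assms unfolding path_equiv_def pathin_def
  by (auto intro!: homotopic_with_equal)

text \<open>\<open>X\<close> has no linear structure, so the straight-line homotopy is performed in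
  the parameter domain \<open>S\<close> and pushed forward along \<open>H\<close>.
  Reparametrisation, associativity, the unit laws and the square lemma all reduce to this.\<close>

lemma path_equiv_convex:
  fixes S :: "'c::real_normed_vector set"
  assumes S: "convex S" and H: "continuous_map (top_of_set S) X H"
    and \<gamma>: "continuous_on {0..1} \<gamma>" "\<gamma> \<in> {0..1} \<rightarrow> S"
    and \<gamma>': "continuous_on {0..1} \<gamma>'" "\<gamma>' \<in> {0..1} \<rightarrow> S"
    and ends: "\<gamma> 0 = \<gamma>' 0" "\<gamma> 1 = \<gamma>' 1"
  shows "(H \<circ> \<gamma>, H \<circ> \<gamma>') \<in> path_equiv X"
proof -
  have "homotopic_paths S \<gamma> \<gamma>'"
  proof (rule homotopic_paths_linear)
    fix t :: real assume "t \<in> {0..1}"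
    then have "\<gamma> t \<in> S" "\<gamma>' t \<in> S" using \<gamma> \<gamma>' by blast+
    then show "closed_segment (\<gamma> t) (\<gamma>' t) \<subseteq> S" using S closed_segment_subset by blast
  qed (use assms in \<open>auto simp: path_def pathstart_def pathfinish_def\<close>)
  then have "homotopic_with (\<lambda>r. pathstart r = pathstart \<gamma> \<and> pathfinish r = pathfinish \<gamma>)
               (top_of_set {0..1}) (top_of_set S) \<gamma> \<gamma>'"
    by (simp add: homotopic_paths_def)
  from homotopic_with_compose_continuous_map_left[OF this H]
  show ?thesis
    by (simp add: path_equiv_def pathstart_def pathfinish_def)
qed

lemma path_equiv_reparam:
  assumes p: "pathin X p"
    and f: "continuous_on {0..1} f" "f \<in> {0..1} \<rightarrow> {0..1}"
    and g: "continuous_on {0..1} g" "g \<in> {0..1} \<rightarrow> {0..1}"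
    and "f 0 = g 0" "f 1 = g 1"
  shows "(\<lambda>t. p (f t), \<lambda>t. p (g t)) \<in> path_equiv X"
  using path_equiv_convex[OF _ _ f g, of X p] p assms(6,7)
  unfolding pathin_def o_def by (simp add: convex_real_interval)

lemma pathin_compose:
  assumes "continuous_map (top_of_set S) X H" "continuous_on {0..1} \<gamma>" "\<gamma> \<in> {0..1} \<rightarrow> S"
  shows "pathin X (\<lambda>t. H (\<gamma> t))"
  unfolding pathin_def
  using continuous_map_compose[of "top_of_set {0..1}" "top_of_set S" \<gamma> X H] assms
  by (auto simp: o_def)

lemma path_concat_0 [simp]: "path_concat p q 0 = p 0"
  and path_concat_1 [simp]: "path_concat p q 1 = q 1"
  by (simp_all add: path_concat_def)

lemma path_concat_eqI:
  assumes "\<And>t. t \<le> 1/2 \<Longrightarrow> r t = p (2 * t)" "\<And>t. 1/2 \<le> t \<Longrightarrow> r t = q (2 * t - 1)"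
  shows "path_concat p q = r"
  using assms by (force simp: path_concat_def)

text \<open>The set \<open>A\<close> allows two uses: \<open>A = {0}\<close> concatenates paths and
  the unit interval concatenates homotopies.\<close>

lemma continuous_map_concat_slice:
  assumes h: "continuous_map (top_of_set (A \<times> {0..1::real})) X h"
    and k: "continuous_map (top_of_set (A \<times> {0..1})) X k"
    and hk: "\<And>s. s \<in> A \<Longrightarrow> h (s, 1) = k (s, 0)"
  shows "continuous_map (top_of_set (A \<times> {0..1::real})) X
           (\<lambda>(s, t). if t \<le> 1/2 then h (s, 2 * t) else k (s, 2 * t - 1))"
proof -
  let ?D = "top_of_set (A \<times> {0..1::real})"
  have "continuous_map ?D X (\<lambda>z. if snd z \<le> 1/2 then (h \<circ> (\<lambda>z. (fst z, 2 * snd z))) z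
                                      else (k \<circ> (\<lambda>z. (fst z, 2 * snd z - 1))) z)"
  proof (rule continuous_map_cases_le)
    show "continuous_map (subtopology ?D {z. z \<in> topspace ?D \<and> snd z \<le> 1/2}) X
            (h \<circ> (\<lambda>z. (fst z, 2 * snd z)))"
      by (rule continuous_map_compose[OF _ h])
        (auto simp: subtopology_subtopology intro!: continuous_intros)
    show "continuous_map (subtopology ?D {z. z \<in> topspace ?D \<and> 1/2 \<le> snd z}) X
            (k \<circ> (\<lambda>z. (fst z, 2 * snd z - 1)))"
      by (rule continuous_map_compose[OF _ k])
        (auto simp: subtopology_subtopology intro!: continuous_intros)
    fix z assume "z \<in> topspace ?D" "snd z = 1/2"
    then show "(h \<circ> (\<lambda>z. (fst z, 2 * snd z))) z = (k \<circ> (\<lambda>z. (fst z, 2 * snd z - 1))) z"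
      using hk[of "fst z"] by (cases z) (simp add: mult.commute)
  qed (auto intro!: continuous_intros)
  then show ?thesis
    by (simp add: case_prod_unfold o_def cong: if_cong)
qed

lemma pathin_iff_slice:
  "pathin X p \<longleftrightarrow> continuous_map (top_of_set ({0::real} \<times> {0..1})) X (\<lambda>z. p (snd z))"
proof
  assume "pathin X p"
  then show "continuous_map (top_of_set ({0::real} \<times> {0..1})) X (\<lambda>z. p (snd z))"
    using continuous_map_compose[of "top_of_set ({0::real} \<times> {0..1})" "top_of_set {0..1}" snd X p]
    by (force simp: pathin_def o_def continuous_on_snd[OF continuous_on_id])
next
  assume "continuous_map (top_of_set ({0::real} \<times> {0..1})) X (\<lambda>z. p (snd z))"
  from pathin_compose[OF this, of "\<lambda>t. (0, t)"] show "pathin X p"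
    by (simp add: continuous_on_Pair)
qed

lemma pathin_concat:
  assumes "pathin X p" "pathin X q" "p 1 = q 0"
  shows "pathin X (path_concat p q)"
  using continuous_map_concat_slice[of "{0::real}" X "\<lambda>z. p (snd z)" "\<lambda>z. q (snd z)"] assms
  by (simp add: pathin_iff_slice path_concat_def case_prod_unfold cong: if_cong)

lemma path_equiv_concat:
  assumes p: "(p, p') \<in> path_equiv X" and q: "(q, q') \<in> path_equiv X" and pq: "p 1 = q 0"
  shows "(path_concat p q, path_concat p' q') \<in> path_equiv X"
proof -
  obtain h where h: "continuous_map (top_of_set ({0..1::real} \<times> {0..1})) X h"
    "\<forall>t\<in>{0..1}. h (0, t) = p t" "\<forall>t\<in>{0..1}. h (1, t) = p' t"
    "\<forall>s\<in>{0..1}. h (s, 0) = p 0 \<and> h (s, 1) = p 1"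
    using p unfolding path_equiv_iff by blast
  obtain k where k: "continuous_map (top_of_set ({0..1::real} \<times> {0..1})) X k"
    "\<forall>t\<in>{0..1}. k (0, t) = q t" "\<forall>t\<in>{0..1}. k (1, t) = q' t"
    "\<forall>s\<in>{0..1}. k (s, 0) = q 0 \<and> k (s, 1) = q 1"
    using q unfolding path_equiv_iff by blast
  have "continuous_map (top_of_set ({0..1} \<times> {0..1})) X
      (\<lambda>(s, t). if t \<le> 1/2 then h (s, 2 * t) else k (s, 2 * t - 1))"
    by (rule continuous_map_concat_slice) (use h k pq in auto)
  then show ?thesis
    unfolding path_equiv_iff
    by (intro exI[where x = "\<lambda>(s, t). if t \<le> 1/2 then h (s, 2 * t) else k (s, 2 * t - 1)"])
      (use h k pq in \<open>auto simp: path_concat_def\<close>)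
qed

lemma path_concat_assoc:
  assumes "pathin X p" "pathin X q" "pathin X r" "p 1 = q 0" "q 1 = r 0"
  shows "(path_concat (path_concat p q) r, path_concat p (path_concat q r)) \<in> path_equiv X"
proof -
  let ?m = "path_concat (path_concat p q) r"
  \<comment> \<open>\<open>f\<close> takes the breakpoints 1/2 and 3/4 of the right-nested
    concatenation to the breakpoints 1/4 and 1/2 of the left-nested one.\<close>
  define f :: "real \<Rightarrow> real"
    where "f t = (if t \<le> 1/2 then t / 2 else if t \<le> 3/4 then t - 1/4 else 2 * t - 1)" for t
  have m: "pathin X ?m"
    using assms by (intro pathin_concat) auto
  have "continuous_on {0..1} f"
  proof -
    \<comment> \<open>The slopes 1/2, 1, 2 increase, so \<open>f\<close> is convex and equals the
      maximum of its affine pieces; continuity is then immediate.\<close>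
    have "f = (\<lambda>t. max (t / 2) (max (t - 1/4) (2 * t - 1)))"
      by (auto simp: f_def fun_eq_iff max_def)
    then show ?thesis by (auto intro!: continuous_intros)
  qed
  then have 1: "(\<lambda>t. ?m t, \<lambda>t. ?m (f t)) \<in> path_equiv X"
    by (intro path_equiv_reparam[OF m]) (auto simp: f_def)
  have "path_concat p (path_concat q r) t = ?m (f t)" for t
  proof -
    consider "t \<le> 1/2" | "1/2 < t" "t \<le> 3/4" | "3/4 < t" by linarith
    then show ?thesis
    proof cases
      case 1
      then have *: "f t = t / 2" by (simp add: f_def)
      show ?thesis unfolding * using 1 by (simp add: path_concat_def algebra_simps)
    next
      case 2
      then have *: "f t = t - 1/4" by (simp add: f_def)
      show ?thesis unfolding * using 2 by (simp add: path_concat_def algebra_simps)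
    next
      case 3
      then have *: "f t = 2 * t - 1" by (simp add: f_def)
      show ?thesis unfolding * using 3 by (simp add: path_concat_def algebra_simps)
    qed
  qed
  then have "path_concat p (path_concat q r) = (\<lambda>t. ?m (f t))" by blast
  then show ?thesis using 1 by simp
qed

lemma path_concat_const:
  assumes "pathin X p"
  shows "(path_concat (\<lambda>t. p 0) p, p) \<in> path_equiv X"
    and "(path_concat p (\<lambda>t. p 1), p) \<in> path_equiv X"
proof -
  have "(\<lambda>t. p (max 0 (2 * t - 1)), \<lambda>t. p t) \<in> path_equiv X"
    by (rule path_equiv_reparam[OF assms]) (auto intro!: continuous_intros)
  moreover have "path_concat (\<lambda>t. p 0) p = (\<lambda>t. p (max 0 (2 * t - 1)))"
    by (rule path_concat_eqI) (simp_all add: max_absorb1 max_absorb2)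
  ultimately show "(path_concat (\<lambda>t. p 0) p, p) \<in> path_equiv X" by simp
  have "(\<lambda>t. p (min 1 (2 * t)), \<lambda>t. p t) \<in> path_equiv X"
    by (rule path_equiv_reparam[OF assms]) (auto intro!: continuous_intros)
  moreover have "path_concat p (\<lambda>t. p 1) = (\<lambda>t. p (min 1 (2 * t)))"
    by (rule path_concat_eqI) (simp_all add: min_absorb1 min_absorb2)
  ultimately show "(path_concat p (\<lambda>t. p 1), p) \<in> path_equiv X" by simp
qed

text \<open>The two routes from corner (0,0) to corner (1,1) along the boundary lie in a convex set.
  In \<open>?f\<close> and \<open>?g\<close>, \<open>min 1 (2 * t)\<close> moves and then waits,
  while \<open>max 0 (2 * t - 1)\<close> waits and then moves.\<close>

lemma path_equiv_square:
  assumes H: "continuous_map (top_of_set ({0..1} \<times> {0..1})) X H"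
  shows "(path_concat (\<lambda>t. H (t, 0)) (\<lambda>t. H (1, t)),
          path_concat (\<lambda>t. H (0, t)) (\<lambda>t. H (t, 1))) \<in> path_equiv X"
proof -
  let ?f = "\<lambda>t::real. (min 1 (2 * t), max 0 (2 * t - 1))"
  let ?g = "\<lambda>t::real. (max 0 (2 * t - 1), min 1 (2 * t))"
  have "(H \<circ> ?f, H \<circ> ?g) \<in> path_equiv X"
    by (rule path_equiv_convex[OF _ H]) (auto intro!: continuous_intros convex_Times)
  moreover have "H \<circ> ?f = path_concat (\<lambda>t. H (t, 0)) (\<lambda>t. H (1, t))"
    "H \<circ> ?g = path_concat (\<lambda>t. H (0, t)) (\<lambda>t. H (t, 1))"
    by (rule path_concat_eqI[symmetric],
        simp_all add: min_absorb1 min_absorb2 max_absorb1 max_absorb2)+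
  ultimately show ?thesis by simp
qed

subsection \<open>The fundamental groupoid\<close>

definition path_class :: "'p topology \<Rightarrow> (real \<Rightarrow> 'p) \<Rightarrow> (real \<Rightarrow> 'p) set" where
  "path_class X p = path_equiv X `` {p}"

lemma path_class_eq: "(p, q) \<in> path_equiv X \<Longrightarrow> path_class X p = path_class X q"
  unfolding path_class_def using path_equiv_sym path_equiv_trans by blast

lemma path_class_eqD: "path_class X p = path_class X q \<Longrightarrow> pathin X q \<Longrightarrow> (p, q) \<in> path_equiv X"
  unfolding path_class_def using path_equiv_refl by blast

lemma Obj_fundamental_groupoid [simp]: "Obj (fundamental_groupoid X) = topspace X"
  by (simp add: fundamental_groupoid_def)

lemma Id_fundamental_groupoid: "Id (fundamental_groupoid X) x = path_class X (\<lambda>t. x)"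
  by (simp add: fundamental_groupoid_def path_class_def)

lemma Hom_fundamental_groupoid:
  "A \<in> Hom (fundamental_groupoid X) x y \<longleftrightarrow>
     (\<exists>p. pathin X p \<and> p 0 = x \<and> p 1 = y \<and> A = path_class X p)"
  by (auto simp: fundamental_groupoid_def path_class_def quotient_def paths_between_def)

lemma path_class_in_Hom:
  "pathin X p \<Longrightarrow> path_class X p \<in> Hom (fundamental_groupoid X) (p 0) (p 1)"
  unfolding Hom_fundamental_groupoid by blast

text \<open>The union over all representatives collapses: every member of it is the same class by
  \<open>path_equiv_concat\<close>, and \<open>p\<close>, \<open>q\<close> themselves occur in
  it.\<close>

lemma Comp_path_class:
  assumes "pathin X p" "pathin X q" "p 1 = q 0"
  shows "Comp (fundamental_groupoid X) (path_class X p) (path_class X q) =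
           path_class X (path_concat p q)"
proof -
  have "(\<Union>p'\<in>path_class X p. \<Union>q'\<in>path_class X q. path_class X (path_concat p' q')) =
      path_class X (path_concat p q)" (is "?L = ?R")
  proof
    show "?L \<subseteq> ?R"
    proof (intro UN_least)
      fix p' q' assume "p' \<in> path_class X p" "q' \<in> path_class X q"
      then have "(path_concat p q, path_concat p' q') \<in> path_equiv X"
        using assms by (intro path_equiv_concat) (simp_all add: path_class_def)
      then show "path_class X (path_concat p' q') \<subseteq> ?R"
        using path_class_eq by blast
    qed
    have "p \<in> path_class X p" "q \<in> path_class X q"
      using assms path_equiv_refl by (simp_all add: path_class_def)
    then show "?R \<subseteq> ?L" by blast
  qed
  then show ?thesis
    by (simp add: fundamental_groupoid_def path_class_def)
qed

lemma pathin_const_path: "x \<in> topspace X \<Longrightarrow> pathin X (\<lambda>t. x)"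
  by (simp add: pathin_def)

lemma is_category_fundamental_groupoid: "is_category (fundamental_groupoid X)"
  unfolding is_category_def
proof (intro conjI ballI impI)
  fix x y x' y'
  assume "Hom (fundamental_groupoid X) x y \<inter> Hom (fundamental_groupoid X) x' y' \<noteq> {}"
  then obtain p q where "path_class X p = path_class X q" "pathin X q"
    and "p 0 = x" "p 1 = y" "q 0 = x'" "q 1 = y'"
    unfolding Hom_fundamental_groupoid disjoint_iff by metis
  with path_equiv_props[OF path_class_eqD] show "x = x'" "y = y'"
    by metis+
next
  fix x assume "x \<in> Obj (fundamental_groupoid X)"
  then show "Id (fundamental_groupoid X) x \<in> Hom (fundamental_groupoid X) x x"
    by (auto simp: Id_fundamental_groupoid Hom_fundamental_groupoid intro!: exI[where x="\<lambda>t. x"])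
next
  fix x y z f g assume "f \<in> Hom (fundamental_groupoid X) x y" "g \<in> Hom (fundamental_groupoid X) y z"
  then obtain p q where p: "pathin X p" "p 0 = x" "p 1 = y" "f = path_class X p"
    and q: "pathin X q" "q 0 = y" "q 1 = z" "g = path_class X q"
    by (auto simp: Hom_fundamental_groupoid)
  show "Comp (fundamental_groupoid X) f g \<in> Hom (fundamental_groupoid X) x z"
    using p q by (auto simp: Comp_path_class Hom_fundamental_groupoid pathin_concat
        intro!: exI[where x="path_concat p q"])
next
  fix x y f assume "f \<in> Hom (fundamental_groupoid X) x y"
  then obtain p where p: "pathin X p" "p 0 = x" "p 1 = y" "f = path_class X p"
    by (auto simp: Hom_fundamental_groupoid)
  then have "x \<in> topspace X" "y \<in> topspace X"
    using continuous_map_image_subset_topspace unfolding pathin_def by fastforce+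
  then show "Comp (fundamental_groupoid X) (Id (fundamental_groupoid X) x) f = f"
    "Comp (fundamental_groupoid X) f (Id (fundamental_groupoid X) y) = f"
    using path_concat_const[OF p(1)] p
    by (simp_all add: Id_fundamental_groupoid Comp_path_class pathin_const_path path_class_eq)
next
  fix w x y z f g h
  assume "f \<in> Hom (fundamental_groupoid X) w x" "g \<in> Hom (fundamental_groupoid X) x y"
    "h \<in> Hom (fundamental_groupoid X) y z"
  then obtain p q r where "pathin X p" "p 1 = x" "f = path_class X p"
    "pathin X q" "q 0 = x" "q 1 = y" "g = path_class X q"
    "pathin X r" "r 0 = y" "h = path_class X r"
    by (auto simp: Hom_fundamental_groupoid)
  then show "Comp (fundamental_groupoid X) (Comp (fundamental_groupoid X) f g) h =
             Comp (fundamental_groupoid X) f (Comp (fundamental_groupoid X) g h)"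
    by (simp add: Comp_path_class pathin_concat path_class_eq[OF path_concat_assoc])
qed

section \<open>Subpaths and the splitting of a path class\<close>

definition restrict_path :: "(real \<Rightarrow> 'c) \<Rightarrow> real \<Rightarrow> real \<Rightarrow> real \<Rightarrow> 'c" where
  "restrict_path p a b t = p (a + (b - a) * t)"

lemma restrict_path_ends [simp]: "restrict_path p a b 0 = p a" "restrict_path p a b 1 = p b"
  by (simp_all add: restrict_path_def)

lemma restrict_path_range:
  assumes "0 \<le> a" "a \<le> b" "b \<le> 1" "t \<in> {0..1::real}"
  shows "a \<le> a + (b - a) * t" "a + (b - a) * t \<le> b"
  using assms mult_left_le[of t "b - a"] by auto

lemma restrict_path_range': "0 \<le> a \<Longrightarrow> a \<le> b \<Longrightarrow> b \<le> 1 \<Longrightarrow> t \<in> {0..1::real} \<Longrightarrow> a + (b - a) * t \<in> {0..1}"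
  using restrict_path_range[of a b t] by auto

lemma pathin_restrict_path:
  assumes "pathin X p" "0 \<le> a" "a \<le> b" "b \<le> 1"
  shows "pathin X (restrict_path p a b)"
  unfolding restrict_path_def
  by (rule pathin_compose[of "{0..1}" X p])
    (use assms restrict_path_range' in \<open>auto simp: pathin_def intro!: continuous_intros\<close>)

text \<open>Both sides follow \<open>p\<close> from \<open>a\<close> to \<open>c\<close>, only with
  different speeds: \<open>\<gamma>\<close> reaches \<open>b\<close> at time 1/2. This makes
  statements about path classes accessible to bisection of the interval.\<close>

lemma path_class_restrict_path:
  assumes p: "pathin X p" and abc: "0 \<le> a" "a \<le> b" "b \<le> c" "c \<le> 1"
  shows "path_class X (restrict_path p a c) =
    Comp (fundamental_groupoid X) (path_class X (restrict_path p a b)) (path_class X (restrict_path p b c))"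
proof -
  define \<gamma> where "\<gamma> t = a + (b - a) * min 1 (2 * t) + (c - b) * max 0 (2 * t - 1)" for t
  have low: "\<gamma> t = a + (b - a) * (2 * t)" if "t \<le> 1/2" for t
    using that by (simp add: \<gamma>_def min_absorb2 max_absorb1)
  have high: "\<gamma> t = b + (c - b) * (2 * t - 1)" if "1/2 \<le> t" for t
    using that by (simp add: \<gamma>_def min_absorb1 max_absorb2)
  have "\<gamma> t \<in> {0..1}" if "t \<in> {0..1}" for t
    using low[of t] high[of t] restrict_path_range'[of a b "2 * t"] restrict_path_range'[of b c "2 * t - 1"] that abc
    by (cases "t \<le> 1/2") auto
  moreover have "continuous_on {0..1} \<gamma>" unfolding \<gamma>_def by (intro continuous_intros)
  ultimately have "(\<lambda>t. p (a + (c - a) * t), \<lambda>t. p (\<gamma> t)) \<in> path_equiv X"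
    using restrict_path_range'[of a c] abc
    by (intro path_equiv_reparam[OF p]) (auto simp: \<gamma>_def intro!: continuous_intros)
  moreover have "path_concat (restrict_path p a b) (restrict_path p b c) = (\<lambda>t. p (\<gamma> t))"
    by (rule path_concat_eqI) (simp_all add: low high restrict_path_def)
  ultimately have "path_class X (restrict_path p a c) = path_class X (path_concat (restrict_path p a b) (restrict_path p b c))"
    unfolding restrict_path_def by (simp add: path_class_eq)
  then show ?thesis
    using pathin_restrict_path[OF p] abc by (simp add: Comp_path_class)
qed

subsection \<open>Categories\<close>

lemma
  assumes "is_category C"
  shows category_Id: "x \<in> Obj C \<Longrightarrow> Id C x \<in> Hom C x x"
    and category_Comp: "f \<in> Hom C x y \<Longrightarrow> g \<in> Hom C y z \<Longrightarrow>
      x \<in> Obj C \<Longrightarrow> y \<in> Obj C \<Longrightarrow> z \<in> Obj C \<Longrightarrow> Comp C f g \<in> Hom C x z"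
    and category_Id_left: "f \<in> Hom C x y \<Longrightarrow> x \<in> Obj C \<Longrightarrow> y \<in> Obj C \<Longrightarrow> Comp C (Id C x) f = f"
    and category_Id_right: "f \<in> Hom C x y \<Longrightarrow> x \<in> Obj C \<Longrightarrow> y \<in> Obj C \<Longrightarrow> Comp C f (Id C y) = f"
    and category_assoc: "f \<in> Hom C w x \<Longrightarrow> g \<in> Hom C x y \<Longrightarrow> h \<in> Hom C y z \<Longrightarrow>
      w \<in> Obj C \<Longrightarrow> x \<in> Obj C \<Longrightarrow> y \<in> Obj C \<Longrightarrow> z \<in> Obj C \<Longrightarrow>
      Comp C (Comp C f g) h = Comp C f (Comp C g h)"
  using assms unfolding is_category_def by blast+

lemma functor_Comp:
  "is_functor C D Fo Fa \<Longrightarrow> x \<in> Obj C \<Longrightarrow> y \<in> Obj C \<Longrightarrow> z \<in> Obj C \<Longrightarrow>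
     f \<in> Hom C x y \<Longrightarrow> g \<in> Hom C y z \<Longrightarrow> Fa (Comp C f g) = Comp D (Fa f) (Fa g)"
  unfolding is_functor_def by blast

lemma functor_Hom:
  "is_functor C D Fo Fa \<Longrightarrow> x \<in> Obj C \<Longrightarrow> y \<in> Obj C \<Longrightarrow> f \<in> Hom C x y \<Longrightarrow> Fa f \<in> Hom D (Fo x) (Fo y)"
  unfolding is_functor_def by blast

subsection \<open>Looped walks up to equivalence\<close>

lemma looped_walk_iff:
  assumes "is_graph K"
  shows "looped_walk K \<alpha> \<longleftrightarrow>
    \<alpha> \<noteq> [] \<and> set \<alpha> \<subseteq> looped_verts K \<and> successively (\<lambda>a b. (a, b) \<in> edges K) \<alpha>"
proof (cases "\<alpha> = []")
  case False
  have sym: "(a, b) \<in> edges K \<longleftrightarrow> (b, a) \<in> edges K" for a b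
    using assms unfolding is_graph_def by (meson symE)
  have "looped_walk K \<alpha> \<longleftrightarrow> (\<forall>i<length \<alpha>. \<alpha> ! i \<in> verts K \<and> (\<alpha> ! i, \<alpha> ! i) \<in> edges K) \<and>
          (\<forall>i. Suc i < length \<alpha> \<longrightarrow> (\<alpha> ! i, \<alpha> ! Suc i) \<in> edges K)"
  proof
    assume "looped_walk K \<alpha>"
    then have v: "\<forall>i\<in>{0..length \<alpha> - 1}. \<alpha> ! i \<in> verts K"
      and e: "\<forall>(i, j)\<in>edges (looped_path_graph (length \<alpha> - 1)). (\<alpha> ! i, \<alpha> ! j) \<in> edges K"
      unfolding looped_walk_def graph_morphism_def by (auto simp: looped_path_graph_def)
    have "\<alpha> ! i \<in> verts K" "(\<alpha> ! i, \<alpha> ! i) \<in> edges K" if "i < length \<alpha>" for i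
      using v e that by (auto simp: looped_path_graph_def)
    moreover have "(\<alpha> ! i, \<alpha> ! Suc i) \<in> edges K" if "Suc i < length \<alpha>" for i
    proof -
      have "i \<le> length \<alpha> - 1" "Suc i \<le> length \<alpha> - 1" using that by auto
      then show ?thesis using e by (auto simp: looped_path_graph_def)
    qed
    ultimately show "(\<forall>i<length \<alpha>. \<alpha> ! i \<in> verts K \<and> (\<alpha> ! i, \<alpha> ! i) \<in> edges K) \<and>
          (\<forall>i. Suc i < length \<alpha> \<longrightarrow> (\<alpha> ! i, \<alpha> ! Suc i) \<in> edges K)" by blast
  next
    assume *: "(\<forall>i<length \<alpha>. \<alpha> ! i \<in> verts K \<and> (\<alpha> ! i, \<alpha> ! i) \<in> edges K) \<and>
          (\<forall>i. Suc i < length \<alpha> \<longrightarrow> (\<alpha> ! i, \<alpha> ! Suc i) \<in> edges K)"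
    \<comment> \<open>Subtraction is truncated, so this conversion of index bounds depends on the
      list being nonempty.\<close>
    have "i \<le> length \<alpha> - 1 \<longleftrightarrow> i < length \<alpha>" for i
      using False by (cases \<alpha>) auto
    with * False sym show "looped_walk K \<alpha>"
      by (auto simp: looped_walk_def graph_morphism_def looped_path_graph_def)
  qed
  also have "\<dots> \<longleftrightarrow> set \<alpha> \<subseteq> looped_verts K \<and> successively (\<lambda>a b. (a, b) \<in> edges K) \<alpha>"
    unfolding successively_conv_nth subset_iff looped_verts_def by (auto simp: in_set_conv_nth)
  finally show ?thesis using False by simp
qed (simp add: looped_walk_def)

lemma equiv_walk_equiv: "equiv UNIV (walk_equiv K)"
  unfolding walk_equiv_def
  by (auto intro!: equivI refl_onI symI transI intro: equivclp_sym equivclp_trans)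

lemma walk_equiv_dup:
  assumes "looped_walk K (\<alpha> @ [v, v] @ \<beta>)" "looped_walk K (\<alpha> @ [v] @ \<beta>)"
  shows "(\<alpha> @ [v, v] @ \<beta>, \<alpha> @ [v] @ \<beta>) \<in> walk_equiv K"
  using assms looped_prune.intros(2) unfolding walk_equiv_def
  by (auto intro!: r_into_equivclp)

text \<open>Deleting the middle vertex of a triangle is a homotopy \<open>(a b c) \<simeq> (a a c)\<close> followed by a prune.\<close>

lemma walk_equiv_triangle:
  assumes K: "is_graph K" and walk: "looped_walk K (\<alpha> @ [a, b, c] @ \<beta>)" and ac: "(a, c) \<in> edges K"
  shows "(\<alpha> @ [a, b, c] @ \<beta>, \<alpha> @ [a, c] @ \<beta>) \<in> walk_equiv K"
proof -
  define p q where "p = \<alpha> @ [a, b, c] @ \<beta>" and "q = \<alpha> @ [a, a, c] @ \<beta>"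
  \<comment> \<open>\<open>k\<close> is the position of \<open>b\<close> in \<open>p\<close>, the
    only place where \<open>p\<close> and \<open>q\<close> differ.\<close>
  define k n where "k = Suc (length \<alpha>)" and "n = length p - 1"
  define L where "L = (\<lambda>(i, j::nat). (if j = 0 then p else q) ! i)"
  have p: "looped_walk K p" using walk by (simp add: p_def)
  have q: "looped_walk K q" and r: "looped_walk K (\<alpha> @ [a, c] @ \<beta>)"
    using walk ac unfolding looped_walk_iff[OF K] q_def
    by (auto simp: successively_append_iff looped_verts_def)
  have n: "length p = Suc n" "length q = Suc n" by (auto simp: n_def p_def q_def)
  have nth_eq: "p ! i = q ! i" if "i \<noteq> k" for i
    using that by (auto simp: p_def q_def k_def nth_append nth_Cons')
  have nth_k: "p ! (k - 1) = a" "q ! k = a"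
    by (auto simp: p_def q_def k_def nth_append)
  have hd_last: "hd p = p ! 0" "last p = p ! n" "hd q = q ! 0" "last q = q ! n"
    using n hd_conv_nth[of p] hd_conv_nth[of q] last_conv_nth[of p] last_conv_nth[of q] by fastforce+
  have k: "0 \<noteq> k" "n \<noteq> k" by (auto simp: k_def n_def p_def)
  have pe: "(p ! i, p ! j) \<in> edges K" "(q ! i, q ! j) \<in> edges K"
    if "i \<le> n" "j \<le> n" "i = j \<or> j = Suc i \<or> i = Suc j" for i j
    using p q that n unfolding looped_walk_def graph_morphism_def
    by (fastforce simp: looped_path_graph_def)+
  have pv: "p ! i \<in> verts K" "q ! i \<in> verts K" if "i \<le> n" for i
    using p q that n unfolding looped_walk_def graph_morphism_def
    by (fastforce simp: looped_path_graph_def)+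
  have sym: "(x, y) \<in> edges K \<Longrightarrow> (y, x) \<in> edges K" for x y
    using K unfolding is_graph_def by (meson symE)
  \<comment> \<open>If one of the two indices is not \<open>k\<close>, the pair already is an edge
    inside \<open>p\<close> or inside \<open>q\<close>. Only \<open>i = j = k\<close> is new: it
    asks for an edge from \<open>b\<close> to \<open>a\<close>.\<close>
  have pq: "(p ! i, q ! j) \<in> edges K"
    if "i \<le> n" "j \<le> n" "i = j \<or> j = Suc i \<or> i = Suc j" for i j
  proof (cases "j = k")
    case False
    then show ?thesis using pe(1)[OF that] nth_eq by simp
  next
    case j: True
    show ?thesis
    proof (cases "i = k")
      case True
      have "(p ! k, p ! (k - 1)) \<in> edges K"
        using that j True k by (intro pe) auto
      then show ?thesis using nth_k True j by simp
    next
      case False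
      then show ?thesis using pe(2)[OF that] nth_eq by simp
    qed
  qed
  have "graph_morphism (graph_product (looped_path_graph n) (looped_path_graph 1)) K L"
    unfolding graph_morphism_def
  proof (intro conjI ballI)
    show "L \<in> verts (graph_product (looped_path_graph n) (looped_path_graph 1)) \<rightarrow> verts K"
      using pv by (simp add: graph_product_def looped_path_graph_def L_def Pi_iff)
    fix e assume "e \<in> edges (graph_product (looped_path_graph n) (looped_path_graph 1))"
    then obtain i j k l where e: "e = ((i, j), (k, l))" and
      ik: "i \<le> n" "k \<le> n" "i = k \<or> k = Suc i \<or> i = Suc k"
      by (auto simp: graph_product_def looped_path_graph_def)
    then show "case e of (v, w) \<Rightarrow> (L v, L w) \<in> edges K"
      using pe[OF ik] pq[OF ik] pq[of k i] sym by (auto simp: L_def)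
  qed
  moreover have "L (0, j) = hd p" "L (n, j) = last p" for j
    using nth_eq k hd_last by (auto simp: L_def)
  moreover have "hd q = hd p" "last q = last p"
    using nth_eq k hd_last by auto
  ultimately have "walk_homotopic K p q"
    unfolding walk_homotopic_def
    using p q n
    by (intro exI[of _ n] exI[of _ "hd p"] exI[of _ "last p"] conjI exI[of _ "1::nat"] exI[of _ L])
      (simp_all add: looped_walks_def L_def)
  then have "(p, q) \<in> walk_equiv K"
    using p q unfolding walk_equiv_def by (auto intro!: r_into_equivclp)
  moreover have "(q, \<alpha> @ [a, c] @ \<beta>) \<in> walk_equiv K"
    using walk_equiv_dup[of K \<alpha> a "c # \<beta>"] q r by (simp add: q_def)
  ultimately show ?thesis
    using equiv_walk_equiv[of K] unfolding equiv_def p_def by (meson transD)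
qed

text \<open>Each well-definedness statement about walk classes becomes an instance of this locale:
  being a walk, the endpoints, the class of a concatenation, and the evaluation in another category.
  Both moves are only demanded between walks, so \<open>f\<close> may behave arbitrarily on other
  lists.\<close>

locale walk_invariant =
  fixes K :: "'a ugraph" and f :: "'a list \<Rightarrow> 'c"
  assumes graph: "is_graph K"
    and dup: "\<And>\<alpha> v \<beta>. looped_walk K (\<alpha> @ [v, v] @ \<beta>) \<Longrightarrow> looped_walk K (\<alpha> @ [v] @ \<beta>) \<Longrightarrow>
      f (\<alpha> @ [v, v] @ \<beta>) = f (\<alpha> @ [v] @ \<beta>)"
    and tri: "\<And>\<alpha> a b c \<beta>. looped_walk K (\<alpha> @ [a, b, c] @ \<beta>) \<Longrightarrow>
      looped_walk K (\<alpha> @ [a, c] @ \<beta>) \<Longrightarrow> (a, c) \<in> edges K \<Longrightarrow>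
      f (\<alpha> @ [a, b, c] @ \<beta>) = f (\<alpha> @ [a, c] @ \<beta>)"
begin

lemma edges_sym: "(x, y) \<in> edges K \<Longrightarrow> (y, x) \<in> edges K"
  using graph unfolding is_graph_def by (meson symE)

lemma prune_invariant:
  assumes "looped_prune \<alpha> \<beta>" "looped_walk K \<alpha>" "looped_walk K \<beta>"
  shows "f \<alpha> = f \<beta>"
  using assms
proof cases
  case (1 \<alpha>' v w \<beta>')
  \<comment> \<open>Since \<open>v\<close> is looped, \<open>v w v\<close> is a triangle whose outer
    vertices are adjacent; it shrinks to \<open>v v\<close> and then to \<open>v\<close>.\<close>
  have "(v, v) \<in> edges K" "looped_walk K (\<alpha>' @ [v, v] @ \<beta>')"
    using assms(3) unfolding 1 looped_walk_iff[OF graph]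
    by (auto simp: successively_append_iff looped_verts_def)
  then show ?thesis using dup[of \<alpha>' v \<beta>'] tri[of \<alpha>' v w v \<beta>'] assms unfolding 1 by simp
next
  case 2
  then show ?thesis using dup assms by simp
qed

text \<open>A homotopy across one column is performed by two triangle moves per square.\<close>

lemma row_invariant:
  assumes "length as = length bs"
    and "looped_walk K (\<pi> @ [b])" "looped_walk K (a # as)" "looped_walk K (b # bs)"
    and "(b, a) \<in> edges K"
    and "\<And>i. i < length as \<Longrightarrow> (as ! i, bs ! i) \<in> edges K \<and> ((b # bs) ! i, as ! i) \<in> edges K"
  shows "f (\<pi> @ b # a # as) = f (\<pi> @ b # bs @ [last (a # as)])"
  using assms
proof (induction as bs arbitrary: \<pi> a b rule: list_induct2)
  case (Cons a' as b' bs)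
  note walk = looped_walk_iff[OF graph]
  have e: "(a', b') \<in> edges K" "(b, a') \<in> edges K" "(b', a') \<in> edges K" "(b, b') \<in> edges K"
    using Cons.prems(5)[of 0] Cons.prems(3) edges_sym by (auto simp: walk)
  \<comment> \<open>The seam between new row and old row moves on by one column: \<open>a\<close> is
    dropped because \<open>b\<close> is adjacent to \<open>a'\<close>, and \<open>b'\<close> is
    inserted between \<open>b\<close> and \<open>a'\<close>.\<close>
  have "f (\<pi> @ b # a # a' # as) = f (\<pi> @ b # a' # as)"
    using tri[of \<pi> b a a' as] Cons.prems e
    by (auto simp: walk successively_append_iff successively_Cons)
  also have "\<dots> = f (\<pi> @ b # b' # a' # as)"
    using tri[of \<pi> b b' a' as] Cons.prems e
    by (auto simp: walk successively_append_iff successively_Cons)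
  also have "\<dots> = f ((\<pi> @ [b]) @ b' # a' # as)" by simp
  also have "\<dots> = f ((\<pi> @ [b]) @ b' # bs @ [last (a' # as)])"
  proof (rule Cons.IH)
    show "looped_walk K ((\<pi> @ [b]) @ [b'])" "looped_walk K (a' # as)" "looped_walk K (b' # bs)"
      using Cons.prems by (auto simp: walk successively_append_iff)
    fix i assume "i < length as"
    then show "(as ! i, bs ! i) \<in> edges K \<and> ((b' # bs) ! i, as ! i) \<in> edges K"
      using Cons.prems(5)[of "Suc i"] by simp
  qed (use e in auto)
  finally show ?case by simp
qed simp

lemma walk_homotopic_invariant:
  assumes "walk_homotopic K \<alpha> \<beta>"
  shows "f \<alpha> = f \<beta>"
proof -
  obtain n m x y \<Lambda> where ab: "\<alpha> \<in> looped_walks K x y" "\<beta> \<in> looped_walks K x y"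
    "length \<alpha> = Suc n" "length \<beta> = Suc n"
    and mor: "graph_morphism (graph_product (looped_path_graph n) (looped_path_graph m)) K \<Lambda>"
    and ends: "\<forall>i\<le>n. \<Lambda> (i, 0) = \<alpha> ! i" "\<forall>i\<le>n. \<Lambda> (i, m) = \<beta> ! i"
      "\<forall>j\<le>m. \<Lambda> (0, j) = x" "\<forall>j\<le>m. \<Lambda> (n, j) = y"
    using assms unfolding walk_homotopic_def by blast
  note walk = looped_walk_iff[OF graph]
  have edge: "(\<Lambda> (i, j), \<Lambda> (i', j')) \<in> edges K"
    if "i \<le> n" "i' \<le> n" "j \<le> m" "j' \<le> m" "i = i' \<or> i' = Suc i \<or> i = Suc i'"
      "j = j' \<or> j' = Suc j \<or> j = Suc j'" for i i' j j'
    using mor that by (fastforce simp: graph_morphism_def graph_product_def looped_path_graph_def)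
  have vert: "\<Lambda> (i, j) \<in> looped_verts K" if "i \<le> n" "j \<le> m" for i j
    using mor that edge[of i i j j]
    by (fastforce simp: graph_morphism_def graph_product_def looped_path_graph_def looped_verts_def)
  \<comment> \<open>Column 0 is omitted since it is constantly \<open>x\<close>; a full row is
    \<open>x # row j\<close>.\<close>
  define row where "row j = map (\<lambda>i. \<Lambda> (i, j)) [1..<Suc n]" for j
  have nth_row: "row j ! i = \<Lambda> (Suc i, j)" "(x # row j) ! i = \<Lambda> (i, j)" "length (row j) = n"
    if "i < n" "j \<le> m" for i j
    using that ends by (auto simp: row_def nth_Cons simp del: upt_Suc split: nat.split)
  have row_walk: "looped_walk K (x # row j)" if "j \<le> m" for j
  proof -
    have "x \<in> looped_verts K" using vert[of 0 j] ends that by auto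
    moreover have "set (row j) \<subseteq> looped_verts K"
      using vert that by (auto simp: row_def)
    moreover have "successively (\<lambda>a b. (a, b) \<in> edges K) (x # row j)"
      unfolding successively_conv_nth
      using edge nth_row that by (auto simp: row_def simp del: nth_Cons_Suc upt_Suc) 
    ultimately show ?thesis by (simp add: walk)
  qed
  have last_row: "last (x # row j) = y" if "j \<le> m" for j
    using ends that by (cases n) (auto simp: row_def)
  have step: "f (x # row j) = f (x # row (Suc j))" if "Suc j \<le> m" for j
  proof -
    have x: "x \<in> looped_verts K" using vert[of 0 0] ends by auto
    \<comment> \<open>The sweep needs one new vertex to the left of the old row and leaves one old
      vertex at the right. As the endpoints are fixed, this surplus is a doubled \<open>x\<close>
      before and a doubled \<open>y\<close> after, and \<open>dup\<close> removes both.\<close>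
    have "f ([] @ x # x # row j) = f ([] @ x # row (Suc j) @ [last (x # row j)])"
    proof (rule row_invariant)
      fix i assume "i < length (row j)"
      then have "i < n" by (simp add: row_def del: upt_Suc)
      then show "(row j ! i, row (Suc j) ! i) \<in> edges K \<and> ((x # row (Suc j)) ! i, row j ! i) \<in> edges K"
        using nth_row[of i] edge that by auto
    qed (use row_walk that x in \<open>auto simp: row_def walk looped_verts_def\<close>)
    moreover have "f (x # x # row j) = f (x # row j)"
      using dup[of "[]" x "row j"] row_walk[of j] that x by (auto simp: walk looped_verts_def)
    moreover have "f (x # row (Suc j) @ [last (x # row j)]) = f (x # row (Suc j))"
    proof -
      have "last (x # row (Suc j)) = y" using last_row that by simp
      then obtain \<gamma> where \<gamma>: "x # row (Suc j) = \<gamma> @ [y]"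
        using append_butlast_last_id[of "x # row (Suc j)"] by (metis list.discI)
      then have "x # row (Suc j) @ [y] = \<gamma> @ [y, y]"
        by (metis append.assoc append_Cons append_Nil)
      moreover have "looped_walk K (x # row (Suc j) @ [y])"
        using row_walk[OF that] last_row[OF that] vert[of n 0] edge[of n n 0 0] ends
        by (cases "row (Suc j) = []") (auto simp: walk successively_append_iff successively_Cons)
      ultimately show ?thesis
        using dup[of \<gamma> y "[]"] \<gamma> row_walk[OF that] last_row[of j] that
        by (metis Suc_leD append_Nil2)
    qed
    ultimately show ?thesis by simp
  qed
  have "j \<le> m \<Longrightarrow> f (x # row 0) = f (x # row j)" for j
    by (induction j) (use step in auto)
  moreover have "x # row 0 = \<alpha>" "x # row m = \<beta>"
    using ab ends
    by (auto intro!: nth_equalityI simp: row_def nth_Cons simp del: upt_Suc split: nat.split)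
  ultimately show ?thesis by auto
qed

lemma walk_equiv_invariant:
  assumes "(\<alpha>, \<beta>) \<in> walk_equiv K"
  shows "f \<alpha> = f \<beta>"
proof -
  have "equivclp (\<lambda>\<alpha> \<beta>. looped_walk K \<alpha> \<and> looped_walk K \<beta> \<and>
          (looped_prune \<alpha> \<beta> \<or> walk_homotopic K \<alpha> \<beta>)) \<alpha> \<beta>"
    using assms by (simp add: walk_equiv_def)
  then show ?thesis
    by (induction rule: equivclp_induct)
      (use prune_invariant walk_homotopic_invariant in \<open>metis+\<close>)
qed

end

text \<open>Walk equivalence is generated by moves on walks but is reflexive on all lists, so these
  facts need their own induction; each is a walk invariant with values in truth values or
  vertices.\<close>

lemma walk_equiv_props:
  assumes K: "is_graph K" and "(\<alpha>, \<beta>) \<in> walk_equiv K"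
  shows "looped_walk K \<alpha> \<longleftrightarrow> looped_walk K \<beta>" "hd \<alpha> = hd \<beta>" "last \<alpha> = last \<beta>"
proof -
  interpret walk_invariant K "looped_walk K" by unfold_locales (use K in auto)
  show "looped_walk K \<alpha> \<longleftrightarrow> looped_walk K \<beta>" using walk_equiv_invariant assms by blast
next
  interpret walk_invariant K hd by unfold_locales (use K in \<open>auto simp: hd_append\<close>)
  show "hd \<alpha> = hd \<beta>" using walk_equiv_invariant assms by blast
next
  interpret walk_invariant K last by unfold_locales (use K in auto)
  show "last \<alpha> = last \<beta>" using walk_equiv_invariant assms by blast
qed


text \<open>The form with \<open>tl\<close> keeps \<open>\<alpha>\<close> intact and the form with
  \<open>butlast\<close> keeps \<open>\<beta>\<close> intact, so that a move inside either factor is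
  visibly a move inside the concatenation.\<close>

lemma concat_eq_butlast: "\<alpha> \<noteq> [] \<Longrightarrow> \<beta> \<noteq> [] \<Longrightarrow> last \<alpha> = hd \<beta> \<Longrightarrow> \<alpha> @ tl \<beta> = butlast \<alpha> @ \<beta>"
  by (metis append.assoc append_Cons append_Nil append_butlast_last_id list.collapse)

lemma looped_walk_nonempty: "looped_walk K \<alpha> \<Longrightarrow> \<alpha> \<noteq> []"
  by (simp add: looped_walk_def)

lemma looped_walk_concat:
  assumes K: "is_graph K" and "looped_walk K \<alpha>" "looped_walk K \<beta>" "last \<alpha> = hd \<beta>"
  shows "looped_walk K (\<alpha> @ tl \<beta>)"
proof -
  obtain b \<beta>' where "\<beta> = b # \<beta>'"
    using assms(3) by (cases \<beta>) (auto simp: looped_walk_def)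
  then show ?thesis
    using assms(2-4) unfolding looped_walk_iff[OF K] successively_append_iff
    by (auto simp: successively_Cons)
qed

subsection \<open>The looped fundamental groupoid\<close>

definition walk_class :: "'a ugraph \<Rightarrow> 'a list \<Rightarrow> 'a list set" where
  "walk_class K \<alpha> = walk_equiv K `` {\<alpha>}"

lemma walk_class_eq: "walk_class K \<alpha> = walk_class K \<beta> \<longleftrightarrow> (\<alpha>, \<beta>) \<in> walk_equiv K"
  unfolding walk_class_def by (rule eq_equiv_class_iff[OF equiv_walk_equiv UNIV_I UNIV_I])

lemma walk_class_concat_cong:
  assumes K: "is_graph K" and "(\<alpha>, \<alpha>') \<in> walk_equiv K" "(\<beta>, \<beta>') \<in> walk_equiv K"
    and walks: "looped_walk K \<alpha>" "looped_walk K \<beta>" and meet: "last \<alpha> = hd \<beta>"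
  shows "walk_class K (\<alpha> @ tl \<beta>) = walk_class K (\<alpha>' @ tl \<beta>')"
proof -
  have walks': "looped_walk K \<alpha>'" "looped_walk K \<beta>'" "last \<alpha>' = hd \<beta>'" "hd \<beta>' = hd \<beta>"
    using walk_equiv_props[OF K] assms by metis+
  note WR = looped_walk_concat[OF K _ walks(2)]
  \<comment> \<open>An invariant has to be defined on all lists, whereas the concatenation is of
    interest only if the ends meet. The default \<open>{}\<close> is harmless because the moves
    preserve the last vertex.\<close>
  interpret L: walk_invariant K "\<lambda>\<alpha>. if last \<alpha> = hd \<beta> then walk_class K (\<alpha> @ tl \<beta>) else {}"
  proof
    fix \<pi> v \<rho> assume w: "looped_walk K (\<pi> @ [v, v] @ \<rho>)" "looped_walk K (\<pi> @ [v] @ \<rho>)"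
    have "last (\<pi> @ [v, v] @ \<rho>) = last (\<pi> @ [v] @ \<rho>)" by simp
    moreover have "walk_class K ((\<pi> @ [v, v] @ \<rho>) @ tl \<beta>) = walk_class K ((\<pi> @ [v] @ \<rho>) @ tl \<beta>)"
      if "last (\<pi> @ [v, v] @ \<rho>) = hd \<beta>" "last (\<pi> @ [v] @ \<rho>) = hd \<beta>"
      using WR[OF w(1)] WR[OF w(2)] that walk_equiv_dup[of K \<pi> v "\<rho> @ tl \<beta>"]
      unfolding walk_class_eq append_assoc by blast
    ultimately show "(if last (\<pi> @ [v, v] @ \<rho>) = hd \<beta> then walk_class K ((\<pi> @ [v, v] @ \<rho>) @ tl \<beta>) else {}) =
       (if last (\<pi> @ [v] @ \<rho>) = hd \<beta> then walk_class K ((\<pi> @ [v] @ \<rho>) @ tl \<beta>) else {})"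
      by presburger
  next
    fix \<pi> a b c \<rho> assume w: "looped_walk K (\<pi> @ [a, b, c] @ \<rho>)" "(a, c) \<in> edges K"
    have "last (\<pi> @ [a, b, c] @ \<rho>) = last (\<pi> @ [a, c] @ \<rho>)" by simp
    moreover have "walk_class K ((\<pi> @ [a, b, c] @ \<rho>) @ tl \<beta>) = walk_class K ((\<pi> @ [a, c] @ \<rho>) @ tl \<beta>)"
      if "last (\<pi> @ [a, b, c] @ \<rho>) = hd \<beta>"
      using WR[OF w(1)] that walk_equiv_triangle[OF K, of \<pi> a b c "\<rho> @ tl \<beta>"] w(2)
      unfolding walk_class_eq append_assoc by blast
    ultimately show "(if last (\<pi> @ [a, b, c] @ \<rho>) = hd \<beta> then walk_class K ((\<pi> @ [a, b, c] @ \<rho>) @ tl \<beta>) else {}) =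
       (if last (\<pi> @ [a, c] @ \<rho>) = hd \<beta> then walk_class K ((\<pi> @ [a, c] @ \<rho>) @ tl \<beta>) else {})"
      by presburger
  qed (rule K)
  have WL: "looped_walk K (butlast \<alpha>' @ \<gamma>)" if "looped_walk K \<gamma>" "hd \<gamma> = last \<alpha>'" for \<gamma>
    using looped_walk_concat[OF K walks'(1) that(1)] that walks'(1)
    by (simp add: concat_eq_butlast looped_walk_nonempty)
  \<comment> \<open>The second factor is varied with the first one already replaced by
    \<open>\<alpha>'\<close>.\<close>
  interpret R: walk_invariant K "\<lambda>\<beta>. if hd \<beta> = last \<alpha>' then walk_class K (butlast \<alpha>' @ \<beta>) else {}"
  proof
    fix \<pi> v \<rho> assume w: "looped_walk K (\<pi> @ [v, v] @ \<rho>)" "looped_walk K (\<pi> @ [v] @ \<rho>)"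
    have "hd (\<pi> @ [v, v] @ \<rho>) = hd (\<pi> @ [v] @ \<rho>)" by (simp add: hd_append)
    moreover have "walk_class K (butlast \<alpha>' @ (\<pi> @ [v, v] @ \<rho>)) = walk_class K (butlast \<alpha>' @ (\<pi> @ [v] @ \<rho>))"
      if "hd (\<pi> @ [v, v] @ \<rho>) = last \<alpha>'" "hd (\<pi> @ [v] @ \<rho>) = last \<alpha>'"
      using WL[OF w(1) that(1)] WL[OF w(2) that(2)] walk_equiv_dup[of K "butlast \<alpha>' @ \<pi>" v "\<rho>"]
      unfolding walk_class_eq append_assoc by blast
    ultimately show "(if hd (\<pi> @ [v, v] @ \<rho>) = last \<alpha>' then walk_class K (butlast \<alpha>' @ (\<pi> @ [v, v] @ \<rho>)) else {}) =
       (if hd (\<pi> @ [v] @ \<rho>) = last \<alpha>' then walk_class K (butlast \<alpha>' @ (\<pi> @ [v] @ \<rho>)) else {})"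
      by presburger
  next
    fix \<pi> a b c \<rho> assume w: "looped_walk K (\<pi> @ [a, b, c] @ \<rho>)" "(a, c) \<in> edges K"
    have "hd (\<pi> @ [a, b, c] @ \<rho>) = hd (\<pi> @ [a, c] @ \<rho>)" by (simp add: hd_append)
    moreover have "walk_class K (butlast \<alpha>' @ (\<pi> @ [a, b, c] @ \<rho>)) = walk_class K (butlast \<alpha>' @ (\<pi> @ [a, c] @ \<rho>))"
      if "hd (\<pi> @ [a, b, c] @ \<rho>) = last \<alpha>'"
      using WL[OF w(1) that] walk_equiv_triangle[OF K, of "butlast \<alpha>' @ \<pi>" a b c "\<rho>"] w(2)
      unfolding walk_class_eq append_assoc by blast
    ultimately show "(if hd (\<pi> @ [a, b, c] @ \<rho>) = last \<alpha>' then walk_class K (butlast \<alpha>' @ (\<pi> @ [a, b, c] @ \<rho>)) else {}) =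
       (if hd (\<pi> @ [a, c] @ \<rho>) = last \<alpha>' then walk_class K (butlast \<alpha>' @ (\<pi> @ [a, c] @ \<rho>)) else {})"
      by presburger
  qed (rule K)
  have "walk_class K (\<alpha> @ tl \<beta>) = walk_class K (\<alpha>' @ tl \<beta>)"
    using L.walk_equiv_invariant[OF assms(2)] meet walks' by simp
  also have "\<dots> = walk_class K (butlast \<alpha>' @ \<beta>)"
    using walks walks' by (simp add: concat_eq_butlast looped_walk_nonempty)
  also have "\<dots> = walk_class K (butlast \<alpha>' @ \<beta>')"
    using R.walk_equiv_invariant[OF assms(3)] meet walks' by simp
  also have "\<dots> = walk_class K (\<alpha>' @ tl \<beta>')"
    using walks' by (simp add: concat_eq_butlast looped_walk_nonempty)
  finally show ?thesis .
qed

lemma Obj_looped_fundamental_groupoid [simp]: "Obj (looped_fundamental_groupoid K) = looped_verts K"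
  by (simp add: looped_fundamental_groupoid_def)

lemma Id_looped_fundamental_groupoid: "Id (looped_fundamental_groupoid K) x = walk_class K [x]"
  by (simp add: looped_fundamental_groupoid_def walk_class_def)

lemma Hom_looped_fundamental_groupoid:
  "A \<in> Hom (looped_fundamental_groupoid K) x y \<longleftrightarrow>
     (\<exists>\<alpha>. looped_walk K \<alpha> \<and> hd \<alpha> = x \<and> last \<alpha> = y \<and> A = walk_class K \<alpha>)"
  by (auto simp: looped_fundamental_groupoid_def walk_class_def quotient_def looped_walks_def)

lemma walk_class_self: "\<alpha> \<in> walk_class K \<alpha>"
  unfolding walk_class_def by (rule equiv_class_self[OF equiv_walk_equiv UNIV_I])

lemma Comp_walk_class:
  assumes "is_graph K" "looped_walk K \<alpha>" "looped_walk K \<beta>" "last \<alpha> = hd \<beta>"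
  shows "Comp (looped_fundamental_groupoid K) (walk_class K \<alpha>) (walk_class K \<beta>) =
           walk_class K (\<alpha> @ tl \<beta>)"
proof -
  have "(\<Union>\<alpha>'\<in>walk_class K \<alpha>. \<Union>\<beta>'\<in>walk_class K \<beta>. walk_class K (\<alpha>' @ tl \<beta>')) =
      walk_class K (\<alpha> @ tl \<beta>)" (is "?L = ?R")
  proof
    show "?L \<subseteq> ?R"
    proof (intro UN_least)
      fix \<alpha>' \<beta>' assume "\<alpha>' \<in> walk_class K \<alpha>" "\<beta>' \<in> walk_class K \<beta>"
      then have "walk_class K (\<alpha> @ tl \<beta>) = walk_class K (\<alpha>' @ tl \<beta>')"
        using assms by (intro walk_class_concat_cong) (simp_all add: walk_class_def)
      then show "walk_class K (\<alpha>' @ tl \<beta>') \<subseteq> ?R" by blast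
    qed
    show "?R \<subseteq> ?L" using walk_class_self by blast
  qed
  then show ?thesis
    by (simp add: looped_fundamental_groupoid_def walk_class_def)
qed

lemma is_category_looped_fundamental_groupoid:
  assumes K: "is_graph K"
  shows "is_category (looped_fundamental_groupoid K)"
  unfolding is_category_def
proof (intro conjI ballI impI)
  fix x y x' y'
  assume "Hom (looped_fundamental_groupoid K) x y \<inter> Hom (looped_fundamental_groupoid K) x' y' \<noteq> {}"
  then obtain \<alpha> \<beta> where "walk_class K \<alpha> = walk_class K \<beta>"
    "hd \<alpha> = x" "last \<alpha> = y" "hd \<beta> = x'" "last \<beta> = y'"
    unfolding Hom_looped_fundamental_groupoid disjoint_iff by metis
  with walk_equiv_props[OF K] show "x = x'" "y = y'"
    unfolding walk_class_eq by blast+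
next
  fix x assume "x \<in> Obj (looped_fundamental_groupoid K)"
  then show "Id (looped_fundamental_groupoid K) x \<in> Hom (looped_fundamental_groupoid K) x x"
    by (auto simp: Id_looped_fundamental_groupoid Hom_looped_fundamental_groupoid looped_walk_iff[OF K]
        intro!: exI[where x="[x]"])
next
  fix x y z f g
  assume "f \<in> Hom (looped_fundamental_groupoid K) x y" "g \<in> Hom (looped_fundamental_groupoid K) y z"
  then obtain p q where p: "looped_walk K p" "hd p = x" "last p = y" "f = walk_class K p"
    and q: "looped_walk K q" "hd q = y" "last q = z" "g = walk_class K q"
    by (auto simp: Hom_looped_fundamental_groupoid)
  have "p \<noteq> []" "q \<noteq> []"
    using p q looped_walk_nonempty by blast+
  have "hd (p @ tl q) = x"
    using p(2) \<open>p \<noteq> []\<close> by simp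
  moreover have "last (p @ tl q) = z"
    using p q concat_eq_butlast[of p q] \<open>p \<noteq> []\<close> \<open>q \<noteq> []\<close> by simp
  ultimately show "Comp (looped_fundamental_groupoid K) f g \<in> Hom (looped_fundamental_groupoid K) x z"
    using p q looped_walk_concat[OF K p(1) q(1)]
    by (auto simp: Comp_walk_class[OF K] Hom_looped_fundamental_groupoid intro!: exI[where x="p @ tl q"])
next
  fix x y f assume "f \<in> Hom (looped_fundamental_groupoid K) x y"
  then obtain p where p: "looped_walk K p" "hd p = x" "last p = y" "f = walk_class K p"
    by (auto simp: Hom_looped_fundamental_groupoid)
  then have "looped_walk K [x]" "looped_walk K [y]" "p \<noteq> []"
    by (auto simp: looped_walk_iff[OF K])
  then show "Comp (looped_fundamental_groupoid K) (Id (looped_fundamental_groupoid K) x) f = f"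
    "Comp (looped_fundamental_groupoid K) f (Id (looped_fundamental_groupoid K) y) = f"
    using p Comp_walk_class[OF K, of "[x]" p] Comp_walk_class[OF K, of p "[y]"]
    by (auto simp: Id_looped_fundamental_groupoid)
next
  fix w x y z f g h
  assume "f \<in> Hom (looped_fundamental_groupoid K) w x" "g \<in> Hom (looped_fundamental_groupoid K) x y"
    "h \<in> Hom (looped_fundamental_groupoid K) y z"
  then obtain p q r where p: "looped_walk K p" "last p = x" "f = walk_class K p"
    and q: "looped_walk K q" "hd q = x" "last q = y" "g = walk_class K q"
    and r: "looped_walk K r" "hd r = y" "h = walk_class K r"
    by (auto simp: Hom_looped_fundamental_groupoid)
  have "last (p @ tl q) = y" "hd (q @ tl r) = x" "tl (q @ tl r) = tl q @ tl r"
    using p q looped_walk_nonempty[of K p] looped_walk_nonempty[of K q]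
    by (auto simp: last_append last_tl) (cases q; simp)
  then show "Comp (looped_fundamental_groupoid K) (Comp (looped_fundamental_groupoid K) f g) h =
             Comp (looped_fundamental_groupoid K) f (Comp (looped_fundamental_groupoid K) g h)"
    using p q r by (simp add: Comp_walk_class[OF K] looped_walk_concat[OF K])
qed

section \<open>Functors out of the looped fundamental groupoid\<close>

fun walk_eval :: "('o, 'm) category \<Rightarrow> ('a \<Rightarrow> 'o) \<Rightarrow> ('a \<Rightarrow> 'a \<Rightarrow> 'm) \<Rightarrow> 'a list \<Rightarrow> 'm" where
  "walk_eval D P E [] = undefined"
| "walk_eval D P E [x] = Id D (P x)"
| "walk_eval D P E (x # y # \<alpha>) = Comp D (E x y) (walk_eval D P E (y # \<alpha>))"

text \<open>A presentation of the looped groupoid: generators are the edges between looped vertices,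
  relations are degenerate edges and triangles. Invertibility follows: the triangle
  \<open>x\<close>, \<open>y\<close>, \<open>x\<close> makes \<open>E y x\<close> inverse to
  \<open>E x y\<close>.\<close>

locale walk_representation =
  fixes K :: "'a ugraph" and D :: "('o, 'm) category" and P :: "'a \<Rightarrow> 'o" and E :: "'a \<Rightarrow> 'a \<Rightarrow> 'm"
  assumes graph: "is_graph K" and category: "is_category D"
    and P: "\<And>x. x \<in> looped_verts K \<Longrightarrow> P x \<in> Obj D"
    and E: "\<And>x y. \<lbrakk>x \<in> looped_verts K; y \<in> looped_verts K; (x, y) \<in> edges K\<rbrakk> \<Longrightarrow>
      E x y \<in> Hom D (P x) (P y)"
    and E_refl: "\<And>x. x \<in> looped_verts K \<Longrightarrow> E x x = Id D (P x)"
    and E_triangle: "\<And>x y z. \<lbrakk>x \<in> looped_verts K; y \<in> looped_verts K; z \<in> looped_verts K;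
      (x, y) \<in> edges K; (y, z) \<in> edges K; (x, z) \<in> edges K\<rbrakk> \<Longrightarrow> Comp D (E x y) (E y z) = E x z"
begin

abbreviation "ev \<equiv> walk_eval D P E"

lemma ev_Hom: "looped_walk K \<alpha> \<Longrightarrow> ev \<alpha> \<in> Hom D (P (hd \<alpha>)) (P (last \<alpha>))"
proof (induction \<alpha> rule: induct_list012)
  case (2 x)
  then show ?case using category_Id[OF category] P by (simp add: looped_walk_iff[OF graph])
next
  case (3 x y \<alpha>)
  then have "looped_walk K (y # \<alpha>)" "last (y # \<alpha>) \<in> looped_verts K"
    using last_in_set[of "y # \<alpha>"] by (auto simp: looped_walk_iff[OF graph])
  then show ?case
    using category_Comp[OF category E] 3 P by (simp add: looped_walk_iff[OF graph])
qed (simp add: looped_walk_def)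

lemma ev_append:
  assumes "looped_walk K \<alpha>" "looped_walk K \<beta>" "last \<alpha> = hd \<beta>"
  shows "ev (\<alpha> @ tl \<beta>) = Comp D (ev \<alpha>) (ev \<beta>)"
  using assms
proof (induction \<alpha> rule: induct_list012)
  case (2 x)
  then have "last \<beta> \<in> looped_verts K" "hd \<beta> \<in> looped_verts K" "\<beta> \<noteq> []"
    by (auto simp: looped_walk_iff[OF graph])
  then show ?case
    using 2 category_Id_left[OF category ev_Hom[of \<beta>]] P by (cases \<beta>) auto
next
  case (3 x y \<alpha>)
  have w: "looped_walk K (y # \<alpha>)" "last (y # \<alpha>) \<in> looped_verts K" "last \<beta> \<in> looped_verts K"
    "x \<in> looped_verts K" "y \<in> looped_verts K" "(x, y) \<in> edges K"
    using 3 last_in_set[of "y # \<alpha>"] by (auto simp: looped_walk_iff[OF graph])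
  have "ev (y # \<alpha>) \<in> Hom D (P y) (P (hd \<beta>))" "ev \<beta> \<in> Hom D (P (hd \<beta>)) (P (last \<beta>))"
    using ev_Hom[OF w(1)] ev_Hom[of \<beta>] 3 by simp_all
  moreover have "hd \<beta> = last (y # \<alpha>)" using 3 by simp
  ultimately show ?case
    using 3 category_assoc[OF category E[of x y], of "ev (y # \<alpha>)" "P (hd \<beta>)" "ev \<beta>" "P (last \<beta>)"] w P
    by simp
qed (simp add: looped_walk_def)

text \<open>Equal heads matter because the arrow that leads from the prefix into the suffix depends
  on the head of the suffix.\<close>

lemma ev_append_cong:
  assumes "ev \<beta> = ev \<gamma>" "hd \<beta> = hd \<gamma>" "\<beta> \<noteq> []" "\<gamma> \<noteq> []"
  shows "ev (\<alpha> @ \<beta>) = ev (\<alpha> @ \<gamma>)"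
proof (induction \<alpha> rule: induct_list012)
  case (2 x)
  then show ?case using assms by (cases \<beta>; cases \<gamma>) auto
qed (use assms in auto)

text \<open>By \<open>ev_append_cong\<close> a move may be assumed to happen at the start of the
  list, where \<open>walk_eval\<close> unfolds. Duplication is then the left unit law, and the
  triangle move is associativity together with \<open>E_triangle\<close>.\<close>

sublocale walk_invariant K ev
proof
  fix \<alpha> v \<beta> assume "looped_walk K (\<alpha> @ [v] @ \<beta>)"
  then have "looped_walk K (v # \<beta>)" "v \<in> looped_verts K" "last (v # \<beta>) \<in> looped_verts K"
    using last_in_set[of "v # \<beta>"] by (auto simp: looped_walk_iff[OF graph] successively_append_iff)
  then have "ev ([v, v] @ \<beta>) = ev ([v] @ \<beta>)"
    using category_Id_left[OF category ev_Hom[of "v # \<beta>"]] P E_refl by simp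
  then show "ev (\<alpha> @ [v, v] @ \<beta>) = ev (\<alpha> @ [v] @ \<beta>)"
    by (rule ev_append_cong) auto
next
  fix \<alpha> a b c \<beta> assume "looped_walk K (\<alpha> @ [a, b, c] @ \<beta>)" and ac: "(a, c) \<in> edges K"
  then have "looped_walk K (c # \<beta>)" "last (c # \<beta>) \<in> looped_verts K" "(a, b) \<in> edges K" "(b, c) \<in> edges K"
    "a \<in> looped_verts K" "b \<in> looped_verts K" "c \<in> looped_verts K"
    using last_in_set[of "c # \<beta>"]
    by (auto simp: looped_walk_iff[OF graph] successively_append_iff)
  moreover from this have "ev (c # \<beta>) \<in> Hom D (P c) (P (last (c # \<beta>)))"
    using ev_Hom[of "c # \<beta>"] by simp
  ultimately have "ev ([a, b, c] @ \<beta>) = ev ([a, c] @ \<beta>)"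
    using category_assoc[OF category E[of a b] E[of b c], of "ev (c # \<beta>)" "P (last (c # \<beta>))"]
      P E_triangle ac by simp
  then show "ev (\<alpha> @ [a, b, c] @ \<beta>) = ev (\<alpha> @ [a, c] @ \<beta>)"
    by (rule ev_append_cong) auto
qed (rule graph)

definition lift :: "'a list set \<Rightarrow> 'm" where
  "lift A = ev (SOME \<alpha>. \<alpha> \<in> A)"

lemma lift_class: "lift (walk_class K \<alpha>) = ev \<alpha>"
proof -
  have "(SOME \<beta>. \<beta> \<in> walk_class K \<alpha>) \<in> walk_class K \<alpha>"
    using walk_class_self by (rule someI)
  then show ?thesis
    using walk_equiv_invariant unfolding lift_def walk_class_def by (metis Image_singleton_iff)
qed

lemma lift_edge:
  assumes "x \<in> looped_verts K" "y \<in> looped_verts K" "(x, y) \<in> edges K"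
  shows "lift (walk_class K [x, y]) = E x y"
  using category_Id_right[OF category E] P assms by (simp add: lift_class)

lemma is_functor_lift: "is_functor (looped_fundamental_groupoid K) D P lift"
  unfolding is_functor_def
proof (intro conjI ballI)
  fix x y f assume "f \<in> Hom (looped_fundamental_groupoid K) x y"
  then show "lift f \<in> Hom D (P x) (P y)"
    using ev_Hom by (auto simp: Hom_looped_fundamental_groupoid lift_class)
next
  fix x y z f g
  assume "f \<in> Hom (looped_fundamental_groupoid K) x y" "g \<in> Hom (looped_fundamental_groupoid K) y z"
  then show "lift (Comp (looped_fundamental_groupoid K) f g) = Comp D (lift f) (lift g)"
    by (auto simp: Hom_looped_fundamental_groupoid Comp_walk_class[OF graph] lift_class ev_append)
qed (simp_all add: P Id_looped_fundamental_groupoid lift_class)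

end

subsection \<open>Transport along paths\<close>

text \<open>
  A partial transport \<open>e\<close> that is only defined between \<open>R\<close>-related points, and functorial on
  pairwise related triples. Nearby points of a path need not be related to each other: only to
  a common centre. Hence a step of the transport goes through a centre.
\<close>

locale local_system =
  fixes C :: "('o, 'm) category" and R :: "'z \<Rightarrow> 'z \<Rightarrow> bool"
    and v :: "'z \<Rightarrow> 'o" and e :: "'z \<Rightarrow> 'z \<Rightarrow> 'm"
  assumes category: "is_category C"
    and R_sym: "R x y \<Longrightarrow> R y x"
    and R_refl: "R x y \<Longrightarrow> R x x"
    and v: "R x x \<Longrightarrow> v x \<in> Obj C"
    and e: "R x y \<Longrightarrow> e x y \<in> Hom C (v x) (v y)"
    and e_refl: "R x x \<Longrightarrow> e x x = Id C (v x)"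
    and e_triangle: "R x y \<Longrightarrow> R y z \<Longrightarrow> R x z \<Longrightarrow> Comp C (e x y) (e y z) = e x z"
begin

abbreviation comp (infixl "\<cdot>" 70) where "f \<cdot> g \<equiv> Comp C f g"

lemma v_Obj: "R x y \<Longrightarrow> v x \<in> Obj C" "R x y \<Longrightarrow> v y \<in> Obj C"
  using v R_refl R_sym by blast+

definition via :: "'z \<Rightarrow> 'z \<Rightarrow> 'z \<Rightarrow> 'm" where
  "via c x y = e x c \<cdot> e c y"

lemma via_Hom: "R x c \<Longrightarrow> R y c \<Longrightarrow> via c x y \<in> Hom C (v x) (v y)"
  unfolding via_def using category_Comp[OF category] e v_Obj R_sym by metis

text \<open>The detour from \<open>c\<close> to \<open>y\<close> and back cancels by the degenerate
  triangle \<open>c\<close>, \<open>y\<close>, \<open>c\<close>.\<close>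

lemma via_comp:
  assumes "R x c" "R y c" "R z c"
  shows "via c x y \<cdot> via c y z = via c x z"
proof -
  have r: "R c y" "R c z" "R c c" using assms R_sym R_refl by blast+
  have o: "v x \<in> Obj C" "v y \<in> Obj C" "v z \<in> Obj C" "v c \<in> Obj C"
    using assms r v_Obj by blast+
  have "e x c \<cdot> e c y \<cdot> (e y c \<cdot> e c z) = e x c \<cdot> (e c y \<cdot> (e y c \<cdot> e c z))"
    using category_assoc[OF category e[OF assms(1)] e[OF r(1)] category_Comp[OF category e[OF assms(2)] e[OF r(2)]]] o
    by blast
  also have "e c y \<cdot> (e y c \<cdot> e c z) = (e c y \<cdot> e y c) \<cdot> e c z"
    using category_assoc[OF category e[OF r(1)] e[OF assms(2)] e[OF r(2)]] o by simp
  also have "e c y \<cdot> e y c = e c c" using e_triangle assms r by blast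
  also have "e c c \<cdot> e c z = e c z" using e_triangle r by blast
  finally show ?thesis by (simp add: via_def)
qed

text \<open>With the two centres related, the triangles \<open>x\<close>, \<open>w\<close>,
  \<open>c\<close> and \<open>w\<close>, \<open>c\<close>, \<open>y\<close> are available and move
  the detour from \<open>c\<close> to \<open>w\<close>.\<close>

lemma via_change_centre:
  assumes "R x c" "R y c" "R x w" "R y w" "R w c"
  shows "via c x y = via w x y"
proof -
  have r: "R c y" "R w y" "R c w" using assms R_sym by blast+
  have o: "v x \<in> Obj C" "v y \<in> Obj C" "v w \<in> Obj C" "v c \<in> Obj C"
    using assms v_Obj by blast+
  have "via c x y = (e x w \<cdot> e w c) \<cdot> e c y"
    using e_triangle[of x w c] assms by (simp add: via_def)
  also have "\<dots> = e x w \<cdot> (e w c \<cdot> e c y)"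
    using category_assoc[OF category e[OF assms(3)] e[OF assms(5)] e[OF r(1)]] o by simp
  also have "e w c \<cdot> e c y = e w y"
    using e_triangle r assms by blast
  finally show ?thesis by (simp add: via_def)
qed

text \<open>A relation instead of a function: no subdivision and no centres are chosen, and
  uniqueness becomes a theorem, obtained from homotopy invariance.\<close>

inductive transport :: "(real \<Rightarrow> 'z) \<Rightarrow> real \<Rightarrow> real \<Rightarrow> 'm \<Rightarrow> bool" for p where
  star: "a \<le> b \<Longrightarrow> (\<And>t. a \<le> t \<Longrightarrow> t \<le> b \<Longrightarrow> R (p t) c) \<Longrightarrow> transport p a b (via c (p a) (p b))"
| trans: "transport p a b f \<Longrightarrow> transport p b d g \<Longrightarrow> transport p a d (f \<cdot> g)"

lemma transport_le: "transport p a b f \<Longrightarrow> a \<le> b"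
  by (induction rule: transport.induct) auto

lemma transport_Obj: "transport p a b f \<Longrightarrow> v (p a) \<in> Obj C \<and> v (p b) \<in> Obj C"
  by (induction rule: transport.induct) (use v_Obj in auto)

lemma transport_Hom: "transport p a b f \<Longrightarrow> f \<in> Hom C (v (p a)) (v (p b))"
proof (induction rule: transport.induct)
  case (trans a b f d g)
  then show ?case using category_Comp[OF category] transport_Obj by blast
qed (simp add: via_Hom)

lemma transport_assoc:
  assumes "transport p a b f" "transport q a' b' g" "transport r a'' b'' h"
    "p b = q a'" "q b' = r a''"
  shows "f \<cdot> g \<cdot> h = f \<cdot> (g \<cdot> h)"
  using category_assoc[OF category transport_Hom[OF assms(1)], of g "v (q b')" h "v (r b'')"]
    transport_Hom[OF assms(2)] transport_Hom[OF assms(3)]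
    transport_Obj[OF assms(1)] transport_Obj[OF assms(2)] transport_Obj[OF assms(3)] assms(4,5)
  by simp

text \<open>A cut inside a star keeps the centre on both sides; a cut elsewhere is passed to one of
  the two factors. Sides of subdivided rectangles are split in this way.\<close>

lemma transport_split:
  assumes "transport p a b f" "a \<le> m" "m \<le> b"
  shows "\<exists>g h. transport p a m g \<and> transport p m b h \<and> f = g \<cdot> h"
  using assms
proof (induction arbitrary: m rule: transport.induct)
  case (star a b c)
  then have "via c (p a) (p b) = via c (p a) (p m) \<cdot> via c (p m) (p b)"
    by (simp add: via_comp)
  moreover have "transport p a m (via c (p a) (p m))" "transport p m b (via c (p m) (p b))"
    using star by (auto intro: transport.star)
  ultimately show ?case by blast
next
  case (trans a b f d g)
  show ?case
  proof (cases "m \<le> b")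
    case True
    then obtain f1 f2 where "transport p a m f1" "transport p m b f2" "f = f1 \<cdot> f2"
      using trans by blast
    moreover from this have "transport p m d (f2 \<cdot> g)" "f \<cdot> g = f1 \<cdot> (f2 \<cdot> g)"
      using trans.hyps transport.trans transport_assoc[of p a m f1 p m b f2 p b d g] by auto
    ultimately show ?thesis by blast
  next
    case False
    then obtain g1 g2 where "transport p b m g1" "transport p m d g2" "g = g1 \<cdot> g2"
      using trans by (metis linear)
    moreover from this have "transport p a m (f \<cdot> g1)" "f \<cdot> g = f \<cdot> g1 \<cdot> g2"
      using trans.hyps transport.trans transport_assoc[of p a b f p b m g1 p m d g2] by auto
    ultimately show ?thesis by blast
  qed
qed

text \<open>Agreement of \<open>q\<close> with the reparametrised \<open>p\<close> is asked only
  over the interval concerned, since a concatenation is an affine copy of either factor on one half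
  only.\<close>

lemma transport_affine:
  assumes "transport p a b f" "0 < m" "\<And>t. a \<le> m * t + c \<Longrightarrow> m * t + c \<le> b \<Longrightarrow> q t = p (m * t + c)"
  shows "transport q ((a - c) / m) ((b - c) / m) f"
  using assms
proof (induction rule: transport.induct)
  case (star a b k)
  have ends: "q ((a - c) / m) = p a" "q ((b - c) / m) = p b" using star by auto
  have "transport q ((a - c) / m) ((b - c) / m) (via k (q ((a - c) / m)) (q ((b - c) / m)))"
  proof (rule transport.star)
    fix t assume "(a - c) / m \<le> t" "t \<le> (b - c) / m"
    then have "a \<le> m * t + c" "m * t + c \<le> b"
      using \<open>0 < m\<close> by (simp_all add: field_simps)
    then show "R (q t) k" using star by simp
  qed (use star in \<open>simp add: divide_right_mono\<close>)
  then show ?case by (simp add: ends)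
next
  case (trans a b f d g)
  then have "a \<le> b" "b \<le> d" using transport_le by blast+
  then have "transport q ((a - c) / m) ((b - c) / m) f" "transport q ((b - c) / m) ((d - c) / m) g"
    using trans by auto
  then show ?case by (rule transport.trans)
qed

lemma transport_cong:
  assumes "transport p a b f" "\<And>t. a \<le> t \<Longrightarrow> t \<le> b \<Longrightarrow> q t = p t"
  shows "transport q a b f"
  using transport_affine[OF assms(1), of 1 0 q] assms(2) by simp

section \<open>Existence of transport and its independence of centres\<close>

definition tame :: "(real \<Rightarrow> 'z) \<Rightarrow> real \<Rightarrow> real \<Rightarrow> bool" where
  "tame p a b \<longleftrightarrow> (\<forall>x\<in>{a..b}. \<exists>d>0. \<forall>t\<in>{a..b}. \<bar>t - x\<bar> < d \<longrightarrow> R (p t) (p x))"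

lemma tame_subinterval: "tame p a b \<Longrightarrow> a \<le> a' \<Longrightarrow> b' \<le> b \<Longrightarrow> tame p a' b'"
  unfolding tame_def by (meson atLeastAtMost_iff order_trans)

text \<open>Bisection replaces a Lebesgue number. The local case offers a centre on the path itself,
  which is then related to anything the whole path is related to.\<close>

lemma tame_interval_induct:
  assumes "a \<le> b" and tame: "tame p a b"
    and trans: "\<And>x y z. a \<le> x \<Longrightarrow> x \<le> y \<Longrightarrow> y \<le> z \<Longrightarrow> z \<le> b \<Longrightarrow> P x y \<Longrightarrow> P y z \<Longrightarrow> P x z"
    and local: "\<And>x y c. a \<le> x \<Longrightarrow> x \<le> c \<Longrightarrow> c \<le> y \<Longrightarrow> y \<le> b \<Longrightarrow>
      (\<And>t. x \<le> t \<Longrightarrow> t \<le> y \<Longrightarrow> R (p t) (p c)) \<Longrightarrow> P x y"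
  shows "P a b"
proof -
  \<comment> \<open>The local case of \<open>Bolzano\<close> also ranges over intervals that leave
    \<open>[a, b]\<close>; the guard makes the claim vacuous for those.\<close>
  have "a \<le> a \<and> b \<le> b \<longrightarrow> P a b"
    using \<open>a \<le> b\<close>
  proof (induction rule: Bolzano[where P = "\<lambda>x y. a \<le> x \<and> y \<le> b \<longrightarrow> P x y"])
    case (local c)
    then obtain d where d: "d > 0" "\<forall>t\<in>{a..b}. \<bar>t - c\<bar> < d \<longrightarrow> R (p t) (p c)"
      using bspec[OF tame[unfolded tame_def], of c] by auto
    show ?case
    proof (intro exI[of _ d] conjI allI impI)
      fix x y assume *: "x \<le> c \<and> c \<le> y \<and> y - x < d" "a \<le> x \<and> y \<le> b"
      show "P x y"
      proof (rule assms(4))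
        fix t assume "x \<le> t" "t \<le> y"
        then have "t \<in> {a..b}" "\<bar>t - c\<bar> < d" using * by auto
        then show "R (p t) (p c)" using d by blast
      qed (use * in auto)
    qed (use d in auto)
  qed (use trans in \<open>meson order_trans\<close>)
  then show ?thesis by blast
qed

lemma transport_exists:
  assumes "a \<le> b" "tame p a b"
  shows "\<exists>f. transport p a b f"
proof (rule tame_interval_induct[OF assms])
  fix x y c assume "x \<le> c" "c \<le> y" "\<And>t. x \<le> t \<Longrightarrow> t \<le> y \<Longrightarrow> R (p t) (p c)"
  then show "\<exists>f. transport p x y f" using transport.star by (meson order_trans)
qed (use transport.trans in blast)

text \<open>The centres \<open>c\<close> and \<open>c'\<close> need not be related to each other, so
  they cannot be compared directly. On short pieces both are compared with a point
  \<open>p w\<close> of the path, which is related to \<open>c\<close> and to \<open>c'\<close>;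
  \<open>via_comp\<close> glues the pieces.\<close>

lemma via_unique:
  assumes "a \<le> b" "tame p a b"
    and "\<And>t. a \<le> t \<Longrightarrow> t \<le> b \<Longrightarrow> R (p t) c" "\<And>t. a \<le> t \<Longrightarrow> t \<le> b \<Longrightarrow> R (p t) c'"
  shows "via c (p a) (p b) = via c' (p a) (p b)"
proof (rule tame_interval_induct[OF assms(1,2)])
  fix x y z assume "a \<le> x" "x \<le> y" "y \<le> z" "z \<le> b"
    "via c (p x) (p y) = via c' (p x) (p y)" "via c (p y) (p z) = via c' (p y) (p z)"
  then show "via c (p x) (p z) = via c' (p x) (p z)"
    using via_comp[of "p x" c "p y" "p z"] via_comp[of "p x" c' "p y" "p z"] assms(3,4) by force
next
  fix x y w assume *: "a \<le> x" "x \<le> w" "w \<le> y" "y \<le> b" "\<And>t. x \<le> t \<Longrightarrow> t \<le> y \<Longrightarrow> R (p t) (p w)"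
  have "R (p x) (p w)" "R (p y) (p w)" using * by simp_all
  then have "via k (p x) (p y) = via (p w) (p x) (p y)" if "\<And>t. a \<le> t \<Longrightarrow> t \<le> b \<Longrightarrow> R (p t) k" for k
    using via_change_centre[of "p x" k "p y" "p w"] that * by simp
  from this[OF assms(3)] this[OF assms(4)]
  show "via c (p x) (p y) = via c' (p x) (p y)" by simp
qed

text \<open>A derivation may use many different centres; \<open>via_unique\<close> trades each of
  them for \<open>c\<close>, and then the intermediate points cancel.\<close>

lemma transport_in_star:
  assumes "transport p a b f" "tame p a b" "\<And>t. a \<le> t \<Longrightarrow> t \<le> b \<Longrightarrow> R (p t) c"
  shows "f = via c (p a) (p b)"
  using assms
proof (induction rule: transport.induct)
  case (star a b c')
  then show ?case using via_unique by blast
next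
  case (trans a b f d g)
  then have ab: "a \<le> b" "b \<le> d" using transport_le by blast+
  then have "tame p a b" "tame p b d" using trans.prems tame_subinterval by (metis order_refl)+
  then have "f = via c (p a) (p b)" "g = via c (p b) (p d)"
    using trans ab by auto
  then show ?case using via_comp trans.prems(2) ab by auto
qed

text \<open>Boundary holonomy of rectangles is trivial: bisect first one side, then the other.\<close>

definition trivial_holonomy :: "(real \<times> real \<Rightarrow> 'z) \<Rightarrow> real \<Rightarrow> real \<Rightarrow> real \<Rightarrow> real \<Rightarrow> bool" where
  "trivial_holonomy h s s' t t' \<longleftrightarrow> (\<forall>f g k l.
     transport (\<lambda>x. h (x, t)) s s' f \<longrightarrow> transport (\<lambda>y. h (s', y)) t t' g \<longrightarrow>
     transport (\<lambda>y. h (s, y)) t t' k \<longrightarrow> transport (\<lambda>x. h (x, t')) s s' l \<longrightarrow> f \<cdot> g = k \<cdot> l)"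

context
  fixes h :: "real \<times> real \<Rightarrow> 'z"
  assumes h: "\<And>x. x \<in> {0..1} \<times> {0..1} \<Longrightarrow>
    \<exists>d>0. \<forall>y\<in>{0..1} \<times> {0..1}. dist y x < d \<longrightarrow> R (h y) (h x)"
begin

lemma tame_row: "0 \<le> t \<Longrightarrow> t \<le> 1 \<Longrightarrow> 0 \<le> a \<Longrightarrow> b \<le> 1 \<Longrightarrow> tame (\<lambda>x. h (x, t)) a b"
  and tame_column: "0 \<le> t \<Longrightarrow> t \<le> 1 \<Longrightarrow> 0 \<le> a \<Longrightarrow> b \<le> 1 \<Longrightarrow> tame (\<lambda>y. h (t, y)) a b"
proof -
  assume *: "0 \<le> t" "t \<le> 1" "0 \<le> a" "b \<le> 1"
  show "tame (\<lambda>x. h (x, t)) a b" unfolding tame_def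
  proof
    fix x assume x: "x \<in> {a..b}"
    then obtain d where "d > 0" "\<forall>y\<in>{0..1} \<times> {0..1}. dist y (x, t) < d \<longrightarrow> R (h y) (h (x, t))"
      using h[of "(x, t)"] * by auto
    then show "\<exists>d>0. \<forall>u\<in>{a..b}. \<bar>u - x\<bar> < d \<longrightarrow> R (h (u, t)) (h (x, t))"
      using * x by (intro exI[of _ d]) (auto simp: dist_Pair_Pair dist_real_def)
  qed
  show "tame (\<lambda>y. h (t, y)) a b" unfolding tame_def
  proof
    fix x assume x: "x \<in> {a..b}"
    then obtain d where "d > 0" "\<forall>y\<in>{0..1} \<times> {0..1}. dist y (t, x) < d \<longrightarrow> R (h y) (h (t, x))"
      using h[of "(t, x)"] * by auto
    then show "\<exists>d>0. \<forall>u\<in>{a..b}. \<bar>u - x\<bar> < d \<longrightarrow> R (h (t, u)) (h (t, x))"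
      using * x by (intro exI[of _ d]) (auto simp: dist_Pair_Pair dist_real_def)
  qed
qed

lemma trivial_holonomy_row:
  assumes "trivial_holonomy h s s' t t'" "trivial_holonomy h s' s'' t t'"
    and le: "0 \<le> s" "s \<le> s'" "s' \<le> s''" "s'' \<le> 1" "0 \<le> t" "t \<le> t'" "t' \<le> 1"
  shows "trivial_holonomy h s s'' t t'"
  unfolding trivial_holonomy_def
proof (intro allI impI)
  fix f g k l assume f: "transport (\<lambda>x. h (x, t)) s s'' f" and g: "transport (\<lambda>y. h (s'', y)) t t' g"
    and k: "transport (\<lambda>y. h (s, y)) t t' k" and l: "transport (\<lambda>x. h (x, t')) s s'' l"
  obtain f1 f2 where f12: "transport (\<lambda>x. h (x, t)) s s' f1" "transport (\<lambda>x. h (x, t)) s' s'' f2" "f = f1 \<cdot> f2"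
    using transport_split[OF f le(2,3)] by blast
  obtain l1 l2 where l12: "transport (\<lambda>x. h (x, t')) s s' l1" "transport (\<lambda>x. h (x, t')) s' s'' l2" "l = l1 \<cdot> l2"
    using transport_split[OF l le(2,3)] by blast
  \<comment> \<open>Triviality of holonomy speaks of given transports along all four sides, so the
    common side of the two rectangles must be supplied with one.\<close>
  obtain m where m: "transport (\<lambda>y. h (s', y)) t t' m"
    using transport_exists tame_column le by (meson order_trans)
  have "f1 \<cdot> m = k \<cdot> l1" "f2 \<cdot> g = m \<cdot> l2"
    using assms f12 l12 g k m unfolding trivial_holonomy_def by blast+
  then show "f \<cdot> g = k \<cdot> l"
    using transport_assoc[OF f12(1,2) g] transport_assoc[OF f12(1) m l12(2)] transport_assoc[OF k l12(1,2)]
    by (simp add: f12 l12)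
qed

lemma trivial_holonomy_column:
  assumes "trivial_holonomy h s s' t t'" "trivial_holonomy h s s' t' t''"
    and le: "0 \<le> s" "s \<le> s'" "s' \<le> 1" "0 \<le> t" "t \<le> t'" "t' \<le> t''" "t'' \<le> 1"
  shows "trivial_holonomy h s s' t t''"
  unfolding trivial_holonomy_def
proof (intro allI impI)
  fix f g k l assume f: "transport (\<lambda>x. h (x, t)) s s' f" and g: "transport (\<lambda>y. h (s', y)) t t'' g"
    and k: "transport (\<lambda>y. h (s, y)) t t'' k" and l: "transport (\<lambda>x. h (x, t'')) s s' l"
  obtain g1 g2 where g12: "transport (\<lambda>y. h (s', y)) t t' g1" "transport (\<lambda>y. h (s', y)) t' t'' g2" "g = g1 \<cdot> g2"
    using transport_split[OF g le(5,6)] by blast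
  obtain k1 k2 where k12: "transport (\<lambda>y. h (s, y)) t t' k1" "transport (\<lambda>y. h (s, y)) t' t'' k2" "k = k1 \<cdot> k2"
    using transport_split[OF k le(5,6)] by blast
  obtain m where m: "transport (\<lambda>x. h (x, t')) s s' m"
    using transport_exists tame_row le by (meson order_trans)
  have "f \<cdot> g1 = k1 \<cdot> m" "m \<cdot> g2 = k2 \<cdot> l"
    using assms g12 k12 f l m unfolding trivial_holonomy_def by blast+
  then show "f \<cdot> g = k \<cdot> l"
    using transport_assoc[OF f g12(1,2)] transport_assoc[OF k12(1) m g12(2)] transport_assoc[OF k12(1,2) l]
    by (simp add: g12 k12)
qed

text \<open>All four sides are computed through the one centre \<open>c\<close>, and both composites
  equal the detour through \<open>c\<close> between opposite corners.\<close>

lemma trivial_holonomy_in_star: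
  assumes le: "0 \<le> s" "s \<le> s'" "s' \<le> 1" "0 \<le> t" "t \<le> t'" "t' \<le> 1"
    and star: "\<And>x y. s \<le> x \<Longrightarrow> x \<le> s' \<Longrightarrow> t \<le> y \<Longrightarrow> y \<le> t' \<Longrightarrow> R (h (x, y)) c"
  shows "trivial_holonomy h s s' t t'"
  unfolding trivial_holonomy_def
proof (intro allI impI)
  fix f g k l assume f: "transport (\<lambda>x. h (x, t)) s s' f" and g: "transport (\<lambda>y. h (s', y)) t t' g"
    and k: "transport (\<lambda>y. h (s, y)) t t' k" and l: "transport (\<lambda>x. h (x, t')) s s' l"
  have "f = via c (h (s, t)) (h (s', t))" "g = via c (h (s', t)) (h (s', t'))"
    "k = via c (h (s, t)) (h (s, t'))" "l = via c (h (s, t')) (h (s', t'))"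
    using transport_in_star[OF f tame_row, of c] transport_in_star[OF g tame_column, of c]
      transport_in_star[OF k tame_column, of c] transport_in_star[OF l tame_row, of c] le star by auto
  then show "f \<cdot> g = k \<cdot> l"
    using via_comp star le by auto
qed

lemma trivial_holonomy_square: "trivial_holonomy h 0 1 0 1"
proof -
  \<comment> \<open>This is the tube lemma for the line at height \<open>t0\<close>. The height
    bound \<open>d\<close> sits inside the bisected property, so joining two adjacent intervals
    takes the minimum of their bounds.\<close>
  have strip: "\<exists>d>0. \<forall>t t'. t \<le> t0 \<and> t0 \<le> t' \<and> t' - t < d \<and> 0 \<le> t \<and> t' \<le> 1 \<longrightarrow> trivial_holonomy h 0 1 t t'"
    if t0: "0 \<le> t0" "t0 \<le> 1" for t0
  proof -
    have "0 \<le> (1::real)" by simp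
    then have "0 \<le> (0::real) \<and> 1 \<le> (1::real) \<longrightarrow> (\<exists>d>0. \<forall>t t'. t \<le> t0 \<and> t0 \<le> t' \<and> t' - t < d \<and> 0 \<le> t \<and> t' \<le> 1 \<longrightarrow>
        trivial_holonomy h 0 1 t t')"
    proof (induction rule: Bolzano[where P = "\<lambda>s s'. 0 \<le> s \<and> s' \<le> 1 \<longrightarrow>
        (\<exists>d>0. \<forall>t t'. t \<le> t0 \<and> t0 \<le> t' \<and> t' - t < d \<and> 0 \<le> t \<and> t' \<le> 1 \<longrightarrow> trivial_holonomy h s s' t t')"])
      case (trans s s' s'')
      show ?case
      proof
        assume s: "0 \<le> s \<and> s'' \<le> 1"
        obtain d1 where d1: "d1 > 0" "\<forall>t t'. t \<le> t0 \<and> t0 \<le> t' \<and> t' - t < d1 \<and> 0 \<le> t \<and> t' \<le> 1 \<longrightarrow> trivial_holonomy h s s' t t'"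
          using trans s by force
        obtain d2 where d2: "d2 > 0" "\<forall>t t'. t \<le> t0 \<and> t0 \<le> t' \<and> t' - t < d2 \<and> 0 \<le> t \<and> t' \<le> 1 \<longrightarrow> trivial_holonomy h s' s'' t t'"
          using trans s by force
        show "\<exists>d>0. \<forall>t t'. t \<le> t0 \<and> t0 \<le> t' \<and> t' - t < d \<and> 0 \<le> t \<and> t' \<le> 1 \<longrightarrow> trivial_holonomy h s s'' t t'"
          using d1 d2 trans(3,4) s
          by (intro exI[of _ "min d1 d2"]) (auto intro!: trivial_holonomy_row[of s s' _ _ s''])
      qed
    next
      case (local s0)
      obtain d where d: "d > 0" "\<forall>y\<in>{0..1} \<times> {0..1}. dist y (s0, t0) < d \<longrightarrow> R (h y) (h (s0, t0))"
        using h[of "(s0, t0)"] local t0 by auto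
      \<comment> \<open>The halves bound the Euclidean distance in the plane by the sum of the
        coordinate distances.\<close>
      have near: "R (h (x, y)) (h (s0, t0))"
        if "x \<in> {0..1}" "y \<in> {0..1}" "\<bar>x - s0\<bar> < d / 2" "\<bar>y - t0\<bar> < d / 2" for x y
      proof -
        have "dist (x, y) (s0, t0) \<le> \<bar>x - s0\<bar> + \<bar>y - t0\<bar>"
          using sqrt_sum_squares_le_sum_abs[of "x - s0" "y - t0"]
          by (simp add: dist_Pair_Pair dist_real_def)
        then show ?thesis using d that by auto
      qed
      show ?case
      proof (intro exI[of _ "d / 2"] conjI allI impI)
        fix s s' t t' assume "s \<le> s0 \<and> s0 \<le> s' \<and> s' - s < d / 2" "0 \<le> s \<and> s' \<le> 1"
          "t \<le> t0 \<and> t0 \<le> t' \<and> t' - t < d / 2 \<and> 0 \<le> t \<and> t' \<le> 1"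
        moreover from this have "\<bar>x - s0\<bar> < d / 2" "\<bar>y - t0\<bar> < d / 2"
          if "s \<le> x" "x \<le> s'" "t \<le> y" "y \<le> t'" for x y
          using that unfolding abs_less_iff by linarith+
        ultimately show "trivial_holonomy h s s' t t'"
          by (intro trivial_holonomy_in_star[where c = "h (s0, t0)"] near) auto
      qed (use d in auto)
    qed
    then show ?thesis by simp
  qed
  have "0 \<le> (1::real)" by simp
  then have "0 \<le> (0::real) \<and> 1 \<le> (1::real) \<longrightarrow> trivial_holonomy h 0 1 0 1"
  proof (induction rule: Bolzano[where P = "\<lambda>t t'. 0 \<le> t \<and> t' \<le> 1 \<longrightarrow> trivial_holonomy h 0 1 t t'"])
    case (trans t t' t'')
    then show ?case using trivial_holonomy_column[of 0 1 t t' t''] by auto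
  next
    case (local t0)
    then show ?case using strip[of t0] by blast
  qed
  then show ?thesis by simp
qed

end

end

text \<open>Locality of \<open>R\<close> is stated for maps from the interval and the square instead
  of by open stars in \<open>X\<close>: the former carry transport along a path, the latter its
  homotopy invariance.\<close>

locale topological_local_system = local_system C R v e
  for C :: "('o, 'm) category" and R :: "'z \<Rightarrow> 'z \<Rightarrow> bool" and v e +
  fixes X :: "'z topology"
  assumes R_topspace: "x \<in> topspace X \<Longrightarrow> R x x"
    and R_path: "\<And>p x. pathin X p \<Longrightarrow> x \<in> {0..1} \<Longrightarrow>
      \<exists>d>0. \<forall>t\<in>{0..1}. dist t x < d \<longrightarrow> R (p t) (p x)"
    and R_square: "\<And>h x. continuous_map (top_of_set ({0..1::real} \<times> {0..1::real})) X h \<Longrightarrow>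
      x \<in> {0..1} \<times> {0..1} \<Longrightarrow> \<exists>d>0. \<forall>y\<in>{0..1} \<times> {0..1}. dist y x < d \<longrightarrow> R (h y) (h x)"
begin

lemma tame_path: "pathin X p \<Longrightarrow> tame p 0 1"
  using R_path unfolding tame_def dist_real_def by blast

lemma transport_const: "x \<in> topspace X \<Longrightarrow> transport (\<lambda>t. x) 0 1 (Id C (v x))"
  using transport.star[of 0 1 "\<lambda>t. x" x] R_topspace[of x] e_triangle[of x x x] e_refl[of x]
  by (simp add: via_def)

text \<open>The homotopy has constant bottom and top sides, which transport by identities, so
  trivial holonomy equates the transports along the other two sides. With \<open>p = q\<close> this
  also gives uniqueness.\<close>

lemma transport_path_equiv:
  assumes pq: "(p, q) \<in> path_equiv X" and f: "transport p 0 1 f" and g: "transport q 0 1 g"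
  shows "f = g"
proof -
  obtain h where h: "continuous_map (top_of_set ({0..1} \<times> {0..1::real})) X h"
    "\<forall>t\<in>{0..1}. h (0::real, t) = p t" "\<forall>t\<in>{0..1}. h (1, t) = q t"
    "\<forall>s\<in>{0..1}. h (s, 0) = p 0 \<and> h (s, 1) = p 1"
    using pq unfolding path_equiv_iff by blast
  have top: "p 0 \<in> topspace X" "p 1 \<in> topspace X"
    using path_equiv_props(1)[OF pq] by (simp_all add: path_start_in_topspace path_finish_in_topspace)
  have hol: "trivial_holonomy h 0 1 0 1"
    using trivial_holonomy_square R_square[OF h(1)] by blast
  have 1: "transport (\<lambda>x. h (x, 0)) 0 1 (Id C (v (p 0)))" "transport (\<lambda>x. h (x, 1)) 0 1 (Id C (v (p 1)))"
    by (rule transport_cong[OF transport_const], use h top in auto)+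
  have 2: "transport (\<lambda>y. h (0, y)) 0 1 f" "transport (\<lambda>y. h (1, y)) 0 1 g"
    by (rule transport_cong[OF f], use h in simp) (rule transport_cong[OF g], use h in simp)
  have "Id C (v (p 0)) \<cdot> g = f \<cdot> Id C (v (p 1))"
    using hol 1 2 unfolding trivial_holonomy_def by blast
  moreover have "q 0 = p 0" "q 1 = p 1" using path_equiv_props[OF pq] by auto
  ultimately show ?thesis
    using category_Id_left[OF category transport_Hom[OF g]] category_Id_right[OF category transport_Hom[OF f]]
      transport_Obj[OF f] by simp
qed

definition transport_class :: "(real \<Rightarrow> 'z) set \<Rightarrow> 'm" where
  "transport_class A = (THE f. \<exists>p\<in>A. transport p 0 1 f)"

lemma transport_class_eq:
  assumes p: "pathin X p" and f: "transport p 0 1 f"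
  shows "transport_class (path_class X p) = f"
  unfolding transport_class_def
proof (rule the_equality)
  show "\<exists>q\<in>path_class X p. transport q 0 1 f"
    using f path_equiv_refl[OF p] by (auto simp: path_class_def)
  fix g assume "\<exists>q\<in>path_class X p. transport q 0 1 g"
  then show "g = f" using transport_path_equiv f by (auto simp: path_class_def)
qed

lemma path_transport: "pathin X p \<Longrightarrow> \<exists>f. transport p 0 1 f"
  using transport_exists[OF _ tame_path] by simp

lemma transport_class_in_star:
  assumes "pathin X p" "\<And>t. t \<in> {0..1} \<Longrightarrow> R (p t) (p 0)"
  shows "transport_class (path_class X p) = e (p 0) (p 1)"
proof -
  have "transport p 0 1 (via (p 0) (p 0) (p 1))"
    by (rule transport.star) (use assms in auto)
  then have "transport_class (path_class X p) = via (p 0) (p 0) (p 1)"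
    by (rule transport_class_eq[OF assms(1)])
  also have "\<dots> = e (p 0) (p 1)"
    using e_triangle[of "p 0" "p 0" "p 1"] assms(2)[of 0] assms(2)[of 1] R_sym by (simp add: via_def)
  finally show ?thesis .
qed

lemma transport_concat:
  assumes "transport p 0 1 f" "transport q 0 1 g" "p 1 = q 0"
  shows "transport (path_concat p q) 0 1 (f \<cdot> g)"
proof (rule transport.trans)
  show "transport (path_concat p q) 0 (1/2) f"
    using transport_affine[OF assms(1), of 2 0 "path_concat p q"] by (simp add: path_concat_def)
  \<comment> \<open>At \<open>t = 1/2\<close> the concatenation still takes its value from
    \<open>p\<close>; there the assumption that the ends meet is used.\<close>
  have "path_concat p q t = q (2 * t + - 1)" if "0 \<le> 2 * t + - 1" for t
  proof (cases "t = 1/2")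
    case True
    show ?thesis unfolding True by (simp add: path_concat_def assms(3))
  next
    case False
    then show ?thesis using that by (simp add: path_concat_def)
  qed
  then show "transport (path_concat p q) (1/2) 1 g"
    using transport_affine[OF assms(2), of 2 "-1" "path_concat p q"] by simp
qed

lemma is_functor_transport: "is_functor (fundamental_groupoid X) C v transport_class"
  unfolding is_functor_def
proof (intro conjI ballI)
  fix x assume "x \<in> Obj (fundamental_groupoid X)"
  then show "v x \<in> Obj C" "transport_class (Id (fundamental_groupoid X) x) = Id C (v x)"
    using v R_topspace transport_class_eq[OF pathin_const_path transport_const]
    by (simp_all add: Id_fundamental_groupoid)
next
  fix x y f assume "f \<in> Hom (fundamental_groupoid X) x y"
  then obtain p where p: "pathin X p" "p 0 = x" "p 1 = y" "f = path_class X p"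
    by (auto simp: Hom_fundamental_groupoid)
  then show "transport_class f \<in> Hom C (v x) (v y)"
    using path_transport[OF p(1)] transport_Hom transport_class_eq by blast
next
  fix x y z f g
  assume "f \<in> Hom (fundamental_groupoid X) x y" "g \<in> Hom (fundamental_groupoid X) y z"
  then obtain p q where p: "pathin X p" "p 1 = y" "f = path_class X p"
    and q: "pathin X q" "q 0 = y" "g = path_class X q"
    by (auto simp: Hom_fundamental_groupoid)
  obtain f' g' where "transport p 0 1 f'" "transport q 0 1 g'"
    using path_transport p q by blast
  then show "transport_class (Comp (fundamental_groupoid X) f g) = transport_class f \<cdot> transport_class g"
    using p q transport_concat transport_class_eq by (simp add: Comp_path_class pathin_concat)
qed

end

subsection \<open>Coherent topologies\<close>

lemma closedin_coherent_topology:
  "closedin (coherent_topology \<T>) Z \<longleftrightarrow>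
     Z \<subseteq> (\<Union>T\<in>\<T>. topspace T) \<and> (\<forall>T\<in>\<T>. closedin T (Z \<inter> topspace T))"
proof -
  let ?Y = "\<Union>T\<in>\<T>. topspace T"
  have "openin T ((?Y - Z) \<inter> topspace T) \<longleftrightarrow> closedin T (Z \<inter> topspace T)" if "T \<in> \<T>" for T
  proof -
    have "(?Y - Z) \<inter> topspace T = topspace T - Z \<inter> topspace T" using that by blast
    then show ?thesis by (simp add: closedin_def)
  qed
  then show ?thesis
    unfolding closedin_def[of "coherent_topology \<T>"]
    by (auto simp: topspace_coherent_topology openin_coherent_topology)
qed

lemma continuous_map_into_coherent_topology:
  "T \<in> \<T> \<Longrightarrow> continuous_map T (coherent_topology \<T>) (\<lambda>x. x)"
  unfolding continuous_map_def topspace_coherent_topology openin_coherent_topology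
  by (auto simp: Collect_conj_eq Int_commute)

lemma continuous_map_from_coherent_topology:
  assumes "\<And>T. T \<in> \<T> \<Longrightarrow> continuous_map T Y f"
  shows "continuous_map (coherent_topology \<T>) Y f"
  unfolding continuous_map_def
proof (intro conjI allI impI)
  show "f \<in> topspace (coherent_topology \<T>) \<rightarrow> topspace Y"
    using assms by (auto simp: topspace_coherent_topology continuous_map_def)
  fix U assume U: "openin Y U"
  show "openin (coherent_topology \<T>) {x \<in> topspace (coherent_topology \<T>). f x \<in> U}"
    unfolding openin_coherent_topology topspace_coherent_topology
  proof (intro conjI ballI)
    fix T assume T: "T \<in> \<T>"
    have "{x \<in> \<Union>T\<in>\<T>. topspace T. f x \<in> U} \<inter> topspace T = {x \<in> topspace T. f x \<in> U}"
      using T by blast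
    then show "openin T ({x \<in> \<Union>T\<in>\<T>. topspace T. f x \<in> U} \<inter> topspace T)"
      using openin_continuous_map_preimage[OF assms[OF T] U] by simp
  qed blast
qed

text \<open>Preimages of closed sets in a metric source are tested by sequences. All terms of such a
  sequence are mapped into the closed set, so convergence of some selection of terms already puts
  the limit there.\<close>

lemma continuous_map_sequentialI:
  fixes S :: "'c::metric_space set"
  assumes g: "g \<in> S \<rightarrow> topspace Y"
    and lim: "\<And>s x. \<lbrakk>\<And>n. s n \<in> S; x \<in> S; s \<longlonglongrightarrow> x\<rbrakk> \<Longrightarrow>
      \<exists>r::nat \<Rightarrow> nat. limitin Y (\<lambda>n. g (s (r n))) (g x) sequentially"
  shows "continuous_map (top_of_set S) Y g"
  unfolding continuous_map_closedin
proof (intro conjI allI impI)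
  fix Z assume Z: "closedin Y Z"
  let ?T = "{x \<in> S. g x \<in> Z}"
  have "S \<inter> closure ?T \<subseteq> ?T"
  proof
    fix x assume x: "x \<in> S \<inter> closure ?T"
    then have "x \<in> closure ?T" by blast
    then obtain s where s: "\<And>n. s n \<in> ?T" "s \<longlonglongrightarrow> x"
      unfolding closure_sequential by blast
    then obtain r where "limitin Y (\<lambda>n. g (s (r n))) (g x) sequentially"
      using lim[of s x] x by blast
    then have "g x \<in> Z"
      by (rule limitin_closedin[OF _ Z]) (use s in auto)
    then show "x \<in> ?T" using x by blast
  qed
  then have "?T = S \<inter> closure ?T" using closure_subset[of ?T] by blast
  then have "closedin (top_of_set S) ?T"
    by (rule ssubst) (rule closedin_closed_Int, rule closed_closure)
  then show "closedin (top_of_set S) {x \<in> topspace (top_of_set S). g x \<in> Z}" by simp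
qed (use g in auto)

subsection \<open>Simplices\<close>

abbreviation supp :: "('b \<Rightarrow> real) \<Rightarrow> 'b set" where "supp p \<equiv> {b. p b \<noteq> 0}"

lemma simplex_points_mono: "S \<subseteq> T \<Longrightarrow> simplex_points S \<subseteq> simplex_points T"
  by (auto simp: simplex_points_def)

lemma simplex_points_iff: "p \<in> simplex_points S \<longleftrightarrow> p \<in> simplex_points UNIV \<and> supp p \<subseteq> S"
  by (auto simp: simplex_points_def)

lemma simplex_points_supp: "p \<in> simplex_points S \<Longrightarrow> p \<in> simplex_points (supp p)"
  by (auto simp: simplex_points_def)

lemma supp_nonempty:
  assumes "p \<in> simplex_points S"
  shows "supp p \<noteq> {}"
proof
  assume "supp p = {}"
  then have "sum p (supp p) = 0" by (simp only: sum.empty)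
  then show False using assms by (simp add: simplex_points_def)
qed

lemma finite_supp: "p \<in> simplex_points S \<Longrightarrow> finite (supp p)"
  by (simp add: simplex_points_def)

lemma simplex_points_sum:
  assumes "finite F" "supp p \<subseteq> F"
  shows "p \<in> simplex_points S \<longleftrightarrow> supp p \<subseteq> S \<and> (\<forall>b. 0 \<le> p b) \<and> sum p F = 1"
proof -
  have "sum p (supp p) = sum p F"
    using assms by (intro sum.mono_neutral_left) auto
  then show ?thesis
    using assms finite_subset by (auto simp: simplex_points_def)
qed

lemma simplex_points_convex:
  assumes p: "p \<in> simplex_points S" and q: "q \<in> simplex_points T" and t: "0 \<le> t" "t \<le> 1"
  shows "(\<lambda>b. (1 - t) * p b + t * q b) \<in> simplex_points (supp p \<union> supp q)"
proof -
  let ?F = "supp p \<union> supp q"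
  have F: "finite ?F" using p q by (simp add: finite_supp)
  have "sum p ?F = 1" "\<forall>b. 0 \<le> p b" "sum q ?F = 1" "\<forall>b. 0 \<le> q b"
    using simplex_points_sum[OF F, of p S] simplex_points_sum[OF F, of q T] p q by auto
  then have "(\<Sum>b\<in>?F. (1 - t) * p b + t * q b) = 1" "\<forall>b. 0 \<le> (1 - t) * p b + t * q b"
    using t by (simp_all add: sum.distrib flip: sum_distrib_left)
  moreover have "supp (\<lambda>b. (1 - t) * p b + t * q b) \<subseteq> ?F" by auto
  ultimately show ?thesis
    using simplex_points_sum[OF F, of "\<lambda>b. (1 - t) * p b + t * q b" ?F] by blast
qed

lemma continuous_map_simplex_space_product:
  "continuous_map (simplex_space S) (powertop_real UNIV) (\<lambda>p. p)"
  unfolding simplex_space_def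
  by (rule continuous_map_from_coherent_topology) (auto intro: continuous_map_from_subtopology)

lemma Hausdorff_simplex_space: "Hausdorff_space (simplex_space S)"
proof (rule Hausdorff_space_injective_preimage[OF _ continuous_map_simplex_space_product])
  show "Hausdorff_space (powertop_real UNIV)" by (simp add: Hausdorff_space_product_topology)
qed auto

text \<open>In the weak topology coordinatewise convergence alone is too weak: mass tending to 0 may
  move to ever new vertices. A common finite face \<open>F\<close> excludes this.\<close>

lemma limitin_simplex_space:
  assumes F: "finite F" "F \<subseteq> S"
    and p: "\<And>n. p n \<in> simplex_points F" and q: "q \<in> simplex_points F"
    and lim: "\<And>b. (\<lambda>n. p n b) \<longlonglongrightarrow> q b"
  shows "limitin (simplex_space S) p q sequentially"
proof -
  have "limitin (powertop_real UNIV) p q sequentially"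
    using lim by (simp add: limitin_componentwise)
  then have "limitin (subtopology (powertop_real UNIV) (simplex_points F)) p q sequentially"
    using p q by (simp add: limitin_subtopology)
  moreover have "continuous_map (subtopology (powertop_real UNIV) (simplex_points F)) (simplex_space S) (\<lambda>x. x)"
    unfolding simplex_space_def by (rule continuous_map_into_coherent_topology) (use F in blast)
  ultimately show ?thesis
    using continuous_map_limit by (fastforce simp: o_def)
qed

text \<open>Open because each finite face only sees finitely many of the constraints.\<close>

lemma openin_simplex_space_below:
  assumes c: "\<And>b. b \<in> B \<Longrightarrow> 0 < c b"
  shows "openin (simplex_space S) {p \<in> simplex_points S. \<forall>b\<in>B. p b < c b}"
proof -
  have "openin (subtopology (powertop_real UNIV) (simplex_points F))
          ({p \<in> simplex_points S. \<forall>b\<in>B. p b < c b} \<inter> simplex_points F)"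
    if F: "F \<subseteq> S" "finite F" for F
  proof -
    have "{p \<in> simplex_points S. \<forall>b\<in>B. p b < c b} \<inter> simplex_points F =
        simplex_points F \<inter> {p. \<forall>b\<in>B \<inter> F. p b < c b}"
    proof -
      \<comment> \<open>Coordinates outside \<open>F\<close> vanish, so positivity of
        \<open>c\<close> settles their constraints and only finitely many remain.\<close>
      have "p b < c b" if "p \<in> simplex_points F" "b \<in> B" "b \<notin> F" for p b
      proof -
        have "p b = 0" using that by (auto simp: simplex_points_def)
        then show ?thesis using c[OF that(2)] by simp
      qed
      then show ?thesis using simplex_points_mono[OF F(1)] by blast
    qed
    moreover have "openin (powertop_real UNIV) {p. \<forall>b\<in>B \<inter> F. p b < c b}"
    proof -
      have "openin (powertop_real UNIV) {p. p b < c b}" for b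
        using openin_continuous_map_preimage[OF continuous_map_product_projection[of b UNIV "\<lambda>_. euclideanreal"],
            of "{..<c b}"] by simp
      then have "openin (powertop_real UNIV) ((\<Inter>b\<in>B \<inter> F. {p. p b < c b}) \<inter> topspace (powertop_real UNIV))"
        using F by (intro openin_INT) auto
      moreover have "(\<Inter>b\<in>B \<inter> F. {p. p b < c b}) \<inter> topspace (powertop_real UNIV) = {p. \<forall>b\<in>B \<inter> F. p b < c b}"
        by auto
      ultimately show ?thesis by simp
    qed
    ultimately show ?thesis by (simp add: openin_subtopology_Int2)
  qed
  moreover have "{p \<in> simplex_points S. \<forall>b\<in>B. p b < c b} \<subseteq> topspace (simplex_space S)"
    by (auto simp: topspace_simplex_space)
  ultimately show ?thesis
    by (auto simp: simplex_space_def openin_coherent_topology topspace_coherent_topology)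
qed

subsection \<open>The hom complex\<close>

locale hom_graphs =
  fixes G :: "'a ugraph" and H :: "'b ugraph"
  assumes graph_G: "is_graph G" and graph_H: "is_graph H"
begin

abbreviation "\<Delta> \<equiv> hom_complex G H"

abbreviation cell :: "('a \<Rightarrow> 'b set) \<Rightarrow> ('a \<Rightarrow> 'b \<Rightarrow> real) topology" where
  "cell \<eta> \<equiv> product_topology (\<lambda>x. simplex_space (\<eta> x)) (verts G)"

lemma topspace_cell: "z \<in> topspace (cell \<eta>) \<longleftrightarrow>
    z \<in> extensional (verts G) \<and> (\<forall>x\<in>verts G. z x \<in> simplex_points (\<eta> x))"
  by (auto simp: topspace_simplex_space PiE_iff)

text \<open>The adjacency relation of the exponential graph applied to supports: any choice of
  vertices in the supports of \<open>z\<close> is adjacent to any choice in those of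
  \<open>w\<close>. Membership in \<open>\<Delta>\<close> provides the same condition for each point
  with itself.\<close>

definition compat :: "('a \<Rightarrow> 'b \<Rightarrow> real) \<Rightarrow> ('a \<Rightarrow> 'b \<Rightarrow> real) \<Rightarrow> bool" where
  "compat z w \<longleftrightarrow> z \<in> topspace \<Delta> \<and> w \<in> topspace \<Delta> \<and>
     (\<forall>(x, y)\<in>edges G. supp (z x) \<times> supp (w y) \<subseteq> edges H)"

lemma edges_G: "(x, y) \<in> edges G \<Longrightarrow> x \<in> verts G \<and> y \<in> verts G \<and> (y, x) \<in> edges G"
  and edges_H: "(x', y') \<in> edges H \<Longrightarrow> x' \<in> verts H \<and> y' \<in> verts H \<and> (y', x') \<in> edges H"
  using graph_G graph_H unfolding is_graph_def by (blast dest: symD)+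

lemma topspace_hom_complex: "z \<in> topspace \<Delta> \<longleftrightarrow>
    z \<in> extensional (verts G) \<and> (\<forall>x\<in>verts G. z x \<in> simplex_points (verts H)) \<and>
    (\<forall>(x, y)\<in>edges G. supp (z x) \<times> supp (z y) \<subseteq> edges H)" (is "_ \<longleftrightarrow> ?R")
proof
  assume "z \<in> topspace \<Delta>"
  then obtain \<eta> where \<eta>: "\<eta> \<in> multihoms G H" "z \<in> topspace (cell \<eta>)"
    unfolding hom_complex_def topspace_coherent_topology by blast
  have z: "z \<in> extensional (verts G)" "\<And>x. x \<in> verts G \<Longrightarrow> z x \<in> simplex_points (\<eta> x)"
    using \<eta>(2) unfolding topspace_cell by blast+
  have supp: "supp (z x) \<subseteq> \<eta> x" if "x \<in> verts G" for x
    using z(2)[OF that] by (simp add: simplex_points_def)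
  have edge: "supp (z x) \<times> supp (z y) \<subseteq> edges H" if "(x, y) \<in> edges G" for x y
  proof -
    have "\<eta> x \<times> \<eta> y \<subseteq> edges H" using \<eta> that by (auto simp: multihoms_def)
    then show ?thesis using supp[of x] supp[of y] edges_G[OF that] by blast
  qed
  have "z x \<in> simplex_points (verts H)" if "x \<in> verts G" for x
  proof -
    have "\<eta> x \<subseteq> verts H" using \<eta> that by (auto simp: multihoms_def PiE_iff)
    then show ?thesis using simplex_points_mono[of "\<eta> x" "verts H"] z(2)[OF that] by blast
  qed
  with z(1) show ?R using edge by (simp add: case_prod_unfold)
next
  assume R: ?R
  \<comment> \<open>The supports of \<open>z\<close> form the smallest cell containing it.\<close>
  define \<eta> where "\<eta> = (\<lambda>x\<in>verts G. supp (z x))"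
  have "\<eta> \<in> multihoms G H"
  proof -
    have "\<eta> x \<in> Pow (verts H) - {{}}" if "x \<in> verts G" for x
    proof -
      have "z x \<in> simplex_points (verts H)" using R that by blast
      then have "supp (z x) \<noteq> {}" "supp (z x) \<subseteq> verts H"
        by (rule supp_nonempty) (use \<open>z x \<in> simplex_points (verts H)\<close> in \<open>simp add: simplex_points_def\<close>)
      then show ?thesis using that by (simp add: \<eta>_def)
    qed
    moreover have "\<eta> x \<times> \<eta> y \<subseteq> edges H" if "(x, y) \<in> edges G" for x y
      using R that edges_G[OF that] by (auto simp: \<eta>_def)
    moreover have "\<eta> \<in> extensional (verts G)" by (simp add: \<eta>_def)
    ultimately show ?thesis unfolding multihoms_def PiE_iff by blast
  qed
  moreover have "z \<in> topspace (cell \<eta>)"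
    using R simplex_points_supp unfolding topspace_cell \<eta>_def by auto
  ultimately show "z \<in> topspace \<Delta>"
    unfolding hom_complex_def topspace_coherent_topology by blast
qed

lemma compat_refl: "z \<in> topspace \<Delta> \<Longrightarrow> compat z z"
  by (simp add: compat_def topspace_hom_complex)

lemma compat_sym: "compat z w \<Longrightarrow> compat w z"
  unfolding compat_def using edges_G edges_H by blast

section \<open>Cells spanned by compatible points\<close>

definition spread :: "('a \<Rightarrow> 'b \<Rightarrow> real) set \<Rightarrow> 'a \<Rightarrow> 'b set" where
  "spread W = (\<lambda>x\<in>verts G. \<Union>w\<in>W. supp (w x))"

text \<open>One value over \<open>x\<close> and one over \<open>y\<close> come from at most two
  points of \<open>W\<close>, so pairwise compatibility is all the multihom condition can see, even
  for infinite \<open>W\<close>.\<close>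

lemma spread_multihoms:
  assumes "W \<noteq> {}" and W: "\<And>z w. z \<in> W \<Longrightarrow> w \<in> W \<Longrightarrow> compat z w"
  shows "spread W \<in> multihoms G H"
proof -
  have top: "\<And>w x. w \<in> W \<Longrightarrow> x \<in> verts G \<Longrightarrow> w x \<in> simplex_points (verts H)"
    using W unfolding compat_def topspace_hom_complex by blast
  have "spread W x \<in> Pow (verts H) - {{}}" if x: "x \<in> verts G" for x
  proof -
    obtain w where "w \<in> W" using \<open>W \<noteq> {}\<close> by blast
    then have "supp (w x) \<noteq> {}" "supp (w x) \<subseteq> spread W x"
      using top x supp_nonempty by (blast, auto simp: spread_def)
    moreover have "spread W x \<subseteq> verts H"
      using top x by (auto simp: spread_def simplex_points_def)
    ultimately show ?thesis by blast
  qed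
  moreover have "spread W x \<times> spread W y \<subseteq> edges H" if "(x, y) \<in> edges G" for x y
  proof
    fix p assume "p \<in> spread W x \<times> spread W y"
    then obtain z w where zw: "z \<in> W" "w \<in> W" "p \<in> supp (z x) \<times> supp (w y)"
      using edges_G[OF \<open>(x, y) \<in> edges G\<close>] by (auto simp: spread_def)
    have "supp (z x) \<times> supp (w y) \<subseteq> edges H"
      using W[OF zw(1,2)] that by (auto simp: compat_def)
    then show "p \<in> edges H" using zw(3) by blast
  qed
  moreover have "spread W \<in> extensional (verts G)" by (simp add: spread_def)
  ultimately show ?thesis
    unfolding multihoms_def PiE_iff by blast
qed

lemma spread_cell: "w \<in> W \<Longrightarrow> w \<in> topspace \<Delta> \<Longrightarrow> w \<in> topspace (cell (spread W))"
  unfolding topspace_cell topspace_hom_complex spread_def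
  by (subst simplex_points_iff) (auto simp: simplex_points_def)

lemma cell_subset: "\<eta> \<in> multihoms G H \<Longrightarrow> topspace (cell \<eta>) \<subseteq> topspace \<Delta>"
  unfolding hom_complex_def topspace_coherent_topology by blast

lemma cell_compat:
  assumes \<eta>: "\<eta> \<in> multihoms G H" and z: "z \<in> topspace (cell \<eta>)" and w: "w \<in> topspace (cell \<eta>)"
  shows "compat z w"
proof -
  have "supp (z x) \<subseteq> \<eta> x" "supp (w x) \<subseteq> \<eta> x" if "x \<in> verts G" for x
    using z w that unfolding topspace_cell simplex_points_def by blast+
  moreover have "\<eta> x \<times> \<eta> y \<subseteq> edges H" if "(x, y) \<in> edges G" for x y
    using \<eta> that by (auto simp: multihoms_def)
  ultimately have "supp (z x) \<times> supp (w y) \<subseteq> edges H" if "(x, y) \<in> edges G" for x y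
    using edges_G[OF that] that by blast
  then show ?thesis
    using cell_subset[OF \<eta>] z w unfolding compat_def by blast
qed

lemma Hausdorff_cell: "Hausdorff_space (cell \<eta>)"
  by (simp add: Hausdorff_space_product_topology Hausdorff_simplex_space)

lemma continuous_map_cell: "\<eta> \<in> multihoms G H \<Longrightarrow> continuous_map (cell \<eta>) \<Delta> (\<lambda>z. z)"
  unfolding hom_complex_def by (rule continuous_map_into_coherent_topology) blast

lemma continuous_map_coordinate:
  assumes "x \<in> verts G"
  shows "continuous_map \<Delta> euclideanreal (\<lambda>z. z x b)"
  unfolding hom_complex_def
proof (rule continuous_map_from_coherent_topology, clarify)
  fix \<eta>
  have "continuous_map (simplex_space (\<eta> x)) euclideanreal (\<lambda>p. p b)"
    using continuous_map_compose[OF continuous_map_simplex_space_product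
        continuous_map_product_projection[of b UNIV "\<lambda>_. euclideanreal"]]
    by (simp add: o_def)
  from continuous_map_compose[OF continuous_map_product_projection[OF assms, of "\<lambda>x. simplex_space (\<eta> x)"] this]
  show "continuous_map (cell \<eta>) euclideanreal (\<lambda>z. z x b)"
    by (simp add: o_def)
qed

text \<open>A cell contains at most one point of \<open>A\<close>, and points are closed in the
  Hausdorff cells; the coherent topology tests closedness cell by cell. The hypothesis passes to
  subsets, so \<open>A\<close> is discrete as well.\<close>

lemma closedin_hom_complex_scattered:
  assumes A: "A \<subseteq> topspace \<Delta>" and scattered: "\<And>z w. z \<in> A \<Longrightarrow> w \<in> A \<Longrightarrow> compat z w \<Longrightarrow> z = w"
  shows "closedin \<Delta> A"
  unfolding hom_complex_def closedin_coherent_topology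
proof (intro conjI ballI)
  show "A \<subseteq> (\<Union>T\<in>cell ` multihoms G H. topspace T)"
    using A unfolding hom_complex_def topspace_coherent_topology .
  fix T assume "T \<in> cell ` multihoms G H"
  then obtain \<eta> where \<eta>: "\<eta> \<in> multihoms G H" "T = cell \<eta>" by blast
  have "\<forall>z\<in>A \<inter> topspace T. \<forall>w\<in>A \<inter> topspace T. z = w"
    using scattered cell_compat[OF \<eta>(1)] \<eta>(2) by blast
  then have "\<exists>z. A \<inter> topspace T \<subseteq> {z}" by blast
  then have "finite (A \<inter> topspace T)" by (meson finite.emptyI finite_insert finite_subset)
  then show "closedin T (A \<inter> topspace T)"
    using Hausdorff_cell[of \<eta>] \<eta>(2) by (intro closedin_Hausdorff_finite) auto
qed

text \<open>
  A convergent sequence need not lie in finitely many cells, but by Ramsey's theorem it has a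
  subsequence that lies in a single one: an infinite set of pairwise incompatible points is closed
  and discrete.
\<close>

lemma convergent_compat_subsequence:
  assumes lim: "limitin \<Delta> z l sequentially" and z: "\<And>n. z n \<in> topspace \<Delta>"
  obtains r :: "nat \<Rightarrow> nat" where "strict_mono r"
    "\<And>m n. compat (z (r m)) (z (r n))" "\<And>n. compat (z (r n)) l"
proof -
  have l: "l \<in> topspace \<Delta>" using lim by (rule limitin_topspace)
  define col :: "nat set \<Rightarrow> nat"
    where "col M = (if \<forall>m\<in>M. \<forall>n\<in>M. compat (z m) (z n) then 0 else 1)" for M
  obtain Y t where Y: "infinite Y" "t < (2::nat)" "\<forall>m\<in>Y. \<forall>n\<in>Y. m \<noteq> n \<longrightarrow> col {m, n} = t"
  proof -
    have "\<forall>m\<in>UNIV. \<forall>n\<in>UNIV. m \<noteq> n \<longrightarrow> col {m, n} < 2" by (simp add: col_def)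
    then show thesis using Ramsey2[OF infinite_UNIV_nat, of col 2] that by blast
  qed
  have t: "t = 0"
  proof (rule ccontr)
    assume "t \<noteq> 0"
    have indep: "\<not> compat (z m) (z n)" if "m \<in> Y" "n \<in> Y" "m \<noteq> n" for m n
    proof
      assume "compat (z m) (z n)"
      then have "col {m, n} = 0" by (simp add: col_def compat_refl compat_sym z)
      then show False using Y that \<open>t \<noteq> 0\<close> by simp
    qed
    \<comment> \<open>The limit is removed so that the complement of the closed set \<open>A\<close>
      is a neighbourhood of it.\<close>
    define A where "A = z ` Y - {l}"
    have "closedin \<Delta> A"
      by (rule closedin_hom_complex_scattered) (use indep z in \<open>auto simp: A_def\<close>)
    then have "\<forall>\<^sub>F n in sequentially. z n \<in> topspace \<Delta> - A"
      using lim l limitinD[OF lim, of "topspace \<Delta> - A"] by (auto simp: A_def)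
    then obtain N where N: "\<And>n. n \<ge> N \<Longrightarrow> z n \<notin> A" unfolding eventually_sequentially by blast
    \<comment> \<open>Late terms with index in \<open>Y\<close> avoid \<open>A\<close> and hence
      equal \<open>l\<close>; two of them coincide and are therefore compatible, against the choice
      of \<open>Y\<close>.\<close>
    have *: "z n = l" if "n \<in> Y" "n \<ge> N" for n using N that by (auto simp: A_def)
    obtain m where m: "m \<in> Y" "m > N" using Y(1) by (meson infinite_nat_iff_unbounded)
    obtain n where n: "n \<in> Y" "n > m" using Y(1) by (meson infinite_nat_iff_unbounded)
    show False using indep[of m n] * m n compat_refl[OF l] by simp
  qed
  define r where "r = enumerate Y"
  have r: "strict_mono r" "r n \<in> Y" for n
    using Y(1) by (auto simp: r_def strict_mono_enumerate enumerate_in_set)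
  have clique: "compat (z (r m)) (z (r n))" for m n
  proof (cases "r m = r n")
    case False
    then have "col {r m, r n} = 0" using Y r t by blast
    then show ?thesis by (auto simp: col_def split: if_splits)
  qed (simp add: compat_refl z)
  define \<eta> where "\<eta> = spread (range (z \<circ> r))"
  have \<eta>: "\<eta> \<in> multihoms G H"
    unfolding \<eta>_def by (rule spread_multihoms) (use clique in auto)
  \<comment> \<open>The spread of the subsequence already contains its limit: a coordinate that is
    nonzero in the limit is nonzero in some term.\<close>
  have "supp (l x) \<subseteq> \<eta> x" if x: "x \<in> verts G" for x
  proof
    fix b assume b: "b \<in> supp (l x)"
    have "limitin \<Delta> (z \<circ> r) l sequentially" using r(1) lim by (rule limitin_subsequence)
    from continuous_map_limit[OF continuous_map_coordinate[OF x, of b] this]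
    have "(\<lambda>n. z (r n) x b) \<longlonglongrightarrow> l x b" by (simp add: o_def)
    then have "\<not> (\<forall>n. z (r n) x b = 0)"
      using b LIMSEQ_unique[OF _ tendsto_const[of 0]] by fastforce
    then show "b \<in> \<eta> x" using x by (auto simp: \<eta>_def spread_def)
  qed
  then have "l \<in> topspace (cell \<eta>)"
    using l unfolding topspace_cell topspace_hom_complex by (subst simplex_points_iff) (auto simp: simplex_points_def)
  moreover have "z (r n) \<in> topspace (cell \<eta>)" for n
    unfolding \<eta>_def by (rule spread_cell) (use z in auto)
  ultimately have "compat (z (r n)) l" for n using cell_compat[OF \<eta>] by blast
  then show ?thesis using that r clique by blast
qed

text \<open>If infinitely many vertices occurred outside the support of the limit, a neighbourhood
  of the limit in the weak topology could exclude a term for each of them. The finiteness is for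
  each \<open>x\<close> separately, which is enough for the product topology of cells.\<close>

lemma convergent_finite_support:
  assumes lim: "limitin \<Delta> z l sequentially" and z: "\<And>n. z n \<in> topspace \<Delta>" and x: "x \<in> verts G"
  shows "finite (\<Union>n. supp (z n x))"
proof -
  have l: "l \<in> topspace \<Delta>" using lim by (rule limitin_topspace)
  have pts: "z n x \<in> simplex_points (verts H)" "l x \<in> simplex_points (verts H)" for n
    using z l x unfolding topspace_hom_complex by blast+
  define B where "B = (\<Union>n. supp (z n x)) - supp (l x)"
  define N where "N b = (SOME n. z n x b \<noteq> 0)" for b
  have N: "z (N b) x b \<noteq> 0" if "b \<in> B" for b
    unfolding N_def by (rule someI_ex) (use that in \<open>auto simp: B_def\<close>)
  then have pos: "0 < z (N b) x b" if "b \<in> B" for b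
    using that pts(1)[of "N b"] by (metis (no_types, lifting) mem_Collect_eq order_le_less simplex_points_def)
  \<comment> \<open>The bound for \<open>b\<close> is the weight that the term
    \<open>z (N b)\<close> gives to \<open>b\<close>, so this term violates its own constraint,
    while \<open>l\<close> satisfies all of them with weight 0.\<close>
  define U where "U = {w \<in> topspace \<Delta>. \<forall>b\<in>B. w x b < z (N b) x b}"
  have "openin \<Delta> U"
    unfolding hom_complex_def openin_coherent_topology
  proof (intro conjI ballI)
    show "U \<subseteq> (\<Union>T\<in>cell ` multihoms G H. topspace T)"
      unfolding U_def hom_complex_def topspace_coherent_topology by blast
    fix T assume "T \<in> cell ` multihoms G H"
    then obtain \<eta> where \<eta>: "\<eta> \<in> multihoms G H" "T = cell \<eta>" by blast
    have "openin (cell \<eta>) {w \<in> topspace (cell \<eta>). w x \<in> {p \<in> simplex_points (\<eta> x). \<forall>b\<in>B. p b < z (N b) x b}}"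
      by (rule openin_continuous_map_preimage[OF continuous_map_product_projection[OF x] openin_simplex_space_below[OF pos]])
    moreover have "U \<inter> topspace T = {w \<in> topspace (cell \<eta>). w x \<in> {p \<in> simplex_points (\<eta> x). \<forall>b\<in>B. p b < z (N b) x b}}"
      using cell_subset[OF \<eta>(1)] x topspace_cell[of _ \<eta>] unfolding U_def \<eta>(2) by blast
    ultimately show "openin T (U \<inter> topspace T)" using \<eta>(2) by simp
  qed
  moreover have "l \<in> U" using l pos by (auto simp: U_def B_def)
  ultimately obtain M where M: "\<And>n. n \<ge> M \<Longrightarrow> z n \<in> U"
    using limitinD[OF lim] unfolding eventually_sequentially by blast
  have "B \<subseteq> (\<Union>n<M. supp (z n x))"
  proof
    fix b assume b: "b \<in> B"
    then have "z (N b) \<notin> U" by (auto simp: U_def)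
    then have "N b < M" using M not_less by blast
    then show "b \<in> (\<Union>n<M. supp (z n x))" using N[OF b] by blast
  qed
  moreover have "finite (\<Union>n<M. supp (z n x))" using pts finite_supp by blast
  ultimately have "finite (supp (l x) \<union> B)" using pts finite_supp finite_subset by blast
  then show ?thesis by (rule rev_finite_subset) (auto simp: B_def)
qed

lemma limitin_continuous_image:
  fixes S :: "'c::metric_space set"
  assumes f: "continuous_map (top_of_set S) \<Delta> f" and s: "\<And>n. s n \<in> S" "x \<in> S" "s \<longlonglongrightarrow> x"
  shows "limitin \<Delta> (\<lambda>n. f (s n)) (f x) sequentially" "f (s n) \<in> topspace \<Delta>"
proof -
  have "limitin (top_of_set S) s x sequentially"
    using s by (simp add: limitin_subtopology)
  then show "limitin \<Delta> (\<lambda>n. f (s n)) (f x) sequentially"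
    using continuous_map_limit[OF f] by (simp add: o_def)
  show "f (s n) \<in> topspace \<Delta>"
    using f s(1) by (auto simp: continuous_map_def)
qed

text \<open>A failure yields a sequence tending to \<open>x\<close> whose images are all
  incompatible with the image of \<open>x\<close>; the extracted subsequence contradicts
  this.\<close>

lemma locally_compat:
  fixes S :: "'c::metric_space set"
  assumes f: "continuous_map (top_of_set S) \<Delta> f" and x: "x \<in> S"
  shows "\<exists>d>0. \<forall>y\<in>S. dist y x < d \<longrightarrow> compat (f y) (f x)"
proof (rule ccontr)
  assume "\<not> ?thesis"
  then have "\<forall>n. \<exists>y\<in>S. dist y x < inverse (real (Suc n)) \<and> \<not> compat (f y) (f x)"
    by (metis inverse_positive_iff_positive of_nat_0_less_iff zero_less_Suc)
  then obtain s where s: "\<And>n. s n \<in> S" "\<And>n. dist (s n) x < inverse (real (Suc n))"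
    "\<And>n. \<not> compat (f (s n)) (f x)"
    by metis
  have "s \<longlonglongrightarrow> x"
  proof (rule tendsto_dist_iff[THEN iffD2], rule tendsto_sandwich[OF _ _ tendsto_const LIMSEQ_inverse_real_of_nat])
  qed (use s(2) in \<open>auto intro!: always_eventually less_imp_le\<close>)
  from limitin_continuous_image[OF f s(1) x this] obtain r where "compat (f (s (r 0))) (f x)"
    using convergent_compat_subsequence by metis
  then show False using s(3) by blast
qed

section \<open>Convex combinations inside cells and cones\<close>

definition mix :: "real \<Rightarrow> ('a \<Rightarrow> 'b \<Rightarrow> real) \<Rightarrow> ('a \<Rightarrow> 'b \<Rightarrow> real) \<Rightarrow> 'a \<Rightarrow> 'b \<Rightarrow> real" where
  "mix t z w = (\<lambda>x\<in>verts G. \<lambda>b. (1 - t) * z x b + t * w x b)"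

lemma mix_cell:
  assumes "z \<in> topspace (cell \<eta>)" "w \<in> topspace (cell \<eta>)" "0 \<le> t" "t \<le> 1"
  shows "mix t z w \<in> topspace (cell \<eta>)"
  unfolding topspace_cell
proof (intro conjI ballI)
  fix x assume x: "x \<in> verts G"
  then have p: "z x \<in> simplex_points (\<eta> x)" "w x \<in> simplex_points (\<eta> x)"
    using assms unfolding topspace_cell by blast+
  then have "simplex_points (supp (z x) \<union> supp (w x)) \<subseteq> simplex_points (\<eta> x)"
    by (intro simplex_points_mono) (auto simp: simplex_points_def)
  then show "mix t z w x \<in> simplex_points (\<eta> x)"
    using simplex_points_convex[OF p assms(3,4)] x by (auto simp: mix_def)
qed (simp add: mix_def)

text \<open>The three points are pairwise compatible, hence lie in one cell, and cells are
  convex.\<close>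

lemma mix_compat:
  assumes "compat z w" "compat z a" "compat w a" "0 \<le> t" "t \<le> 1"
  shows "compat (mix t z w) a"
proof -
  let ?\<eta> = "spread {z, w, a}"
  have top: "z \<in> topspace \<Delta>" "w \<in> topspace \<Delta>" "a \<in> topspace \<Delta>" using assms by (auto simp: compat_def)
  have "?\<eta> \<in> multihoms G H"
    by (rule spread_multihoms) (use assms top compat_refl compat_sym in auto)
  moreover have "z \<in> topspace (cell ?\<eta>)" "w \<in> topspace (cell ?\<eta>)" "a \<in> topspace (cell ?\<eta>)"
    using spread_cell[of _ "{z, w, a}"] top by auto
  ultimately show ?thesis using mix_cell cell_compat assms by blast
qed

lemma mix_0: "z \<in> topspace \<Delta> \<Longrightarrow> mix 0 z w = z"
  and mix_1: "w \<in> topspace \<Delta> \<Longrightarrow> mix 1 z w = w"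
  by (auto simp: mix_def topspace_hom_complex extensional_def)

text \<open>
  Only cones over a constant apex are continuous in general: when both ends of the segment move,
  points with different parameters need not be compatible.
\<close>

lemma continuous_map_cone:
  fixes S :: "'c::metric_space set"
  assumes f: "continuous_map (top_of_set S) \<Delta> f" and a: "\<And>s. s \<in> S \<Longrightarrow> compat (f s) a"
    and t: "continuous_on S t" "\<And>s. s \<in> S \<Longrightarrow> 0 \<le> t s \<and> t s \<le> 1"
  shows "continuous_map (top_of_set S) \<Delta> (\<lambda>s. mix (t s) (f s) a)"
proof (rule continuous_map_sequentialI)
  show "(\<lambda>s. mix (t s) (f s) a) \<in> S \<rightarrow> topspace \<Delta>"
  proof
    fix s assume "s \<in> S"
    moreover from this have "compat (f s) (f s)" "compat a a"
      using a compat_refl unfolding compat_def by blast+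
    ultimately have "compat (mix (t s) (f s) a) a" using mix_compat a t by blast
    then show "mix (t s) (f s) a \<in> topspace \<Delta>" by (simp add: compat_def)
  qed
  fix s x assume s: "\<And>n. s n \<in> S" "x \<in> S" "s \<longlonglongrightarrow> x"
  note lim = limitin_continuous_image[OF f s]
  obtain r :: "nat \<Rightarrow> nat" where r: "strict_mono r" "\<And>m n. compat (f (s (r m))) (f (s (r n)))" "\<And>n. compat (f (s (r n))) (f x)"
    using convergent_compat_subsequence[OF lim] by blast
  \<comment> \<open>Apex, limit and the whole subsequence are pairwise compatible, so the
    convergence can be checked inside one cell.\<close>
  define W where "W = insert a (insert (f x) (range (\<lambda>n. f (s (r n)))))"
  have top: "W \<subseteq> topspace \<Delta>"
    using a[OF s(2)] lim(2) unfolding W_def compat_def by blast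
  have \<eta>: "spread W \<in> multihoms G H"
    by (rule spread_multihoms) (use r a s compat_sym compat_refl top in \<open>auto simp: W_def\<close>)
  have W: "w \<in> topspace (cell (spread W))" if "w \<in> W" for w
    using spread_cell that top by blast
  have t01: "0 \<le> t y \<and> t y \<le> 1" if "y \<in> S" for y using t(2) that .
  have "limitin (cell (spread W)) (\<lambda>n. mix (t (s (r n))) (f (s (r n))) a) (mix (t x) (f x) a) sequentially"
  proof (rule limitin_componentwise[THEN iffD2], intro conjI ballI always_eventually allI)
    show "mix (t x) (f x) a \<in> extensional (verts G)" by (simp add: mix_def)
    show "mix (t (s (r n))) (f (s (r n))) a \<in> topspace (cell (spread W))" for n
      by (rule mix_cell) (use W t01 s in \<open>auto simp: W_def\<close>)
    fix y assume y: "y \<in> verts G"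
    \<comment> \<open>A finite face that contains all supports over \<open>y\<close>; inside it,
      convergence of coordinates suffices.\<close>
    define F where "F = (\<Union>n. supp (f (s (r n)) y)) \<union> supp (f x y) \<union> supp (a y)"
    have sp: "w y \<in> simplex_points (supp (w y))" if "w \<in> W" for w
    proof -
      have "w \<in> topspace \<Delta>" using top that by blast
      then have "w y \<in> simplex_points (verts H)" using y by (simp add: topspace_hom_complex)
      then show ?thesis by (rule simplex_points_supp)
    qed
    show "limitin (simplex_space (spread W y)) (\<lambda>n. mix (t (s (r n))) (f (s (r n))) a y)
            (mix (t x) (f x) a y) sequentially"
    proof (rule limitin_simplex_space[of F])
      have "finite (\<Union>n. supp (f (s n) y))"
        by (rule convergent_finite_support[OF lim y])
      then have "finite (\<Union>n. supp (f (s (r n)) y))"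
        by (rule rev_finite_subset) blast
      moreover have "finite (supp (f x y))" "finite (supp (a y))"
        using sp finite_supp by (auto simp: W_def)
      ultimately show "finite F" by (simp add: F_def)
      show "F \<subseteq> spread W y" using y by (auto simp: F_def W_def spread_def)
      have mixF: "mix u w a y \<in> simplex_points F" if "w \<in> W" "supp (w y) \<subseteq> F" "0 \<le> u" "u \<le> 1" for u w
      proof -
        have "simplex_points (supp (w y) \<union> supp (a y)) \<subseteq> simplex_points F"
          using that by (intro simplex_points_mono) (auto simp: F_def)
        then show ?thesis
          using simplex_points_convex[OF sp sp that(3,4), of w a] that(1) y by (auto simp: mix_def W_def)
      qed
      show "mix (t (s (r n))) (f (s (r n))) a y \<in> simplex_points F" for n
        by (rule mixF) (use t01 s in \<open>auto simp: W_def F_def\<close>)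
      show "mix (t x) (f x) a y \<in> simplex_points F"
        by (rule mixF) (use t01 s in \<open>auto simp: W_def F_def\<close>)
      fix b
      have sr: "(s \<circ> r) \<longlonglongrightarrow> x" using LIMSEQ_subseq_LIMSEQ s(3) r(1) by blast
      have "limitin \<Delta> (\<lambda>n. f ((s \<circ> r) n)) (f x) sequentially"
        by (rule limitin_continuous_image(1)[OF f _ s(2) sr]) (simp add: s)
      from continuous_map_limit[OF continuous_map_coordinate[OF y, of b] this]
      have "(\<lambda>n. f (s (r n)) y b) \<longlonglongrightarrow> f x y b" by (simp add: o_def)
      moreover have "(\<lambda>n. t (s (r n))) \<longlonglongrightarrow> t x"
        using continuous_on_tendsto_compose[OF t(1) sr s(2)] s(1) by (simp add: o_def)
      ultimately show "(\<lambda>n. mix (t (s (r n))) (f (s (r n))) a y b) \<longlonglongrightarrow> mix (t x) (f x) a y b"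
        using y by (auto simp: mix_def intro!: tendsto_intros)
    qed
  qed
  from continuous_map_limit[OF continuous_map_cell[OF \<eta>] this]
  show "\<exists>r. limitin \<Delta> (\<lambda>n. mix (t (s (r n))) (f (s (r n))) a) (mix (t x) (f x) a) sequentially"
    by (auto simp: o_def)
qed

subsection \<open>Straight segments\<close>

definition segment :: "('a \<Rightarrow> 'b \<Rightarrow> real) \<Rightarrow> ('a \<Rightarrow> 'b \<Rightarrow> real) \<Rightarrow> real \<Rightarrow> 'a \<Rightarrow> 'b \<Rightarrow> real" where
  "segment z w t = mix t z w"

lemma segment_ends:
  assumes "compat z w"
  shows "segment z w 0 = z" "segment z w 1 = w"
  using assms by (simp_all add: compat_def segment_def mix_0 mix_1)

lemma pathin_segment: "compat z w \<Longrightarrow> pathin \<Delta> (segment z w)"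
  unfolding pathin_def segment_def
  by (rule continuous_map_cone) (auto simp: compat_def intro!: continuous_intros)

lemma segment_compat:
  assumes "compat z w" "compat z a" "compat w a" "t \<in> {0..1}"
  shows "compat (segment z w t) a"
  using mix_compat assms by (simp add: segment_def)

lemma segment_refl: "z \<in> topspace \<Delta> \<Longrightarrow> segment z z t = z"
  by (auto simp: segment_def mix_def topspace_hom_complex extensional_def algebra_simps)

text \<open>The cone over \<open>p\<close> is a square with \<open>p\<close> as lower side, the two
  segments to \<open>a\<close> as vertical sides and the constant path at \<open>a\<close> as upper
  side.\<close>

lemma path_equiv_cone:
  assumes p: "pathin \<Delta> p" and a: "\<And>t. t \<in> {0..1} \<Longrightarrow> compat (p t) a"
  shows "(path_concat p (segment (p 1) a), path_concat (segment (p 0) a) (\<lambda>t. a)) \<in> path_equiv \<Delta>"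
proof -
  let ?S = "{0..1::real} \<times> {0..1::real}"
  let ?h = "\<lambda>s. mix (snd s) (p (fst s)) a"
  have "continuous_map (top_of_set ?S) \<Delta> (\<lambda>s. p (fst s))"
    using continuous_map_compose[of "top_of_set ?S" "top_of_set {0..1}" fst \<Delta> p] p
    unfolding pathin_def o_def by (force simp: continuous_on_fst[OF continuous_on_id])
  then have "continuous_map (top_of_set ?S) \<Delta> ?h"
    by (rule continuous_map_cone) (use a in \<open>auto intro!: continuous_intros\<close>)
  note sq = path_equiv_square[OF this]
  have top: "a \<in> topspace \<Delta>" "\<And>t. t \<in> {0..1} \<Longrightarrow> p t \<in> topspace \<Delta>"
    using a[of 0] a by (auto simp: compat_def)
  \<comment> \<open>Outside the unit interval \<open>p\<close> is unrestricted and
    \<open>mix 0\<close> may change it, so the lower side is related to \<open>p\<close> by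
    agreement on the interval, not by equality.\<close>
  have l: "(path_concat p (segment (p 1) a), path_concat (\<lambda>t. ?h (t, 0)) (\<lambda>t. ?h (1, t))) \<in> path_equiv \<Delta>"
    using top a p by (intro path_equiv_eq_on pathin_concat pathin_segment)
      (auto simp: path_concat_def segment_def mix_0 segment_ends)
  have "path_concat (\<lambda>t. ?h (0, t)) (\<lambda>t. ?h (t, 1)) = path_concat (segment (p 0) a) (\<lambda>t. a)"
    using top by (simp add: path_concat_def segment_def mix_1 fun_eq_iff)
  then show ?thesis using path_equiv_trans[OF l sq] by simp
qed

end

context hom_graphs
begin

definition segment_class :: "('a \<Rightarrow> 'b \<Rightarrow> real) \<Rightarrow> ('a \<Rightarrow> 'b \<Rightarrow> real) \<Rightarrow> (real \<Rightarrow> 'a \<Rightarrow> 'b \<Rightarrow> real) set" where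
  "segment_class z w = path_class \<Delta> (segment z w)"

abbreviation "\<D> \<equiv> fundamental_groupoid \<Delta>"

abbreviation comp (infixl "\<cdot>" 70) where "f \<cdot> g \<equiv> Comp \<D> f g"

lemma compat_topspace: "compat z w \<Longrightarrow> z \<in> topspace \<Delta> \<and> w \<in> topspace \<Delta>"
  by (simp add: compat_def)

lemma segment_class_Hom: "compat z w \<Longrightarrow> segment_class z w \<in> Hom \<D> z w"
  using path_class_in_Hom[OF pathin_segment] segment_ends unfolding segment_class_def by metis

lemma segment_class_refl: "z \<in> topspace \<Delta> \<Longrightarrow> segment_class z z = Id \<D> z"
  using segment_refl[of z] unfolding segment_class_def Id_fundamental_groupoid by presburger

lemma segment_class_cone:
  assumes p: "pathin \<Delta> p" and a: "\<And>t. t \<in> {0..1} \<Longrightarrow> compat (p t) a"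
  shows "path_class \<Delta> p \<cdot> segment_class (p 1) a = segment_class (p 0) a"
proof -
  have c: "compat (p 0) a" "compat (p 1) a" using a by auto
  have "path_class \<Delta> p \<cdot> segment_class (p 1) a = path_class \<Delta> (path_concat p (segment (p 1) a))"
    using p c unfolding segment_class_def by (simp add: Comp_path_class pathin_segment segment_ends)
  also have "\<dots> = path_class \<Delta> (path_concat (segment (p 0) a) (\<lambda>t. a))"
    by (rule path_class_eq, rule path_equiv_cone[OF p a])
  also have "\<dots> = segment_class (p 0) a"
    using path_concat_const(2)[OF pathin_segment[OF c(1)]] c(1)
    unfolding segment_class_def by (intro path_class_eq) (simp add: segment_ends)
  finally show ?thesis .
qed

text \<open>The cone with apex \<open>a\<close> over the segment from \<open>z\<close> to
  \<open>w\<close>.\<close>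

lemma segment_class_triangle:
  assumes "compat z w" "compat w a" "compat z a"
  shows "segment_class z w \<cdot> segment_class w a = segment_class z a"
  using segment_class_cone[OF pathin_segment[OF assms(1)] segment_compat[OF assms(1,3,2)]]
  by (simp add: segment_ends assms(1) segment_class_def[symmetric])

lemma segment_class_inverse: "compat z w \<Longrightarrow> segment_class z w \<cdot> segment_class w z = Id \<D> z"
  using segment_class_triangle[of z w z] segment_class_refl compat_refl compat_sym compat_topspace by metis

text \<open>The cone formula determines the path class after composing with the segment to
  \<open>a\<close>, and that segment is invertible.\<close>

lemma path_class_in_star:
  assumes p: "pathin \<Delta> p" and a: "\<And>t. t \<in> {0..1} \<Longrightarrow> compat (p t) a"
  shows "path_class \<Delta> p = segment_class (p 0) a \<cdot> segment_class a (p 1)"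
proof -
  have c: "compat (p 0) a" "compat (p 1) a" "compat a (p 1)" using a compat_sym by auto
  note cat = is_category_fundamental_groupoid[of \<Delta>]
  note top = compat_topspace[OF c(1)] compat_topspace[OF c(2)]
  have "path_class \<Delta> p = path_class \<Delta> p \<cdot> (segment_class (p 1) a \<cdot> segment_class a (p 1))"
    using category_Id_right[OF cat path_class_in_Hom[OF p]] top segment_class_inverse[OF c(2)] by simp
  also have "\<dots> = path_class \<Delta> p \<cdot> segment_class (p 1) a \<cdot> segment_class a (p 1)"
    using category_assoc[OF cat path_class_in_Hom[OF p] segment_class_Hom[OF c(2)] segment_class_Hom[OF c(3)]]
      top by simp
  finally show ?thesis using segment_class_cone[OF p a] by simp
qed

subsection \<open>Vertices of the hom complex\<close>

abbreviation "K \<equiv> exp_graph H G"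

lemma edges_K: "(f, g) \<in> edges K \<longleftrightarrow> f \<in> verts G \<rightarrow>\<^sub>E verts H \<and> g \<in> verts G \<rightarrow>\<^sub>E verts H \<and>
    (\<forall>x y. (x, y) \<in> edges G \<longrightarrow> (f x, g y) \<in> edges H)"
  by (auto simp: exp_graph_def)

lemma graph_K: "is_graph K"
  unfolding is_graph_def
proof (intro conjI symI)
  show "edges K \<subseteq> verts K \<times> verts K" by (auto simp: exp_graph_def)
  fix f g assume "(f, g) \<in> edges K"
  then show "(g, f) \<in> edges K"
    unfolding edges_K using edges_G edges_H by blast
qed

lemma looped_verts_K: "f \<in> looped_verts K \<longleftrightarrow> (f, f) \<in> edges K"
  by (auto simp: looped_verts_def edges_K) (simp add: exp_graph_def)

definition dirac :: "('a \<Rightarrow> 'b) \<Rightarrow> 'a \<Rightarrow> 'b \<Rightarrow> real" where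
  "dirac f = (\<lambda>x\<in>verts G. \<lambda>b. if b = f x then 1 else 0)"

text \<open>An arbitrary choice of a vertex of the smallest cell containing \<open>z\<close>; no
  continuity is asked of it.\<close>

definition vertex :: "('a \<Rightarrow> 'b \<Rightarrow> real) \<Rightarrow> 'a \<Rightarrow> 'b" where
  "vertex z = (\<lambda>x\<in>verts G. SOME b. z x b \<noteq> 0)"

lemma supp_dirac: "x \<in> verts G \<Longrightarrow> supp (dirac f x) = {f x}"
  by (simp add: dirac_def)

lemma dirac_simplex: "x \<in> verts G \<Longrightarrow> dirac f x \<in> simplex_points S \<longleftrightarrow> f x \<in> S"
  by (subst simplex_points_sum[of "{f x}"]) (auto simp: dirac_def)

lemma dirac_topspace:
  assumes "f \<in> looped_verts K"
  shows "dirac f \<in> topspace \<Delta>"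
proof -
  have f: "f \<in> verts G \<rightarrow>\<^sub>E verts H" "\<And>x y. (x, y) \<in> edges G \<Longrightarrow> (f x, f y) \<in> edges H"
    using assms unfolding looped_verts_K edges_K by blast+
  have "supp (dirac f x) \<times> supp (dirac f y) \<subseteq> edges H" if "(x, y) \<in> edges G" for x y
    using f(2)[OF that] edges_G[OF that] supp_dirac by simp
  moreover have "dirac f x \<in> simplex_points (verts H)" if "x \<in> verts G" for x
    using f(1) that by (auto simp: dirac_simplex)
  moreover have "dirac f \<in> extensional (verts G)" by (simp add: dirac_def)
  ultimately show ?thesis unfolding topspace_hom_complex by (simp add: case_prod_unfold)
qed

lemma dirac_compat:
  assumes "f \<in> looped_verts K" "g \<in> looped_verts K" "(f, g) \<in> edges K"
  shows "compat (dirac f) (dirac g)"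
proof -
  have "supp (dirac f x) \<times> supp (dirac g y) \<subseteq> edges H" if "(x, y) \<in> edges G" for x y
    using assms(3) that edges_G[OF that] supp_dirac unfolding edges_K by simp
  then show ?thesis
    using dirac_topspace assms unfolding compat_def by (simp add: case_prod_unfold)
qed

lemma vertex_supp:
  assumes "z \<in> topspace \<Delta>" "x \<in> verts G"
  shows "vertex z x \<in> supp (z x)"
proof -
  have "\<exists>b. z x b \<noteq> 0"
    using assms supp_nonempty unfolding topspace_hom_complex by blast
  then have "z x (SOME b. z x b \<noteq> 0) \<noteq> 0" by (rule someI_ex)
  then show ?thesis using assms(2) by (simp add: vertex_def)
qed

lemma vertex_edge:
  assumes "compat z w"
  shows "(vertex z, vertex w) \<in> edges K"
proof -
  note top = compat_topspace[OF assms]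
  have "vertex u \<in> verts G \<rightarrow>\<^sub>E verts H" if "u \<in> topspace \<Delta>" for u
  proof
    fix x assume x: "x \<in> verts G"
    then have "supp (u x) \<subseteq> verts H"
      using that unfolding topspace_hom_complex by (simp add: simplex_points_def)
    then show "vertex u x \<in> verts H" using vertex_supp[OF that x] by blast
  qed (simp add: vertex_def)
  moreover have "(vertex z x, vertex w y) \<in> edges H" if "(x, y) \<in> edges G" for x y
  proof -
    have "supp (z x) \<times> supp (w y) \<subseteq> edges H" using assms that by (auto simp: compat_def)
    then show ?thesis using vertex_supp top edges_G[OF that] by blast
  qed
  ultimately show ?thesis using top unfolding edges_K by blast
qed

lemma vertex_looped: "z \<in> topspace \<Delta> \<Longrightarrow> vertex z \<in> looped_verts K"
  using vertex_edge compat_refl unfolding looped_verts_K by blast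

text \<open>The supports of a 0-cell are singletons, so the choice is forced.\<close>

lemma vertex_dirac: "f \<in> looped_verts K \<Longrightarrow> vertex (dirac f) = f"
  unfolding looped_verts_K edges_K by (auto simp: vertex_def dirac_def fun_eq_iff PiE_iff extensional_def)

text \<open>Passing from \<open>z\<close> to its chosen vertex shrinks the supports, which preserves
  compatibility with every other point.\<close>

lemma dirac_vertex_compat:
  assumes "compat z w"
  shows "compat (dirac (vertex z)) w"
proof -
  note top = compat_topspace[OF assms]
  have "supp (dirac (vertex z) x) \<times> supp (w y) \<subseteq> edges H" if "(x, y) \<in> edges G" for x y
  proof -
    have "supp (z x) \<times> supp (w y) \<subseteq> edges H" using assms that by (auto simp: compat_def)
    moreover have "supp (dirac (vertex z) x) \<subseteq> supp (z x)"
      using supp_dirac[of x] vertex_supp[of z x] top edges_G[OF that] by simp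
    ultimately show ?thesis by blast
  qed
  then show ?thesis
    using dirac_topspace vertex_looped top unfolding compat_def by (simp add: case_prod_unfold)
qed

subsection \<open>The equivalence\<close>

sublocale realise: walk_representation K \<D> dirac "\<lambda>f g. segment_class (dirac f) (dirac g)"
proof
  fix x y z
  assume "x \<in> looped_verts K" "y \<in> looped_verts K" "z \<in> looped_verts K"
    "(x, y) \<in> edges K" "(y, z) \<in> edges K" "(x, z) \<in> edges K"
  then show "segment_class (dirac x) (dirac y) \<cdot> segment_class (dirac y) (dirac z) =
      segment_class (dirac x) (dirac z)"
    by (simp add: segment_class_triangle dirac_compat)
qed (simp_all add: graph_K is_category_fundamental_groupoid dirac_topspace segment_class_Hom
    dirac_compat segment_class_refl)

abbreviation "\<C> \<equiv> looped_fundamental_groupoid K"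

lemma vertex_walks:
  assumes "compat z w"
  shows "looped_walk K [vertex z, vertex w]"
  using assms vertex_looped vertex_edge compat_topspace by (simp add: looped_walk_iff[OF graph_K])

text \<open>Pairwise compatible points have pairwise adjacent vertices, so \<open>e_triangle\<close>
  is exactly the triangle move on walks. Both locality axioms are instances of
  \<open>locally_compat\<close>.\<close>

sublocale combinatorial: topological_local_system \<C> compat vertex "\<lambda>z w. walk_class K [vertex z, vertex w]" \<Delta>
proof
  show "is_category \<C>" using is_category_looped_fundamental_groupoid graph_K by blast
  fix z w a
  show "compat z w \<Longrightarrow> compat w z" by (rule compat_sym)
  show "compat z w \<Longrightarrow> compat z z" using compat_refl compat_topspace by blast
  show "compat z z \<Longrightarrow> vertex z \<in> Obj \<C>" using vertex_looped compat_topspace by simp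
  show "walk_class K [vertex z, vertex w] \<in> Hom \<C> (vertex z) (vertex w)" if "compat z w"
    using vertex_walks[OF that] by (force simp: Hom_looped_fundamental_groupoid)
  show "walk_class K [vertex z, vertex z] = Id \<C> (vertex z)" if "compat z z"
    using walk_equiv_dup[of K "[]" "vertex z" "[]"] vertex_walks[OF that]
    by (simp add: Id_looped_fundamental_groupoid walk_class_eq looped_walk_iff[OF graph_K])
  show "Comp \<C> (walk_class K [vertex z, vertex w]) (walk_class K [vertex w, vertex a]) =
      walk_class K [vertex z, vertex a]" if "compat z w" "compat w a" "compat z a"
    using walk_equiv_triangle[OF graph_K, of "[]" "vertex z" "vertex w" "vertex a" "[]"]
      vertex_walks that vertex_edge[OF that(3)]
    by (simp add: Comp_walk_class[OF graph_K] walk_class_eq looped_walk_iff[OF graph_K])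
  show "z \<in> topspace \<Delta> \<Longrightarrow> compat z z" by (rule compat_refl)
next
  fix p and x :: real assume "pathin \<Delta> p" "x \<in> {0..1}"
  then show "\<exists>d>0. \<forall>t\<in>{0..1}. dist t x < d \<longrightarrow> compat (p t) (p x)"
    unfolding pathin_def by (rule locally_compat)
next
  fix h :: "real \<times> real \<Rightarrow> 'a \<Rightarrow> 'b \<Rightarrow> real" and x :: "real \<times> real"
  assume "continuous_map (top_of_set ({0..1} \<times> {0..1})) \<Delta> h" "x \<in> {0..1} \<times> {0..1}"
  then show "\<exists>d>0. \<forall>y\<in>{0..1} \<times> {0..1}. dist y x < d \<longrightarrow> compat (h y) (h x)"
    by (rule locally_compat)
qed

abbreviation "\<Phi> \<equiv> realise.lift"
abbreviation "\<Psi> \<equiv> combinatorial.transport_class"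

text \<open>The whole segment lies in the star of its starting point, so its transport is a single
  step.\<close>

lemma transport_segment:
  assumes "compat z w"
  shows "\<Psi> (segment_class z w) = walk_class K [vertex z, vertex w]"
proof -
  have "compat (segment z w t) (segment z w 0)" if "t \<in> {0..1}" for t
    using segment_compat[OF assms _ _ that, of z] assms compat_refl compat_sym compat_topspace segment_ends
    by metis
  from combinatorial.transport_class_in_star[OF pathin_segment[OF assms] this]
  show ?thesis by (simp add: segment_class_def segment_ends assms)
qed

lemma transport_realise_walk: "looped_walk K \<alpha> \<Longrightarrow> \<Psi> (\<Phi> (walk_class K \<alpha>)) = walk_class K \<alpha>"
proof (induction \<alpha> rule: induct_list012)
  case (2 f)
  then have f: "f \<in> looped_verts K" by (simp add: looped_walk_iff[OF graph_K])
  then have "\<Psi> (Id \<D> (dirac f)) = Id \<C> (vertex (dirac f))"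
    using combinatorial.is_functor_transport dirac_topspace unfolding is_functor_def by simp
  then show ?case
    by (simp add: realise.lift_class f vertex_dirac Id_looped_fundamental_groupoid)
next
  case (3 f g \<alpha>)
  have w: "looped_walk K (g # \<alpha>)" "looped_walk K [f, g]" and fg: "f \<in> looped_verts K" "g \<in> looped_verts K" "(f, g) \<in> edges K"
    using 3 by (auto simp: looped_walk_iff[OF graph_K])
  have last: "last (g # \<alpha>) \<in> looped_verts K"
    using w(1) last_in_set[of "g # \<alpha>"] unfolding looped_walk_iff[OF graph_K] by blast
  have c: "compat (dirac f) (dirac g)" by (rule dirac_compat[OF fg])
  have ev: "realise.ev (g # \<alpha>) \<in> Hom \<D> (dirac g) (dirac (last (g # \<alpha>)))"
    using realise.ev_Hom[OF w(1)] by simp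
  have "\<Psi> (\<Phi> (walk_class K (f # g # \<alpha>))) =
      \<Psi> (segment_class (dirac f) (dirac g) \<cdot> realise.ev (g # \<alpha>))"
    by (simp add: realise.lift_class)
  also have "\<dots> = Comp \<C> (\<Psi> (segment_class (dirac f) (dirac g))) (\<Psi> (realise.ev (g # \<alpha>)))"
    using functor_Comp[OF combinatorial.is_functor_transport _ _ _ segment_class_Hom[OF c] ev]
      dirac_topspace fg last by simp
  also have "\<dots> = Comp \<C> (walk_class K [f, g]) (walk_class K (g # \<alpha>))"
    using 3 w by (simp add: transport_segment c vertex_dirac fg realise.lift_class)
  also have "\<dots> = walk_class K (f # g # \<alpha>)"
    using Comp_walk_class[OF graph_K w(2,1)] by simp
  finally show ?case .
qed (simp add: looped_walk_def)

text \<open>The component at \<open>z\<close> of the natural isomorphism on the topological side. In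
  spite of the name, the arrow runs from the chosen vertex to \<open>z\<close>.\<close>

definition to_vertex :: "('a \<Rightarrow> 'b \<Rightarrow> real) \<Rightarrow> (real \<Rightarrow> 'a \<Rightarrow> 'b \<Rightarrow> real) set" where
  "to_vertex z = segment_class (dirac (vertex z)) z"

lemma to_vertex_compat: "z \<in> topspace \<Delta> \<Longrightarrow> compat (dirac (vertex z)) z"
  using dirac_vertex_compat compat_refl by blast

lemma is_iso_to_vertex: "z \<in> topspace \<Delta> \<Longrightarrow> is_iso \<D> (dirac (vertex z)) z (to_vertex z)"
  unfolding is_iso_def to_vertex_def
  using to_vertex_compat[of z] compat_sym segment_class_Hom segment_class_inverse by blast

text \<open>The naturality square at one arrow, isolated because it is proved piece by piece along a
  path.\<close>

definition natural_at :: "('a \<Rightarrow> 'b \<Rightarrow> real) \<Rightarrow> ('a \<Rightarrow> 'b \<Rightarrow> real) \<Rightarrow> (real \<Rightarrow> 'a \<Rightarrow> 'b \<Rightarrow> real) set \<Rightarrow> bool" where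
  "natural_at z w A \<longleftrightarrow> \<Phi> (\<Psi> A) \<cdot> to_vertex w = to_vertex z \<cdot> A"

text \<open>Both composites equal the segment from the chosen vertex of \<open>z\<close> to
  \<open>w\<close>, by two triangles that share this side.\<close>

lemma natural_at_segment:
  assumes "compat z w"
  shows "natural_at z w (segment_class z w)"
proof -
  note top = compat_topspace[OF assms]
  have c: "compat (dirac (vertex z)) (dirac (vertex w))"
    using dirac_compat vertex_looped vertex_edge assms top by blast
  have "\<Phi> (\<Psi> (segment_class z w)) = segment_class (dirac (vertex z)) (dirac (vertex w))"
    using realise.lift_edge vertex_looped vertex_edge assms top by (simp add: transport_segment)
  then show ?thesis
    unfolding natural_at_def to_vertex_def
    using segment_class_triangle[OF c to_vertex_compat dirac_vertex_compat[OF assms]]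
      segment_class_triangle[OF to_vertex_compat assms dirac_vertex_compat[OF assms]] top by simp
qed

lemma natural_at_comp:
  assumes A: "A \<in> Hom \<D> z w" and B: "B \<in> Hom \<D> w a"
    and top: "z \<in> topspace \<Delta>" "w \<in> topspace \<Delta>" "a \<in> topspace \<Delta>"
    and nat: "natural_at z w A" "natural_at w a B"
  shows "natural_at z a (A \<cdot> B)"
proof -
  note cat = is_category_fundamental_groupoid[of \<Delta>]
  note FT = combinatorial.is_functor_transport and FR = realise.is_functor_lift
  have TA: "\<Psi> A \<in> Hom \<C> (vertex z) (vertex w)" and TB: "\<Psi> B \<in> Hom \<C> (vertex w) (vertex a)"
    using functor_Hom[OF FT _ _ A] functor_Hom[OF FT _ _ B] top by auto
  have v: "vertex u \<in> Obj \<C>" "dirac (vertex u) \<in> Obj \<D>" if "u \<in> topspace \<Delta>" for u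
    using that vertex_looped dirac_topspace by auto
  have RA: "\<Phi> (\<Psi> A) \<in> Hom \<D> (dirac (vertex z)) (dirac (vertex w))"
    and RB: "\<Phi> (\<Psi> B) \<in> Hom \<D> (dirac (vertex w)) (dirac (vertex a))"
    using functor_Hom[OF FR _ _ TA] functor_Hom[OF FR _ _ TB] v top by auto
  have E: "to_vertex u \<in> Hom \<D> (dirac (vertex u)) u" if "u \<in> topspace \<Delta>" for u
    using is_iso_to_vertex[OF that] by (simp add: is_iso_def)
  have "\<Phi> (\<Psi> (A \<cdot> B)) = \<Phi> (\<Psi> A) \<cdot> \<Phi> (\<Psi> B)"
    using functor_Comp[OF FT _ _ _ A B] functor_Comp[OF FR _ _ _ TA TB] v top by simp
  then have "\<Phi> (\<Psi> (A \<cdot> B)) \<cdot> to_vertex a = \<Phi> (\<Psi> A) \<cdot> (\<Phi> (\<Psi> B) \<cdot> to_vertex a)"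
    using category_assoc[OF cat RA RB E[OF top(3)]] v top by simp
  also have "\<dots> = \<Phi> (\<Psi> A) \<cdot> (to_vertex w \<cdot> B)"
    using nat(2) by (simp add: natural_at_def)
  also have "\<dots> = \<Phi> (\<Psi> A) \<cdot> to_vertex w \<cdot> B"
    using category_assoc[OF cat RA E[OF top(2)] B] v top by simp
  also have "\<dots> = to_vertex z \<cdot> A \<cdot> B"
    using nat(1) by (simp add: natural_at_def)
  also have "\<dots> = to_vertex z \<cdot> (A \<cdot> B)"
    using category_assoc[OF cat E[OF top(1)] A B] v top by simp
  finally show ?thesis by (simp add: natural_at_def)
qed

text \<open>On a short interval the subpath lies in the star of some \<open>p c\<close> and is
  homotopic to the two segments through \<open>p c\<close>, for which naturality is known;
  \<open>natural_at_comp\<close> pastes these squares.\<close>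

lemma natural_at_path:
  assumes p: "pathin \<Delta> p"
  shows "natural_at (p 0) (p 1) (path_class \<Delta> p)"
proof -
  have sub_Hom: "path_class \<Delta> (restrict_path p a b) \<in> Hom \<D> (p a) (p b)"
    if "0 \<le> a" "a \<le> b" "b \<le> 1" for a b
    using path_class_in_Hom[OF pathin_restrict_path[OF p that]] by simp
  have top: "p t \<in> topspace \<Delta>" if "0 \<le> t" "t \<le> 1" for t
    using p that by (auto simp: pathin_def continuous_map_def)
  have "natural_at (p 0) (p 1) (path_class \<Delta> (restrict_path p 0 1))"
  proof (rule combinatorial.tame_interval_induct[OF _ combinatorial.tame_path[OF p]])
    fix x y z :: real assume *: "0 \<le> x" "x \<le> y" "y \<le> z" "z \<le> 1"
      "natural_at (p x) (p y) (path_class \<Delta> (restrict_path p x y))"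
      "natural_at (p y) (p z) (path_class \<Delta> (restrict_path p y z))"
    then show "natural_at (p x) (p z) (path_class \<Delta> (restrict_path p x z))"
      unfolding path_class_restrict_path[OF p *(1-4)]
      by (intro natural_at_comp[of _ "p x" "p y" _ "p z"] sub_Hom top) auto
  next
    fix x y c :: real assume *: "0 \<le> x" "x \<le> c" "c \<le> y" "y \<le> 1"
      "\<And>t. x \<le> t \<Longrightarrow> t \<le> y \<Longrightarrow> compat (p t) (p c)"
    have "compat (restrict_path p x y t) (p c)" if "t \<in> {0..1}" for t
      using restrict_path_range[of x y t] *(5)[of "x + (y - x) * t"] * that by (simp add: restrict_path_def)
    from path_class_in_star[OF pathin_restrict_path[OF p] this]
    have "path_class \<Delta> (restrict_path p x y) = segment_class (p x) (p c) \<cdot> segment_class (p c) (p y)"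
      using * by simp
    moreover have "compat (p x) (p c)" "compat (p c) (p y)"
      using *(5)[of x] *(5)[of y] * compat_sym by auto
    ultimately show "natural_at (p x) (p y) (path_class \<Delta> (restrict_path p x y))"
      using natural_at_comp[OF segment_class_Hom segment_class_Hom _ _ _ natural_at_segment natural_at_segment]
        compat_topspace by metis
  qed simp
  moreover have "restrict_path p 0 1 = p" by (simp add: restrict_path_def fun_eq_iff)
  ultimately show ?thesis by simp
qed

theorem equivalent_groupoids: "equivalent_categories \<C> \<D>"
  unfolding equivalent_categories_def
proof (intro conjI exI)
  show cat: "is_category \<C>" "is_category \<D>"
    by (rule is_category_looped_fundamental_groupoid[OF graph_K], rule is_category_fundamental_groupoid)
  show "is_functor \<C> \<D> dirac \<Phi>" by (rule realise.is_functor_lift)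
  show "is_functor \<D> \<C> vertex \<Psi>" by (rule combinatorial.is_functor_transport)
  \<comment> \<open>Both composites \<open>vertex \<circ> dirac\<close> and
    \<open>\<Psi> \<circ> \<Phi>\<close> are identities on objects and arrows of
    \<open>\<C>\<close>, so identities serve as components.\<close>
  show "is_natural_iso \<C> \<C> id id (vertex \<circ> dirac) (\<Psi> \<circ> \<Phi>) (Id \<C>)"
    unfolding is_natural_iso_def
  proof (intro conjI ballI)
    fix f assume f: "f \<in> Obj \<C>"
    have "Id \<C> f \<in> Hom \<C> f f" "Comp \<C> (Id \<C> f) (Id \<C> f) = Id \<C> f"
      using category_Id[OF cat(1) f] category_Id_left[OF cat(1) _ f f] by blast+
    then show "is_iso \<C> (id f) ((vertex \<circ> dirac) f) (Id \<C> f)"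
      using f by (auto simp: is_iso_def vertex_dirac)
  next
    fix f g A assume "f \<in> Obj \<C>" "g \<in> Obj \<C>" "A \<in> Hom \<C> f g"
    moreover from this have "\<Psi> (\<Phi> A) = A"
      using transport_realise_walk by (auto simp: Hom_looped_fundamental_groupoid)
    ultimately show "Comp \<C> (id A) (Id \<C> g) = Comp \<C> (Id \<C> f) ((\<Psi> \<circ> \<Phi>) A)"
      using category_Id_left[OF cat(1)] category_Id_right[OF cat(1)] by simp
  qed
  show "is_natural_iso \<D> \<D> (dirac \<circ> vertex) (\<Phi> \<circ> \<Psi>) id id to_vertex"
    unfolding is_natural_iso_def
  proof (intro conjI ballI)
    fix z assume "z \<in> Obj \<D>"
    then show "is_iso \<D> ((dirac \<circ> vertex) z) (id z) (to_vertex z)"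
      using is_iso_to_vertex by simp
  next
    fix z w A assume "A \<in> Hom \<D> z w"
    then show "(\<Phi> \<circ> \<Psi>) A \<cdot> to_vertex w = to_vertex z \<cdot> id A"
      using natural_at_path unfolding Hom_fundamental_groupoid natural_at_def by auto
  qed
qed

end

theorem theorem6p6:
  fixes G :: "'a ugraph" and H :: "'b ugraph"
  assumes "is_graph G" and "is_graph H"
  shows "equivalent_categories
           (looped_fundamental_groupoid (exp_graph H G))
           (fundamental_groupoid (hom_complex G H))"
proof -
  interpret hom_graphs G H using assms by unfold_locales
  show ?thesis by (rule equivalent_groupoids)
qed

end
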